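(* Assume Conditions 1--4 stated in the context. Then, as $n\to\infty$, the $K$-fold cross-validation weight vector $\widehat{\mathbf w}$ satisfies $$\frac{\mathrm{EFPE}_n(\widehat{\mathbf w})}{\inf_{\mathbf w\in\mathcal W}\mathrm{EFPE}_n(\mathbf w)}=1+O_p\left\{\eta_n^{-1}n\left(c_n+g_n+n^{-1/2}|\mathcal J|^{1/2}\right)\right\}=1+o_p(1).$$
   Context: **Model.** Fix $\tau\in(0,1)$ and a compact interval $\mathcal T\subset\mathbb R$. $\{(Y_i,X_i)\}_{i=1}^n$ are i.i.d., $Y_i$ a real random variable, $X_i=\{X_i(t):t\in\mathcal T\}$ a random function with mean function $\mu(t)=E\{X_i(t)\}$ and covariance function $G(s,t)=\mathrm{Cov}\{X_i(s),X_i(t)\}=\sum_{j\ge1}\kappa_j\phi_j(s)\phi_j(t)$, where $\kappa_1\ge\kappa_2\ge\cdots>0$ and $\{\phi_j\}$ is an orthonormal basis of $L_2(\mathcal T)$. Put $X_i^c=X_i-\mu$. The $\tau$th conditional quantile of $Y_i$ given $X_i$ is $Q_\tau(X_i)=a+\int_{\mathcal T}b(t)X_i^c(t)\,dt$ with $a\in\mathbb R$, $b\in L_2(\mathcal T)$. Let $\varepsilon_i=Y_i-Q_\tau(X_i)$, so $P(\varepsilon_i\le0\mid X_i)=\tau$ a.s., and let $F(\cdot\mid X_i)$ be the conditional distribution function of $\varepsilon_i$ given $X_i$. Let $\rho_\tau(e)=[\tau-\mathbf 1\{e\le0\}]e$. **Observations.** One observes $U_{il}=X_i(T_{il})+\epsilon_{il}$,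 $T_{il}\in\mathcal T$, $l=1,\dots,N_i$, where the $\epsilon_{il}$ are i.i.d. with mean zero and finite variance $\sigma_u^2$, independent of the $X_i$. $\mathcal D_n=\{(Y_i,T_{il},U_{il}):l=1,\dots,N_i;\ i=1,\dots,n\}$. $(Y_0,X_0)$ is an independent copy of the $(Y_i,X_i)$, with $\varepsilon_0=Y_0-Q_\tau(X_0)$; only $\{(T_{0l},U_{0l})\}_{l=1}^{N_0}$, with $U_{0l}=X_0(T_{0l})+\epsilon_{0l}$, is observed for $X_0$. With $\mathcal D_0=\{(T_{0l},X_0(T_{0l}),\epsilon_{0l}):l\le N_0\}$, the conditional distribution of $\varepsilon_0$ given $(\mathcal D_n,\mathcal D_0,X_0)$ is $F(\cdot\mid X_0)$. All expectations written below are understood to be finite. **Estimators.** $\widehat\mu$ and $\widehat G$ are the estimators of $\mu$ and $G$ obtained from the data $\{(T_{il},U_{il})\}_{i=1}^n$ by local linear smoothing (kernel and bandwidths are not fixed; the required accuracy is encoded in the Conditions), $\widehat\sigma_u^2$ is an estimate of $\sigma_u^2$, and $\widehat G(s,t)=\sum_{j\ge1}\widehat\kappa_j\widehat\phi_j(s)\widehat\phi_j(t)$ is the spectral decomposition, $\widehat\kappa_1\ge\widehat\kappa_2\ge\cdots\ge0$. For $i=0,1,\dots,n$ put $\mathbf U_i=(U_{i1},\dots,U_{iN_i})^\top$, $\widehat{\boldsymbol\phi}_{ij}=(\widehat\phi_j(T_{i1}),\dots,\widehat\phi_j(T_{iN_i}))^\top$, $\widehat{\boldsymbol\mu}_i=(\widehat\mu(T_{i1}),\dots,\widehat\mu(T_{iN_i}))^\top$,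 $\widehat{\boldsymbol\Sigma}_{\mathbf U_i}=\{\widehat G(T_{il},T_{il'})+\widehat\sigma_u^2\mathbf 1\{l=l'\}\}_{l,l'=1}^{N_i}$, and $\widehat\xi_{ij}=\widehat\kappa_j\widehat{\boldsymbol\phi}_{ij}^\top\widehat{\boldsymbol\Sigma}_{\mathbf U_i}^{-1}(\mathbf U_i-\widehat{\boldsymbol\mu}_i)$. The set $\mathcal J$ of candidate models is a predetermined finite set of numbers $J_n$ of principal components (it may depend on $n$); $|\mathcal J|$ is its cardinality. For $J_n\in\mathcal J$, $$(\widehat a_{J_n},\widehat b_{1,J_n},\dots,\widehat b_{J_n,J_n})=\arg\min_{a,b_1,\dots,b_{J_n}}\sum_{i=1}^n\rho_\tau\Big(Y_i-a-\sum_{j=1}^{J_n}b_j\widehat\xi_{ij}\Big),\qquad \widehat b_{J_n}(t)=\sum_{j=1}^{J_n}\widehat b_{j,J_n}\widehat\phi_j(t),$$ $\widehat X_{i,J_n}(t)=\widehat\mu(t)+\sum_{j=1}^{J_n}\widehat\xi_{ij}\widehat\phi_j(t)$ and $\widehat Q_{\tau,J_n}(X_i)=\widehat a_{J_n}+\int_{\mathcal T}\widehat b_{J_n}(t)\{\widehat X_{i,J_n}(t)-\widehat\mu(t)\}\,dt$, $i=0,1,\dots,n$. **Model averaging.** $\mathcal W=\{\mathbf w=(w_{J_n})_{J_n\in\mathcal J}:w_{J_n}\ge0,\ \sum_{J_n\in\mathcal J}w_{J_n}=1\}$ and $\widehat Q_\tau(X_i,\mathbf w)=\sum_{J_n\in\mathcal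 J}w_{J_n}\widehat Q_{\tau,J_n}(X_i)$. The data are divided into $K\ge2$ groups, each of size $M=\lfloor n/K\rfloor$, the $k$th group having indices $(k-1)M+1,\dots,kM$. Let $\widehat a^{[-k]}_{J_n}$, $\widehat b^{[-k]}_{J_n}(t)$ be the intercept and slope function estimates obtained from all observations except those of the $k$th group. For $i$ in the $k$th group, $\widehat Q^{[-k]}_{\tau,J_n}(X_i)=\widehat a^{[-k]}_{J_n}+\int_{\mathcal T}\widehat b^{[-k]}_{J_n}(t)\{\widehat X_{i,J_n}(t)-\widehat\mu(t)\}\,dt$ (with $\widehat\mu$, $\widehat X_{i,J_n}$ computed from all data), and $\widehat Q^{[-k]}_\tau(X_i,\mathbf w)=\sum_{J_n\in\mathcal J}w_{J_n}\widehat Q^{[-k]}_{\tau,J_n}(X_i)$. Define $$\mathrm{CV}_K(\mathbf w)=\frac1n\sum_{k=1}^K\sum_{m=1}^M\rho_\tau\Big(Y_{(k-1)M+m}-\widehat Q^{[-k]}_\tau(X_{(k-1)M+m},\mathbf w)\Big),\qquad \widehat{\mathbf w}=\arg\min_{\mathbf w\in\mathcal W}\mathrm{CV}_K(\mathbf w).$$ **Prediction errors.** $\mathrm{FPE}_n(\mathbf w)=E\{\rho_\tau(Y_0-\widehat Q_\tau(X_0,\mathbf w))\mid\mathcal D_n\}$ and $\mathrm{EFPE}_n(\mathbf w)=\mathrm{FPE}_n(\mathbf w)-E\{\rho_\tau(\varepsilon_0)\}$, viewed as functions of $\mathbf w$; $\mathrm{EFPE}_n(\widehat{\mathbf w})$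 is this function evaluated at $\widehat{\mathbf w}$. **Conditions.** All limits are as $n\to\infty$; "$O_p$ uniformly" means the supremum of the absolute value over the stated indices is $O_p$. Condition 1: there exist a constant $a^*_{J_n}$, functions $b^*_{J_n}(t)$, $X^*_{i,J_n}(t)$, $X^*_{0,J_n}(t)$, and a sequence $c_n\to0$ such that $\widehat a_{J_n}-a^*_{J_n}=O_p(c_n)$, $\widehat b_{J_n}(t)-b^*_{J_n}(t)=O_p(c_n)$, $\widehat\mu(t)-\mu(t)=O_p(c_n)$, $\widehat X_{i,J_n}(t)-X^*_{i,J_n}(t)=O_p(c_n)$ and $E\{|\widehat X_{0,J_n}(t)-X^*_{0,J_n}(t)|\mid\mathcal D_n\}=O_p(c_n)$ uniformly for $t\in\mathcal T$, $J_n\in\mathcal J$, $i\in\{1,\dots,n\}$. Notation: for $i=0,1,\dots,n$, $Q^*_{\tau,J_n}(X_i)=a^*_{J_n}+\int_{\mathcal T}b^*_{J_n}(t)\{X^*_{i,J_n}(t)-\mu(t)\}\,dt$ and $Q^*_\tau(X_i,\mathbf w)=\sum_{J_n\in\mathcal J}w_{J_n}Q^*_{\tau,J_n}(X_i)$ (as the notation indicates, $Q^*_{\tau,J_n}(\cdot)$ is regarded as a nonrandom functional, the same for every $i$, evaluated at $X_i$). Further, $\mathrm{EFPE}^*_n(\mathbf w)=E\{\rho_\tau(Y_0-Q^*_\tau(X_0,\mathbf w))\}-E\{\rho_\tau(\varepsilon_0)\}$ and $\eta_n=n\inf_{\mathbf w\in\mathcal W}\mathrm{EFPE}^*_n(\mathbf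 w)$. Condition 2: there is a constant $\varrho>0$ with $|Q^*_{\tau,J_n}(X_i)-Q_\tau(X_i)|\le\varrho$ a.s. uniformly for $i\in\{0,1,\dots,n\}$ and $J_n\in\mathcal J$. Condition 3: there is a sequence $g_n\to0$ such that $\widehat Q_\tau(X_{(k-1)M+m},\mathbf w)-\widehat Q^{[-k]}_\tau(X_{(k-1)M+m},\mathbf w)=O_p(g_n)$ uniformly for $\mathbf w\in\mathcal W$, $k\in\{1,\dots,K\}$, $m\in\{1,\dots,M\}$. Condition 4: $\eta_n^{-1}n^{1/2}|\mathcal J|^{1/2}=o(1)$, $\eta_n^{-1}nc_n=o(1)$ and $\eta_n^{-1}ng_n=o(1)$.
   Formalization: Added assumption, without which the claim can fail: uniformly over candidate models, the integral of |b*| is O(1), and both the sample average of the integral of |X*_i − μ| and the conditional mean given D_n of the integral of |X*_0 − μ| are finite and O_p(1). *)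

theory Defs
  imports "HOL-Probability.Probability" "Jordan_Normal_Form.Gauss_Jordan_Elimination"
begin

text \<open>
  The exceptional event is a measurable set containing the bad outcomes, so that suprema over
  uncountable index sets and arbitrary selections of minimisers need not be measurable. For
  measurable \<^term>\<open>Z\<close> these are the usual notions; \<open>unif_Op\<close> says that the supremum of
  \<open>\<bar>Z n x\<bar>\<close> over \<open>x \<in> S n\<close> is \<open>O\<^sub>p(r n)\<close>.
\<close>

definition unif_Op ::
  "'w measure \<Rightarrow> (nat \<Rightarrow> 'i set) \<Rightarrow> (nat \<Rightarrow> 'i \<Rightarrow> 'w \<Rightarrow> real) \<Rightarrow> (nat \<Rightarrow> real) \<Rightarrow> bool" where
  "unif_Op M S Z r \<longleftrightarrow>
     (\<forall>e>0. \<exists>C. \<forall>\<^sub>F n in sequentially. \<exists>A\<in>sets M. measure M A \<ge> 1 - e \<and>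
        (\<forall>\<omega>\<in>A. \<forall>x\<in>S n. \<bar>Z n x \<omega>\<bar> \<le> C * \<bar>r n\<bar>))"

definition big_Op :: "'w measure \<Rightarrow> (nat \<Rightarrow> 'w \<Rightarrow> real) \<Rightarrow> (nat \<Rightarrow> real) \<Rightarrow> bool" where
  "big_Op M Z r \<longleftrightarrow>
     (\<forall>e>0. \<exists>C. \<forall>\<^sub>F n in sequentially. \<exists>A\<in>sets M. measure M A \<ge> 1 - e \<and>
        (\<forall>\<omega>\<in>A. \<bar>Z n \<omega>\<bar> \<le> C * \<bar>r n\<bar>))"

definition little_op1 :: "'w measure \<Rightarrow> (nat \<Rightarrow> 'w \<Rightarrow> real) \<Rightarrow> bool" where
  "little_op1 M Z \<longleftrightarrow>
     (\<forall>d>0. \<forall>e>0. \<forall>\<^sub>F n in sequentially. \<exists>A\<in>sets M. measure M A \<ge> 1 - e \<and>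
        (\<forall>\<omega>\<in>A. \<bar>Z n \<omega>\<bar> \<le> d))"

definition L2_on :: "real set \<Rightarrow> (real \<Rightarrow> real) set" where
  "L2_on S = {f. set_borel_measurable lborel S f \<and> set_integrable lborel S (\<lambda>t. (f t)\<^sup>2)}"

definition inner_on :: "real set \<Rightarrow> (real \<Rightarrow> real) \<Rightarrow> (real \<Rightarrow> real) \<Rightarrow> real" where
  "inner_on S f g = (LINT t:S|lborel. f t * g t)"

text \<open>Eigenvalues, eigenfunctions and observation times are indexed from 1.\<close>

definition orthonormal_on :: "real set \<Rightarrow> (nat \<Rightarrow> real \<Rightarrow> real) \<Rightarrow> bool" where
  "orthonormal_on S \<phi> \<longleftrightarrow>
     (\<forall>j\<ge>1. \<phi> j \<in> L2_on S) \<and>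
     (\<forall>i\<ge>1. \<forall>j\<ge>1. inner_on S (\<phi> i) (\<phi> j) = (if i = j then 1 else 0))"

definition orthonormal_basis_on :: "real set \<Rightarrow> (nat \<Rightarrow> real \<Rightarrow> real) \<Rightarrow> bool" where
  "orthonormal_basis_on S \<phi> \<longleftrightarrow> orthonormal_on S \<phi> \<and>
     (\<forall>f\<in>L2_on S.
        (\<lambda>m. LINT t:S|lborel. (f t - (\<Sum>j=1..m. inner_on S f (\<phi> j) * \<phi> j t))\<^sup>2)
          \<longlonglongrightarrow> 0)"

definition kernel_expansion ::
  "real set \<Rightarrow> (real \<Rightarrow> real \<Rightarrow> real) \<Rightarrow> (nat \<Rightarrow> real) \<Rightarrow> (nat \<Rightarrow> real \<Rightarrow> real) \<Rightarrow> bool" where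
  "kernel_expansion S G \<kappa> \<phi> \<longleftrightarrow>
     (\<forall>s\<in>S. \<forall>t\<in>S. (\<lambda>j. \<kappa> (Suc j) * \<phi> (Suc j) s * \<phi> (Suc j) t) sums G s t)"

text \<open>
  The sigma-algebra on sample paths makes the evaluations at points of \<open>S\<close> and the
  functionals \<open>x \<mapsto> \<integral> f x\<close> with \<open>f\<close> square-integrable measurable. For a jointly measurable
  process with square-integrable paths it has the same completion as the cylinder
  sigma-algebra.
\<close>

definition path_space :: "real set \<Rightarrow> (real \<Rightarrow> real) measure" where
  "path_space S = sigma UNIV
     ({(\<lambda>x. x t) -` B | t B. t \<in> S \<and> B \<in> sets borel} \<union>
      {(\<lambda>x. LINT t:S|lborel. f t * x t) -` B | f B. f \<in> L2_on S \<and> B \<in> sets borel})"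

definition random_function :: "'w measure \<Rightarrow> real set \<Rightarrow> ('w \<Rightarrow> real \<Rightarrow> real) \<Rightarrow> bool" where
  "random_function M S Z \<longleftrightarrow>
     (\<lambda>(\<omega>, t). Z \<omega> t) \<in> borel_measurable (M \<Otimes>\<^sub>M restrict_space borel S)"

definition generated_algebra :: "'w set \<Rightarrow> ('w \<Rightarrow> real) set \<Rightarrow> 'w measure" where
  "generated_algebra \<Omega> F = sigma \<Omega> {f -` B \<inter> \<Omega> | f B. f \<in> F \<and> B \<in> sets borel}"

definition check_loss :: "real \<Rightarrow> real \<Rightarrow> real" where
  "check_loss \<tau> e = (\<tau> - (if e \<le> 0 then 1 else 0)) * e"

definition quantile :: "real \<Rightarrow> real measure \<Rightarrow> real" where
  "quantile \<tau> \<nu> = Inf {y. \<tau> \<le> cdf \<nu> y}"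

text \<open>
  Subject 0 is the independent copy; subjects \<open>i \<ge> 1\<close> form the sample. \<open>resp_law x\<close> is the
  conditional law of the response given that the curve is \<open>x\<close>. Numbers of observations and
  observation times are random variables; fixed designs are the constant ones.
\<close>

record 'w fq_model =
  prb :: "'w measure"
  qlev :: real
  lo :: real
  hi :: real
  resp :: "nat \<Rightarrow> 'w \<Rightarrow> real"
  curve :: "nat \<Rightarrow> 'w \<Rightarrow> real \<Rightarrow> real"
  mean_fun :: "real \<Rightarrow> real"
  cov_fun :: "real \<Rightarrow> real \<Rightarrow> real"
  eig_val :: "nat \<Rightarrow> real"
  eig_fun :: "nat \<Rightarrow> real \<Rightarrow> real"
  icept :: real
  slope :: "real \<Rightarrow> real"
  resp_law :: "(real \<Rightarrow> real) \<Rightarrow> real measure"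
  nobs :: "nat \<Rightarrow> 'w \<Rightarrow> nat"
  obs_time :: "nat \<Rightarrow> nat \<Rightarrow> 'w \<Rightarrow> real"
  obs_err :: "nat \<Rightarrow> nat \<Rightarrow> 'w \<Rightarrow> real"
  err_var :: real

definition dom_of :: "'w fq_model \<Rightarrow> real set" where
  "dom_of m = {lo m..hi m}"

abbreviation paths_of :: "'w fq_model \<Rightarrow> (real \<Rightarrow> real) measure" where
  "paths_of m \<equiv> path_space (dom_of m)"

definition cond_quant :: "'w fq_model \<Rightarrow> (real \<Rightarrow> real) \<Rightarrow> real" where
  "cond_quant m x = icept m + (LINT t:dom_of m|lborel. slope m t * (x t - mean_fun m t))"

definition q_err :: "'w fq_model \<Rightarrow> nat \<Rightarrow> 'w \<Rightarrow> real" where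
  "q_err m i \<omega> = resp m i \<omega> - cond_quant m (curve m i \<omega>)"

definition err_cdf :: "'w fq_model \<Rightarrow> real \<Rightarrow> (real \<Rightarrow> real) \<Rightarrow> real" where
  "err_cdf m u x = cdf (distr (resp_law m x) borel (\<lambda>y. y - cond_quant m x)) u"

definition obs_val :: "'w fq_model \<Rightarrow> nat \<Rightarrow> nat \<Rightarrow> 'w \<Rightarrow> real" where
  "obs_val m i l \<omega> = curve m i \<omega> (obs_time m i l \<omega>) + obs_err m i l \<omega>"

definition curve_alg :: "'w fq_model \<Rightarrow> nat \<Rightarrow> 'w measure" where
  "curve_alg m i = vimage_algebra (space (prb m)) (curve m i) (paths_of m)"

definition pair_alg :: "'w fq_model \<Rightarrow> nat \<Rightarrow> 'w measure" where
  "pair_alg m i = vimage_algebra (space (prb m)) (\<lambda>\<omega>. (resp m i \<omega>, curve m i \<omega>))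
     (borel \<Otimes>\<^sub>M paths_of m)"

text \<open>
  A variable with index \<open>l\<close> is part of the data only if \<open>1 \<le> l \<le> nobs m i \<omega>\<close>;
  it is replaced by 0 otherwise.
\<close>

definition seen :: "'w fq_model \<Rightarrow> nat \<Rightarrow> nat \<Rightarrow> ('w \<Rightarrow> real) \<Rightarrow> 'w \<Rightarrow> real" where
  "seen m i l V \<omega> = (if l \<in> {1..nobs m i \<omega>} then V \<omega> else 0)"

definition data_alg :: "'w fq_model \<Rightarrow> nat \<Rightarrow> 'w measure" where
  "data_alg m n = generated_algebra (space (prb m))
     (\<Union>i\<in>{1..n}. {resp m i, \<lambda>\<omega>. real (nobs m i \<omega>)} \<union>
        (\<Union>l. {seen m i l (obs_time m i l), seen m i l (obs_val m i l)}))"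

definition copy_alg :: "'w fq_model \<Rightarrow> 'w measure" where
  "copy_alg m = generated_algebra (space (prb m))
     ({\<lambda>\<omega>. real (nobs m 0 \<omega>)} \<union>
        (\<Union>l. {seen m 0 l (obs_time m 0 l),
               seen m 0 l (\<lambda>\<omega>. curve m 0 \<omega> (obs_time m 0 l \<omega>)),
               seen m 0 l (obs_err m 0 l)}))"

definition joint_alg :: "'w fq_model \<Rightarrow> nat \<Rightarrow> 'w measure" where
  "joint_alg m n = sigma (space (prb m))
     (sets (data_alg m n) \<union> sets (copy_alg m) \<union> sets (curve_alg m 0))"

definition curve_model :: "'w fq_model \<Rightarrow> bool" where
  "curve_model m \<longleftrightarrow>
     prob_space (prb m) \<and> 0 < qlev m \<and> qlev m < 1 \<and> lo m < hi m \<and>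
     prob_space.indep_vars (prb m) (\<lambda>_. borel \<Otimes>\<^sub>M paths_of m)
       (\<lambda>i \<omega>. (resp m i \<omega>, curve m i \<omega>)) UNIV \<and>
     (\<forall>i. distr (prb m) (borel \<Otimes>\<^sub>M paths_of m) (\<lambda>\<omega>. (resp m i \<omega>, curve m i \<omega>)) =
          distr (prb m) (borel \<Otimes>\<^sub>M paths_of m) (\<lambda>\<omega>. (resp m 0 \<omega>, curve m 0 \<omega>))) \<and>
     (\<forall>i. random_function (prb m) (dom_of m) (curve m i)) \<and>
     (\<forall>i. AE \<omega> in prb m. curve m i \<omega> \<in> L2_on (dom_of m)) \<and>
     mean_fun m \<in> L2_on (dom_of m) \<and>
     (\<forall>i. \<forall>t\<in>dom_of m. integrable (prb m) (\<lambda>\<omega>. (curve m i \<omega> t)\<^sup>2) \<and>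
        (LINT \<omega>|prb m. curve m i \<omega> t) = mean_fun m t) \<and>
     (\<forall>i. \<forall>s\<in>dom_of m. \<forall>t\<in>dom_of m.
        (LINT \<omega>|prb m. (curve m i \<omega> s - mean_fun m s) * (curve m i \<omega> t - mean_fun m t)) =
          cov_fun m s t) \<and>
     (\<forall>j\<ge>1. 0 < eig_val m j \<and> eig_val m (Suc j) \<le> eig_val m j) \<and>
     orthonormal_basis_on (dom_of m) (eig_fun m) \<and>
     kernel_expansion (dom_of m) (cov_fun m) (eig_val m) (eig_fun m)"

definition quantile_model :: "'w fq_model \<Rightarrow> bool" where
  "quantile_model m \<longleftrightarrow>
     slope m \<in> L2_on (dom_of m) \<and>
     resp_law m \<in> paths_of m \<rightarrow>\<^sub>M prob_algebra borel \<and>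
     (\<forall>i y. AE \<omega> in prb m.
        real_cond_exp (prb m) (curve_alg m i) (\<lambda>\<omega>. indicator {..y} (resp m i \<omega>)) \<omega> =
          cdf (resp_law m (curve m i \<omega>)) y) \<and>
     (\<forall>i. AE \<omega> in prb m.
        quantile (qlev m) (resp_law m (curve m i \<omega>)) = cond_quant m (curve m i \<omega>) \<and>
        err_cdf m 0 (curve m i \<omega>) = qlev m) \<and>
     integrable (prb m) (\<lambda>\<omega>. check_loss (qlev m) (q_err m 0 \<omega>))"

definition observation_model :: "'w fq_model \<Rightarrow> bool" where
  "observation_model m \<longleftrightarrow>
     (\<forall>i. nobs m i \<in> prb m \<rightarrow>\<^sub>M count_space UNIV) \<and>
     (\<forall>i. \<forall>l\<ge>1. obs_time m i l \<in> borel_measurable (prb m) \<and>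
        (\<forall>\<omega>\<in>space (prb m). obs_time m i l \<omega> \<in> dom_of m)) \<and>
     prob_space.indep_vars (prb m) (\<lambda>_. borel) (\<lambda>(i, l). obs_err m i l) (UNIV \<times> {1..}) \<and>
     (\<forall>i. \<forall>l\<ge>1. distr (prb m) borel (obs_err m i l) = distr (prb m) borel (obs_err m 0 1)) \<and>
     integrable (prb m) (\<lambda>\<omega>. (obs_err m 0 1 \<omega>)\<^sup>2) \<and>
     (LINT \<omega>|prb m. obs_err m 0 1 \<omega>) = 0 \<and>
     (LINT \<omega>|prb m. (obs_err m 0 1 \<omega>)\<^sup>2) = err_var m \<and>
     prob_space.indep_set (prb m)
       (sets (vimage_algebra (space (prb m)) (\<lambda>\<omega>. \<lambda>(i, l)\<in>UNIV \<times> {1..}. obs_err m i l \<omega>)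
          (\<Pi>\<^sub>M _\<in>UNIV \<times> {1..}. borel)))
       (sets (vimage_algebra (space (prb m)) (\<lambda>\<omega> i. curve m i \<omega>)
          (\<Pi>\<^sub>M _\<in>UNIV. paths_of m))) \<and>
     (\<forall>n. prob_space.indep_set (prb m) (sets (pair_alg m 0)) (sets (data_alg m n))) \<and>
     (\<forall>n u. AE \<omega> in prb m.
        real_cond_exp (prb m) (joint_alg m n) (\<lambda>\<omega>. indicator {..u} (q_err m 0 \<omega>)) \<omega> =
          err_cdf m u (curve m 0 \<omega>))"

record fpca =
  mean_est :: "real \<Rightarrow> real"
  cov_est :: "real \<Rightarrow> real \<Rightarrow> real"
  noise_est :: real
  eig_val_est :: "nat \<Rightarrow> real"
  eig_fun_est :: "nat \<Rightarrow> real \<Rightarrow> real"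

definition local_linear_mean ::
  "(real \<Rightarrow> real) \<Rightarrow> real \<Rightarrow> real set \<Rightarrow> nat set \<Rightarrow> (nat \<Rightarrow> nat) \<Rightarrow>
   (nat \<Rightarrow> nat \<Rightarrow> real) \<Rightarrow> (nat \<Rightarrow> nat \<Rightarrow> real) \<Rightarrow> (real \<Rightarrow> real) \<Rightarrow> bool" where
  "local_linear_mean k h S I N T U f \<longleftrightarrow>
     (\<forall>t\<in>S. \<exists>b1. is_arg_min
        (\<lambda>(b0, b1). \<Sum>i\<in>I. \<Sum>l=1..N i.
           k ((T i l - t) / h) * (U i l - b0 - b1 * (T i l - t))\<^sup>2)
        (\<lambda>_. True) (f t, b1))"

definition local_linear_cov ::
  "(real \<Rightarrow> real \<Rightarrow> real) \<Rightarrow> real \<Rightarrow> real set \<Rightarrow> nat set \<Rightarrow> (nat \<Rightarrow> nat) \<Rightarrow>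
   (nat \<Rightarrow> nat \<Rightarrow> real) \<Rightarrow> (nat \<Rightarrow> nat \<Rightarrow> real) \<Rightarrow> (real \<Rightarrow> real) \<Rightarrow>
   (real \<Rightarrow> real \<Rightarrow> real) \<Rightarrow> bool" where
  "local_linear_cov k h S I N T U f R \<longleftrightarrow>
     (\<forall>s\<in>S. \<forall>t\<in>S. \<exists>b1 b2. is_arg_min
        (\<lambda>(b0, b1, b2). \<Sum>i\<in>I. \<Sum>l=1..N i. \<Sum>l'\<in>{1..N i} - {l}.
           k ((T i l - s) / h) ((T i l' - t) / h) *
           ((U i l - f (T i l)) * (U i l' - f (T i l')) -
             b0 - b1 * (T i l - s) - b2 * (T i l' - t))\<^sup>2)
        (\<lambda>_. True) (R s t, b1, b2))"

text \<open>
  A smoothed covariance surface \<open>R\<close> need not be nonnegative definite, in which case its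
  negative spectral part is discarded. If \<open>R\<close> is nonnegative definite, \<open>G = R\<close> is allowed
  (take \<open>\<nu> = 0\<close>).
\<close>

definition positive_part ::
  "real set \<Rightarrow> (real \<Rightarrow> real \<Rightarrow> real) \<Rightarrow> (nat \<Rightarrow> real) \<Rightarrow> (nat \<Rightarrow> real \<Rightarrow> real) \<Rightarrow>
   (real \<Rightarrow> real \<Rightarrow> real) \<Rightarrow> bool" where
  "positive_part S G \<kappa> \<phi> R \<longleftrightarrow>
     (\<exists>\<nu> \<psi>. (\<forall>j\<ge>1. 0 \<le> \<nu> j) \<and> orthonormal_on S \<psi> \<and>
        (\<forall>i\<ge>1. \<forall>j\<ge>1. 0 < \<kappa> i \<longrightarrow> 0 < \<nu> j \<longrightarrow> inner_on S (\<phi> i) (\<psi> j) = 0) \<and>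
        kernel_expansion S (\<lambda>s t. G s t - R s t) \<nu> \<psi>)"

definition spectral_estimate :: "real set \<Rightarrow> fpca \<Rightarrow> bool" where
  "spectral_estimate S f \<longleftrightarrow>
     (\<forall>j\<ge>1. 0 \<le> eig_val_est f j \<and> eig_val_est f (Suc j) \<le> eig_val_est f j) \<and>
     orthonormal_on S (eig_fun_est f) \<and>
     kernel_expansion S (cov_est f) (eig_val_est f) (eig_fun_est f)"

text \<open>Matrices and vectors are indexed from 0, observations from 1.\<close>

definition Sigma_est :: "fpca \<Rightarrow> nat \<Rightarrow> (nat \<Rightarrow> real) \<Rightarrow> real Matrix.mat" where
  "Sigma_est f N T = Matrix.mat N N (\<lambda>(l, l').
     cov_est f (T (Suc l)) (T (Suc l')) + noise_est f * (if l = l' then 1 else 0))"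

definition score :: "fpca \<Rightarrow> nat \<Rightarrow> (nat \<Rightarrow> real) \<Rightarrow> (nat \<Rightarrow> real) \<Rightarrow> nat \<Rightarrow> real" where
  "score f N T U j = eig_val_est f j *
     scalar_prod (Matrix.vec N (\<lambda>l. eig_fun_est f j (T (Suc l))))
       (mult_mat_vec (the (mat_inverse (Sigma_est f N T)))
         (Matrix.vec N (\<lambda>l. U (Suc l) - mean_est f (T (Suc l)))))"

text \<open>
  The second argument of \<open>fit\<close>, \<open>coef\<close> and the bandwidths is the group left out;
  0 stands for leaving out nothing.
\<close>

record 'w fq_proc =
  cand :: "nat \<Rightarrow> nat set"
  folds :: nat
  ker1 :: "real \<Rightarrow> real"
  ker2 :: "real \<Rightarrow> real \<Rightarrow> real"
  bw1 :: "nat \<Rightarrow> nat \<Rightarrow> 'w \<Rightarrow> real"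
  bw2 :: "nat \<Rightarrow> nat \<Rightarrow> 'w \<Rightarrow> real"
  fit :: "nat \<Rightarrow> nat \<Rightarrow> 'w \<Rightarrow> fpca"
  coef :: "nat \<Rightarrow> nat \<Rightarrow> nat \<Rightarrow> 'w \<Rightarrow> real \<times> (nat \<Rightarrow> real)"

definition grp_size :: "'w fq_proc \<Rightarrow> nat \<Rightarrow> nat" where
  "grp_size p n = n div folds p"

definition train :: "'w fq_proc \<Rightarrow> nat \<Rightarrow> nat \<Rightarrow> nat set" where
  "train p n k =
     (if k = 0 then {1..n} else {1..n} - {(k - 1) * grp_size p n + 1..k * grp_size p n})"

definition score_est ::
  "'w fq_model \<Rightarrow> 'w fq_proc \<Rightarrow> nat \<Rightarrow> nat \<Rightarrow> nat \<Rightarrow> nat \<Rightarrow> 'w \<Rightarrow> real" where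
  "score_est m p n k i j \<omega> = score (fit p n k \<omega>) (nobs m i \<omega>)
     (\<lambda>l. obs_time m i l \<omega>) (\<lambda>l. obs_val m i l \<omega>) j"

definition slope_est :: "'w fq_proc \<Rightarrow> nat \<Rightarrow> nat \<Rightarrow> nat \<Rightarrow> 'w \<Rightarrow> real \<Rightarrow> real" where
  "slope_est p n k J \<omega> t =
     (\<Sum>j=1..J. snd (coef p n k J \<omega>) j * eig_fun_est (fit p n k \<omega>) j t)"

definition curve_est ::
  "'w fq_model \<Rightarrow> 'w fq_proc \<Rightarrow> nat \<Rightarrow> nat \<Rightarrow> nat \<Rightarrow> 'w \<Rightarrow> real \<Rightarrow> real" where
  "curve_est m p n i J \<omega> t = mean_est (fit p n 0 \<omega>) t +
     (\<Sum>j=1..J. score_est m p n 0 i j \<omega> * eig_fun_est (fit p n 0 \<omega>) j t)"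

definition quant_est ::
  "'w fq_model \<Rightarrow> 'w fq_proc \<Rightarrow> nat \<Rightarrow> nat \<Rightarrow> nat \<Rightarrow> nat \<Rightarrow> 'w \<Rightarrow> real" where
  "quant_est m p n k i J \<omega> = fst (coef p n k J \<omega>) +
     (LINT t:dom_of m|lborel. slope_est p n k J \<omega> t *
        (curve_est m p n i J \<omega> t - mean_est (fit p n 0 \<omega>) t))"

definition weight_set :: "nat set \<Rightarrow> (nat \<Rightarrow> real) set" where
  "weight_set A = {w. (\<forall>J\<in>A. 0 \<le> w J) \<and> (\<forall>J. J \<notin> A \<longrightarrow> w J = 0) \<and> (\<Sum>J\<in>A. w J) = 1}"

definition avg_quant_est ::
  "'w fq_model \<Rightarrow> 'w fq_proc \<Rightarrow> nat \<Rightarrow> nat \<Rightarrow> nat \<Rightarrow> (nat \<Rightarrow> real) \<Rightarrow> 'w \<Rightarrow> real" where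
  "avg_quant_est m p n k i w \<omega> = (\<Sum>J\<in>cand p n. w J * quant_est m p n k i J \<omega>)"

definition CV :: "'w fq_model \<Rightarrow> 'w fq_proc \<Rightarrow> nat \<Rightarrow> 'w \<Rightarrow> (nat \<Rightarrow> real) \<Rightarrow> real" where
  "CV m p n \<omega> w = 1 / real n *
     (\<Sum>k=1..folds p. \<Sum>r=1..grp_size p n.
        check_loss (qlev m) (resp m ((k - 1) * grp_size p n + r) \<omega> -
          avg_quant_est m p n k ((k - 1) * grp_size p n + r) w \<omega>))"

definition estimation :: "'w fq_model \<Rightarrow> 'w fq_proc \<Rightarrow> bool" where
  "estimation m p \<longleftrightarrow>
     (\<forall>n\<ge>1. finite (cand p n) \<and> cand p n \<noteq> {}) \<and> 2 \<le> folds p \<and>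
     (\<forall>x. 0 \<le> ker1 p x) \<and> (ker1 p has_integral 1) UNIV \<and>
     (\<forall>x y. 0 \<le> ker2 p x y) \<and> ((\<lambda>(x, y). ker2 p x y) has_integral 1) UNIV \<and>
     (\<forall>n\<ge>1. \<forall>k\<le>folds p.
        random_function (data_alg m n) (dom_of m) (\<lambda>\<omega>. mean_est (fit p n k \<omega>)) \<and>
        (\<lambda>(\<omega>, s, t). cov_est (fit p n k \<omega>) s t) \<in> borel_measurable
          (data_alg m n \<Otimes>\<^sub>M restrict_space borel (dom_of m) \<Otimes>\<^sub>M restrict_space borel (dom_of m)) \<and>
        (\<lambda>\<omega>. noise_est (fit p n k \<omega>)) \<in> borel_measurable (data_alg m n) \<and>
        (\<forall>j\<ge>1. (\<lambda>\<omega>. eig_val_est (fit p n k \<omega>) j) \<in> borel_measurable (data_alg m n) \<and>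
           random_function (data_alg m n) (dom_of m) (\<lambda>\<omega>. eig_fun_est (fit p n k \<omega>) j)) \<and>
        (\<forall>J\<in>cand p n. (\<lambda>\<omega>. fst (coef p n k J \<omega>)) \<in> borel_measurable (data_alg m n) \<and>
           (\<forall>j\<in>{1..J}. (\<lambda>\<omega>. snd (coef p n k J \<omega>) j) \<in> borel_measurable (data_alg m n)))) \<and>
     (\<forall>n\<ge>1. \<forall>i\<le>n. \<forall>j\<ge>1. score_est m p n 0 i j \<in> borel_measurable (prb m)) \<and>
     (AE \<omega> in prb m. \<forall>n\<ge>1. \<forall>k\<le>folds p.
        let f = fit p n k \<omega>; I = train p n k; N = (\<lambda>i. nobs m i \<omega>);
            T = (\<lambda>i l. obs_time m i l \<omega>); U = (\<lambda>i l. obs_val m i l \<omega>) in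
        0 < bw1 p n k \<omega> \<and> 0 < bw2 p n k \<omega> \<and>
        local_linear_mean (ker1 p) (bw1 p n k \<omega>) (dom_of m) I N T U (mean_est f) \<and>
        (\<exists>R. local_linear_cov (ker2 p) (bw2 p n k \<omega>) (dom_of m) I N T U (mean_est f) R \<and>
           positive_part (dom_of m) (cov_est f) (eig_val_est f) (eig_fun_est f) R) \<and>
        spectral_estimate (dom_of m) f \<and>
        (\<forall>i\<in>(if k = 0 then insert 0 I else I). invertible_mat (Sigma_est f (N i) (T i))) \<and>
        (\<forall>J\<in>cand p n. is_arg_min
           (\<lambda>(a, b). \<Sum>i\<in>I. check_loss (qlev m)
              (resp m i \<omega> - a - (\<Sum>j=1..J. b j * score_est m p n k i j \<omega>)))
           (\<lambda>_. True) (coef p n k J \<omega>)))"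

definition CV_weights :: "'w fq_model \<Rightarrow> 'w fq_proc \<Rightarrow> (nat \<Rightarrow> 'w \<Rightarrow> nat \<Rightarrow> real) \<Rightarrow> bool" where
  "CV_weights m p what \<longleftrightarrow>
     (AE \<omega> in prb m. \<forall>n\<ge>1.
        is_arg_min (CV m p n \<omega>) (\<lambda>w. w \<in> weight_set (cand p n)) (what n \<omega>))"

text \<open>
  A conditional expectation is determined only almost surely for each fixed \<open>w\<close>. To evaluate
  it at data-dependent weights, a version with continuous paths in \<open>w\<close> is needed; such a
  version is unique up to indistinguishability.
\<close>

definition FPE_version ::
  "'w fq_model \<Rightarrow> 'w fq_proc \<Rightarrow> (nat \<Rightarrow> (nat \<Rightarrow> real) \<Rightarrow> 'w \<Rightarrow> real) \<Rightarrow> bool" where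
  "FPE_version m p FPE \<longleftrightarrow>
     (\<forall>n\<ge>1.
        (\<forall>w\<in>weight_set (cand p n).
           integrable (prb m)
             (\<lambda>\<omega>. check_loss (qlev m) (resp m 0 \<omega> - avg_quant_est m p n 0 0 w \<omega>)) \<and>
           (AE \<omega> in prb m. FPE n w \<omega> = real_cond_exp (prb m) (data_alg m n)
             (\<lambda>\<omega>. check_loss (qlev m) (resp m 0 \<omega> - avg_quant_est m p n 0 0 w \<omega>)) \<omega>)) \<and>
        (AE \<omega> in prb m. continuous_on (weight_set (cand p n)) (\<lambda>w. FPE n w \<omega>)))"

definition base_risk :: "'w fq_model \<Rightarrow> real" where
  "base_risk m = (LINT \<omega>|prb m. check_loss (qlev m) (q_err m 0 \<omega>))"

definition EFPE ::
  "'w fq_model \<Rightarrow> (nat \<Rightarrow> (nat \<Rightarrow> real) \<Rightarrow> 'w \<Rightarrow> real) \<Rightarrow> nat \<Rightarrow> (nat \<Rightarrow> real) \<Rightarrow> 'w \<Rightarrow> real"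
  where "EFPE m FPE n w \<omega> = FPE n w \<omega> - base_risk m"

definition EFPE_ratio ::
  "'w fq_model \<Rightarrow> 'w fq_proc \<Rightarrow> (nat \<Rightarrow> (nat \<Rightarrow> real) \<Rightarrow> 'w \<Rightarrow> real) \<Rightarrow>
   (nat \<Rightarrow> 'w \<Rightarrow> nat \<Rightarrow> real) \<Rightarrow> nat \<Rightarrow> 'w \<Rightarrow> real" where
  "EFPE_ratio m p FPE what n \<omega> =
     EFPE m FPE n (what n \<omega>) \<omega> / (INF w\<in>weight_set (cand p n). EFPE m FPE n w \<omega>)"

text \<open>
  Limit quantities carry the sample size \<open>n\<close> besides the number \<open>J\<close> of components.
  \<open>quant_lim\<close> is the nonrandom functional of the path.
\<close>

record 'w fq_limits =
  icept_lim :: "nat \<Rightarrow> nat \<Rightarrow> real"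
  slope_lim :: "nat \<Rightarrow> nat \<Rightarrow> real \<Rightarrow> real"
  curve_lim :: "nat \<Rightarrow> nat \<Rightarrow> nat \<Rightarrow> 'w \<Rightarrow> real \<Rightarrow> real"
  quant_lim :: "nat \<Rightarrow> nat \<Rightarrow> (real \<Rightarrow> real) \<Rightarrow> real"

definition limit_objects :: "'w fq_model \<Rightarrow> 'w fq_proc \<Rightarrow> 'w fq_limits \<Rightarrow> bool" where
  "limit_objects m p q \<longleftrightarrow>
     (\<forall>n\<ge>1. \<forall>J\<in>cand p n.
        set_borel_measurable lborel (dom_of m) (slope_lim q n J) \<and>
        quant_lim q n J \<in> borel_measurable (paths_of m) \<and>
        (\<forall>i\<le>n. random_function (prb m) (dom_of m) (curve_lim q n i J) \<and>
           (AE \<omega> in prb m.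
              set_integrable lborel (dom_of m)
                (\<lambda>t. slope_lim q n J t * (curve_lim q n i J \<omega> t - mean_fun m t)) \<and>
              quant_lim q n J (curve m i \<omega>) = icept_lim q n J +
                (LINT t:dom_of m|lborel.
                   slope_lim q n J t * (curve_lim q n i J \<omega> t - mean_fun m t)))))"

definition avg_quant_lim ::
  "'w fq_proc \<Rightarrow> 'w fq_limits \<Rightarrow> nat \<Rightarrow> (nat \<Rightarrow> real) \<Rightarrow> (real \<Rightarrow> real) \<Rightarrow> real" where
  "avg_quant_lim p q n w x = (\<Sum>J\<in>cand p n. w J * quant_lim q n J x)"

definition EFPE_lim ::
  "'w fq_model \<Rightarrow> 'w fq_proc \<Rightarrow> 'w fq_limits \<Rightarrow> nat \<Rightarrow> (nat \<Rightarrow> real) \<Rightarrow> real" where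
  "EFPE_lim m p q n w =
     (LINT \<omega>|prb m. check_loss (qlev m) (resp m 0 \<omega> - avg_quant_lim p q n w (curve m 0 \<omega>))) -
     base_risk m"

definition eta :: "'w fq_model \<Rightarrow> 'w fq_proc \<Rightarrow> 'w fq_limits \<Rightarrow> nat \<Rightarrow> real" where
  "eta m p q n = real n * (INF w\<in>weight_set (cand p n). EFPE_lim m p q n w)"

text \<open>
  \<open>D\<close> is a version of the conditional expectation of the absolute error of the predicted curve
  of subject 0, one random variable for each \<open>t\<close>.
\<close>

definition condition1 ::
  "'w fq_model \<Rightarrow> 'w fq_proc \<Rightarrow> 'w fq_limits \<Rightarrow>
   (nat \<Rightarrow> nat \<Rightarrow> real \<Rightarrow> 'w \<Rightarrow> real) \<Rightarrow> (nat \<Rightarrow> real) \<Rightarrow> bool" where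
  "condition1 m p q D c \<longleftrightarrow>
     (\<forall>n. 0 \<le> c n) \<and> c \<longlonglongrightarrow> 0 \<and>
     unif_Op (prb m) (cand p) (\<lambda>n J \<omega>. fst (coef p n 0 J \<omega>) - icept_lim q n J) c \<and>
     unif_Op (prb m) (\<lambda>n. cand p n \<times> dom_of m)
       (\<lambda>n (J, t) \<omega>. slope_est p n 0 J \<omega> t - slope_lim q n J t) c \<and>
     unif_Op (prb m) (\<lambda>_. dom_of m)
       (\<lambda>n t \<omega>. mean_est (fit p n 0 \<omega>) t - mean_fun m t) c \<and>
     unif_Op (prb m) (\<lambda>n. {1..n} \<times> cand p n \<times> dom_of m)
       (\<lambda>n (i, J, t) \<omega>. curve_est m p n i J \<omega> t - curve_lim q n i J \<omega> t) c \<and>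
     (\<forall>n\<ge>1. \<forall>J\<in>cand p n. \<forall>t\<in>dom_of m.
        integrable (prb m) (\<lambda>\<omega>. \<bar>curve_est m p n 0 J \<omega> t - curve_lim q n 0 J \<omega> t\<bar>) \<and>
        (AE \<omega> in prb m. D n J t \<omega> = real_cond_exp (prb m) (data_alg m n)
           (\<lambda>\<omega>. \<bar>curve_est m p n 0 J \<omega> t - curve_lim q n 0 J \<omega> t\<bar>) \<omega>)) \<and>
     unif_Op (prb m) (\<lambda>n. cand p n \<times> dom_of m) (\<lambda>n (J, t) \<omega>. D n J t \<omega>) c"

text \<open>
  The limits in \<open>condition1\<close> are of bounded order in \<open>L\<^sub>1\<close>. Without this, errors of order
  \<open>c n\<close> in slope and curve do not give an error of order \<open>c n\<close> in the integral of their
  product: the limit slope can be 0 while the estimated slope tends to 0 and the estimated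
  curves diverge.
\<close>

definition bounded_limits :: "'w fq_model \<Rightarrow> 'w fq_proc \<Rightarrow> 'w fq_limits \<Rightarrow> bool" where
  "bounded_limits m p q \<longleftrightarrow>
     (\<exists>C. \<forall>\<^sub>F n in sequentially. \<forall>J\<in>cand p n.
        set_integrable lborel (dom_of m) (slope_lim q n J) \<and>
        (LINT t:dom_of m|lborel. \<bar>slope_lim q n J t\<bar>) \<le> C) \<and>
     (\<forall>n\<ge>1. \<forall>J\<in>cand p n. \<forall>i\<le>n. AE \<omega> in prb m.
        set_integrable lborel (dom_of m) (\<lambda>t. curve_lim q n i J \<omega> t - mean_fun m t)) \<and>
     unif_Op (prb m) (cand p)
       (\<lambda>n J \<omega>. 1 / real n *
          (\<Sum>i=1..n. LINT t:dom_of m|lborel. \<bar>curve_lim q n i J \<omega> t - mean_fun m t\<bar>))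
       (\<lambda>_. 1) \<and>
     (\<forall>n\<ge>1. \<forall>J\<in>cand p n. integrable (prb m)
        (\<lambda>\<omega>. LINT t:dom_of m|lborel. \<bar>curve_lim q n 0 J \<omega> t - mean_fun m t\<bar>)) \<and>
     unif_Op (prb m) (cand p)
       (\<lambda>n J. real_cond_exp (prb m) (data_alg m n)
          (\<lambda>\<omega>. LINT t:dom_of m|lborel. \<bar>curve_lim q n 0 J \<omega> t - mean_fun m t\<bar>))
       (\<lambda>_. 1)"

definition condition2 :: "'w fq_model \<Rightarrow> 'w fq_proc \<Rightarrow> 'w fq_limits \<Rightarrow> bool" where
  "condition2 m p q \<longleftrightarrow>
     (\<exists>\<rho>>0. \<forall>n\<ge>1. \<forall>i\<le>n. \<forall>J\<in>cand p n. AE \<omega> in prb m.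
        \<bar>quant_lim q n J (curve m i \<omega>) - cond_quant m (curve m i \<omega>)\<bar> \<le> \<rho>)"

definition condition3 :: "'w fq_model \<Rightarrow> 'w fq_proc \<Rightarrow> (nat \<Rightarrow> real) \<Rightarrow> bool" where
  "condition3 m p g \<longleftrightarrow>
     (\<forall>n. 0 \<le> g n) \<and> g \<longlonglongrightarrow> 0 \<and>
     unif_Op (prb m) (\<lambda>n. weight_set (cand p n) \<times> {1..folds p} \<times> {1..grp_size p n})
       (\<lambda>n (w, k, r) \<omega>.
          avg_quant_est m p n 0 ((k - 1) * grp_size p n + r) w \<omega> -
          avg_quant_est m p n k ((k - 1) * grp_size p n + r) w \<omega>) g"

text \<open>In HOL \<open>inverse 0 = 0\<close>, so that without the first conjunct \<open>eta = 0\<close> would satisfy the limits.\<close>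

definition condition4 ::
  "'w fq_model \<Rightarrow> 'w fq_proc \<Rightarrow> 'w fq_limits \<Rightarrow> (nat \<Rightarrow> real) \<Rightarrow> (nat \<Rightarrow> real) \<Rightarrow> bool" where
  "condition4 m p q c g \<longleftrightarrow>
     (\<forall>\<^sub>F n in sequentially. eta m p q n \<noteq> 0) \<and>
     (\<lambda>n. inverse (eta m p q n) * sqrt (real n) * sqrt (real (card (cand p n)))) \<longlonglongrightarrow> 0 \<and>
     (\<lambda>n. inverse (eta m p q n) * real n * c n) \<longlonglongrightarrow> 0 \<and>
     (\<lambda>n. inverse (eta m p q n) * real n * g n) \<longlonglongrightarrow> 0"

end

theory Submission
  imports Defs
begin

text \<open>
  Three functions of the weights are compared on the simplex: the conditional excess risk
  \<open>EFPE\<close>, its nonrandom limit \<open>EFPE_lim\<close>, and the cross-validation criterion \<open>CV\<close>. The check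
  loss is convex and 1-Lipschitz, so a difference of losses is at most the difference of the
  quantiles, and for averaged quantiles it is at most the average of the differences; what
  holds for every candidate model carries over to all weights at once.

  First, \<open>EFPE\<close> differs from \<open>EFPE_lim\<close> by \<open>O\<^sub>p (c n)\<close>, uniformly in the weights. The
  independence of subject 0 from the data identifies the conditional risk of the limit quantile
  with \<open>EFPE_lim\<close>, and \<open>copy_error_on\<close> bounds the integral of the error of the estimated quantile
  over events of the data. As the accuracy of the estimates is known only on an event that need
  not belong to the data, that event is replaced by its hull (\<open>measurable_hull\<close>). The result is
  \<open>AE_EFPE_close\<close>.

  Second, up to a term without weights, \<open>CV\<close> differs from a multiple \<open>\<theta> \<ge> 1/2\<close> of \<open>EFPE_lim\<close>
  by \<open>O\<^sub>p (c n + g n + sqrt (card (cand p n) / n))\<close>. Estimated quantiles are replaced by their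
  limits in \<open>CV_close\<close>, which costs \<open>c n + g n\<close>. There remains an empirical process indexed by
  the simplex (\<open>likely_uniform_deviation\<close>). Symmetrisation and contraction remove the loss
  function and leave signed sums that are linear in the weights; the maximum of a linear function
  over the simplex is at most the Euclidean norm of its coefficients, which has mean of order
  \<open>sqrt (card (cand p n) * n)\<close>.

  Consequently a minimiser of \<open>CV\<close> minimises \<open>EFPE\<close> up to an error of the sum of these orders
  (\<open>minimizer_ratio\<close>). The limiting risk is nonnegative because the conditional quantile minimises
  the expected check loss (\<open>EFPE_lim_nonneg\<close>), and its infimum is \<open>eta m p q n / n\<close>. By
  \<open>condition4\<close> this is positive and of larger order than the errors, so the infimum of \<open>EFPE\<close> is at
  least half of it, and division by the infimum gives the rate of the ratio.
\<close>

section \<open>Maxima of centred sums\<close>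

text \<open>
  If the maxima on the left are attained at \<open>a\<close> and \<open>b\<close>, their sum contains \<open>x a - x b\<close>.
  This is at most \<open>y a - y b\<close> or \<open>y b - y a\<close>, and in either case \<open>a\<close> and \<open>b\<close>, in one of the
  two orders, are admissible choices on the right.
\<close>

lemma MAX_contraction:
  fixes A x y :: "'a \<Rightarrow> real"
  assumes W: "finite W" "W \<noteq> {}"
    and xy: "\<And>a b. a \<in> W \<Longrightarrow> b \<in> W \<Longrightarrow> \<bar>x a - x b\<bar> \<le> \<bar>y a - y b\<bar>"
  shows "(MAX a\<in>W. A a + x a) + (MAX a\<in>W. A a - x a)
       \<le> (MAX a\<in>W. A a + y a) + (MAX a\<in>W. A a - y a)"
proof -
  have "(MAX a\<in>W. A a + x a) \<in> (\<lambda>a. A a + x a) ` W" "(MAX a\<in>W. A a - x a) \<in> (\<lambda>a. A a - x a) ` W"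
    using W by (intro Max_in; simp)+
  then obtain a b where a: "a \<in> W" "(MAX a\<in>W. A a + x a) = A a + x a"
    and b: "b \<in> W" "(MAX a\<in>W. A a - x a) = A b - x b" by auto
  have p: "A c + y c \<le> (MAX a\<in>W. A a + y a)" "A c - y c \<le> (MAX a\<in>W. A a - y a)" if "c \<in> W" for c
    using W that by (auto intro!: Max_ge)
  show ?thesis
    using xy[OF a(1) b(1)] p[OF a(1)] p[OF b(1)] unfolding a(2) b(2) by linarith
qed

lemma abs_MAX_le:
  fixes x :: "'a \<Rightarrow> real"
  assumes "finite W" "W \<noteq> {}" "\<And>a. a \<in> W \<Longrightarrow> \<bar>x a\<bar> \<le> K"
  shows "\<bar>MAX a\<in>W. x a\<bar> \<le> K"
proof -
  have "(MAX a\<in>W. x a) \<in> x ` W" using assms by (intro Max_in) auto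
  then show ?thesis using assms(3) by auto
qed

lemma (in prob_space) MAX_integral_le:
  fixes x :: "'i \<Rightarrow> 'a \<Rightarrow> real"
  assumes W: "finite W" "W \<noteq> {}" and x: "\<And>a. a \<in> W \<Longrightarrow> integrable M (x a)"
    and m: "integrable M (\<lambda>v. MAX a\<in>W. x a v)"
  shows "(MAX a\<in>W. \<integral>v. x a v \<partial>M) \<le> (\<integral>v. (MAX a\<in>W. x a v) \<partial>M)"
  using W by (auto intro!: Max.boundedI integral_mono x m Max_ge)

lemma (in prob_space) integrable_MAX_bounded:
  fixes x :: "'i \<Rightarrow> 'a \<Rightarrow> real"
  assumes W: "finite W" "W \<noteq> {}" and "\<And>a. a \<in> W \<Longrightarrow> x a \<in> borel_measurable M"
    and "\<And>a v. a \<in> W \<Longrightarrow> v \<in> space M \<Longrightarrow> \<bar>x a v\<bar> \<le> K"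
  shows "integrable M (\<lambda>v. MAX a\<in>W. x a v)"
  using assms
  by (intro integrable_const_bound[where B=K] borel_measurable_Max AE_I2) (auto intro!: abs_MAX_le)

text \<open>
  The maximum is a convex function. Writing the centred term as half of \<open>2 * f a v\<close> minus half
  of \<open>2 * E (f a)\<close>, Jensen's inequality replaces the centring by a random sign at the cost of a
  factor 2. Once the two signs are paired, only differences \<open>f a v - f b v\<close> matter, and these
  are dominated by those of \<open>t\<close>.
\<close>

lemma (in prob_space) MAX_centred_le_signed:
  fixes f t :: "'i \<Rightarrow> 'a \<Rightarrow> real"
  assumes W: "finite W" "W \<noteq> {}"
    and f[measurable]: "\<And>a. a \<in> W \<Longrightarrow> f a \<in> borel_measurable M" and t[measurable]: "\<And>a. a \<in> W \<Longrightarrow> t a \<in> borel_measurable M"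
    and fB: "\<And>a v. a \<in> W \<Longrightarrow> \<bar>f a v\<bar> \<le> B" and tB: "\<And>a v. a \<in> W \<Longrightarrow> \<bar>t a v\<bar> \<le> B"
    and ft: "\<And>a b v. a \<in> W \<Longrightarrow> b \<in> W \<Longrightarrow> \<bar>f a v - f b v\<bar> \<le> \<bar>t a v - t b v\<bar>"
  shows "(\<integral>v. (MAX a\<in>W. A a + (f a v - expectation (f a))) \<partial>M)
    \<le> (\<integral>v. ((MAX a\<in>W. A a + 2 * t a v) + (MAX a\<in>W. A a - 2 * t a v)) / 2 \<partial>M)"
proof -
  define K where "K = (MAX a\<in>W. \<bar>A a\<bar>)"
  have K: "\<bar>A a\<bar> \<le> K" if "a \<in> W" for a using that W unfolding K_def by auto
  have fi: "integrable M (f a)" if "a \<in> W" for a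
    using that fB by (intro integrable_const_bound[where B=B]) auto
  have Ef: "\<bar>expectation (f a)\<bar> \<le> B" if "a \<in> W" for a
  proof -
    have "\<bar>expectation (f a)\<bar> \<le> expectation (\<lambda>v. \<bar>f a v\<bar>)" by (rule integral_abs_bound)
    also have "\<dots> \<le> expectation (\<lambda>v. B)" using that fi fB by (intro integral_mono) auto
    finally show ?thesis by (simp add: prob_space)
  qed
  have B0: "\<bar>A a + 2 * f a v\<bar> \<le> K + 2 * B" "\<bar>A a - 2 * f a v\<bar> \<le> K + 2 * B"
    "\<bar>A a + 2 * t a v\<bar> \<le> K + 2 * B" "\<bar>A a - 2 * t a v\<bar> \<le> K + 2 * B"
    "\<bar>A a + (f a v - expectation (f a))\<bar> \<le> K + 2 * B" if "a \<in> W" for a v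
    using K[OF that] fB[OF that, of v] tB[OF that, of v] Ef[OF that] by linarith+
  have int[simp]: "integrable M (\<lambda>v. MAX a\<in>W. A a + 2 * f a v)" "integrable M (\<lambda>v. MAX a\<in>W. A a - 2 * f a v)"
    "integrable M (\<lambda>v. MAX a\<in>W. A a + 2 * t a v)" "integrable M (\<lambda>v. MAX a\<in>W. A a - 2 * t a v)"
    "integrable M (\<lambda>v. MAX a\<in>W. A a + (f a v - expectation (f a)))"
    by (rule integrable_MAX_bounded[OF W, where K="K + 2 * B"]; use B0 in measurable)+
  have J: "(MAX a\<in>W. A a - 2 * expectation (f a)) \<le> (\<integral>v. (MAX a\<in>W. A a - 2 * f a v) \<partial>M)"
  proof -
    have "(MAX a\<in>W. A a - 2 * expectation (f a)) = (MAX a\<in>W. \<integral>v. A a - 2 * f a v \<partial>M)"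
      using fi by (intro arg_cong[where f=Max] image_cong) (auto simp: prob_space)
    also have "\<dots> \<le> (\<integral>v. (MAX a\<in>W. A a - 2 * f a v) \<partial>M)"
      using fi by (intro MAX_integral_le[OF W]) auto
    finally show ?thesis .
  qed
  have "(\<integral>v. (MAX a\<in>W. A a + (f a v - expectation (f a))) \<partial>M)
      \<le> (\<integral>v. ((MAX a\<in>W. A a + 2 * f a v) + (MAX a\<in>W. A a - 2 * expectation (f a))) / 2 \<partial>M)"
  proof (intro integral_mono int)
    fix v
    have "A a + (f a v - expectation (f a))
        \<le> ((MAX a\<in>W. A a + 2 * f a v) + (MAX a\<in>W. A a - 2 * expectation (f a))) / 2" if "a \<in> W" for a
    proof -
      have "A a + 2 * f a v \<le> (MAX a\<in>W. A a + 2 * f a v)"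
        "A a - 2 * expectation (f a) \<le> (MAX a\<in>W. A a - 2 * expectation (f a))"
        using that W by (auto intro!: Max_ge)
      then show ?thesis by argo
    qed
    then show "(MAX a\<in>W. A a + (f a v - expectation (f a)))
        \<le> ((MAX a\<in>W. A a + 2 * f a v) + (MAX a\<in>W. A a - 2 * expectation (f a))) / 2"
      using W by (intro Max.boundedI) auto
  qed auto
  also have "\<dots> = ((\<integral>v. (MAX a\<in>W. A a + 2 * f a v) \<partial>M) + (MAX a\<in>W. A a - 2 * expectation (f a))) / 2"
    by (simp add: prob_space)
  also have "\<dots> \<le> ((\<integral>v. (MAX a\<in>W. A a + 2 * f a v) \<partial>M) + (\<integral>v. (MAX a\<in>W. A a - 2 * f a v) \<partial>M)) / 2"
    using J by simp
  also have "\<dots> = (\<integral>v. ((MAX a\<in>W. A a + 2 * f a v) + (MAX a\<in>W. A a - 2 * f a v)) / 2 \<partial>M)"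
    by simp
  also have "\<dots> \<le> (\<integral>v. ((MAX a\<in>W. A a + 2 * t a v) + (MAX a\<in>W. A a - 2 * t a v)) / 2 \<partial>M)"
  proof (intro integral_mono)
    fix v
    have "(MAX a\<in>W. A a + 2 * f a v) + (MAX a\<in>W. A a - 2 * f a v)
       \<le> (MAX a\<in>W. A a + 2 * t a v) + (MAX a\<in>W. A a - 2 * t a v)"
    proof (rule MAX_contraction[OF W])
      show "\<bar>2 * f a v - 2 * f b v\<bar> \<le> \<bar>2 * t a v - 2 * t b v\<bar>" if "a \<in> W" "b \<in> W" for a b
        using ft[OF that, of v] by arith
    qed
    then show "((MAX a\<in>W. A a + 2 * f a v) + (MAX a\<in>W. A a - 2 * f a v)) / 2
       \<le> ((MAX a\<in>W. A a + 2 * t a v) + (MAX a\<in>W. A a - 2 * t a v)) / 2" by simp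
  qed auto
  finally show ?thesis .
qed

text \<open>
  An inequality between expected maxima that holds for one observation and every offset \<open>A\<close> can
  be applied to the observations one after the other, the sum over the others being absorbed in
  the offset.
\<close>

lemma MAX_sum_comparison:
  fixes f :: "'i \<Rightarrow> 'v \<Rightarrow> real" and h :: "'i \<Rightarrow> 'z \<Rightarrow> real" and I :: "'k set"
  assumes P: "prob_space P" and Q: "prob_space Q" and W: "finite W" "W \<noteq> {}"
    and f[measurable]: "\<And>a. a \<in> W \<Longrightarrow> f a \<in> borel_measurable P" and h[measurable]: "\<And>a. a \<in> W \<Longrightarrow> h a \<in> borel_measurable Q"
    and fB: "\<And>a v. a \<in> W \<Longrightarrow> v \<in> space P \<Longrightarrow> \<bar>f a v\<bar> \<le> B" and hB: "\<And>a z. a \<in> W \<Longrightarrow> z \<in> space Q \<Longrightarrow> \<bar>h a z\<bar> \<le> B"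
    and le: "\<And>A. (\<integral>v. (MAX a\<in>W. A a + f a v) \<partial>P) \<le> (\<integral>z. (MAX a\<in>W. A a + h a z) \<partial>Q)"
    and I: "finite I"
  shows "(\<integral>x. (MAX a\<in>W. A a + (\<Sum>i\<in>I. f a (x i))) \<partial>Pi\<^sub>M I (\<lambda>_. P))
       \<le> (\<integral>x. (MAX a\<in>W. A a + (\<Sum>i\<in>I. h a (x i))) \<partial>Pi\<^sub>M I (\<lambda>_. Q))"
  using I
proof (induction I arbitrary: A rule: finite_induct)
  case empty
  then show ?case by (simp add: PiM_empty)
next
  case (insert i I)
  interpret P: prob_space P by fact
  interpret Q: prob_space Q by fact
  interpret PP: product_prob_space "\<lambda>_::'k. P" by standard
  interpret QQ: product_prob_space "\<lambda>_::'k. Q" by standard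
  interpret PI: prob_space "Pi\<^sub>M I (\<lambda>_. P)" by (intro prob_space_PiM P)
  interpret QI: prob_space "Pi\<^sub>M I (\<lambda>_. Q)" by (intro prob_space_PiM Q)
  interpret PJ: prob_space "Pi\<^sub>M (insert i I) (\<lambda>_. P)" by (intro prob_space_PiM P)
  interpret QJ: prob_space "Pi\<^sub>M (insert i I) (\<lambda>_. Q)" by (intro prob_space_PiM Q)
  interpret X: pair_prob_space P "Pi\<^sub>M I (\<lambda>_. P)" ..
  interpret Y: pair_prob_space P "Pi\<^sub>M I (\<lambda>_. Q)" ..
  interpret X: prob_space "P \<Otimes>\<^sub>M Pi\<^sub>M I (\<lambda>_. P)" by (rule prob_space_pair[OF P PI.prob_space_axioms])
  interpret Y: prob_space "P \<Otimes>\<^sub>M Pi\<^sub>M I (\<lambda>_. Q)" by (rule prob_space_pair[OF P QI.prob_space_axioms])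
  interpret Z: prob_space "Pi\<^sub>M I (\<lambda>_. Q) \<Otimes>\<^sub>M Q" by (rule prob_space_pair[OF QI.prob_space_axioms Q])
  interpret ZZ: pair_prob_space "Pi\<^sub>M I (\<lambda>_. Q)" Q ..
  define K where "K = (MAX a\<in>W. \<bar>A a\<bar>)"
  have K: "\<bar>A a\<bar> \<le> K" if "a \<in> W" for a using that W unfolding K_def by auto
  have sf: "\<bar>\<Sum>j\<in>J. f a (x j)\<bar> \<le> real (card J) * B" if "a \<in> W" "x \<in> space (Pi\<^sub>M J (\<lambda>_. P))" for a x and J :: "'k set"
    using that by (intro order_trans[OF sum_abs] sum_bounded_above fB) (auto simp: space_PiM)
  have sh: "\<bar>\<Sum>j\<in>J. h a (x j)\<bar> \<le> real (card J) * B" if "a \<in> W" "x \<in> space (Pi\<^sub>M J (\<lambda>_. Q))" for a x and J :: "'k set"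
    using that by (intro order_trans[OF sum_abs] sum_bounded_above hB) (auto simp: space_PiM)
  let ?n = "K + real (card I) * B + B"
  have eqf: "A a + (\<Sum>j\<in>insert i I. f a ((x(i:=v)) j)) = A a + f a v + (\<Sum>j\<in>I. f a (x j))" for a x v
    using insert by (subst sum.insert) (auto intro!: sum.cong)
  have eqh: "A a + (\<Sum>j\<in>insert i I. h a ((x(i:=v)) j)) = A a + (\<Sum>j\<in>I. h a (x j)) + h a v" for a x v
    using insert by (subst sum.insert) (auto intro!: sum.cong)
  have iPJ: "integrable (Pi\<^sub>M (insert i I) (\<lambda>_. P)) (\<lambda>x. MAX a\<in>W. A a + (\<Sum>j\<in>insert i I. f a (x j)))"
  proof (rule PJ.integrable_MAX_bounded[OF W, where K="K + real (card (insert i I)) * B"])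
    fix a x assume "a \<in> W" "x \<in> space (Pi\<^sub>M (insert i I) (\<lambda>_. P))"
    then show "\<bar>A a + (\<Sum>j\<in>insert i I. f a (x j))\<bar> \<le> K + real (card (insert i I)) * B"
      using K[of a] sf[of a x "insert i I"] by linarith
  qed measurable
  have iQJ: "integrable (Pi\<^sub>M (insert i I) (\<lambda>_. Q)) (\<lambda>x. MAX a\<in>W. A a + (\<Sum>j\<in>insert i I. h a (x j)))"
  proof (rule QJ.integrable_MAX_bounded[OF W, where K="K + real (card (insert i I)) * B"])
    fix a x assume "a \<in> W" "x \<in> space (Pi\<^sub>M (insert i I) (\<lambda>_. Q))"
    then show "\<bar>A a + (\<Sum>j\<in>insert i I. h a (x j))\<bar> \<le> K + real (card (insert i I)) * B"
      using K[of a] sh[of a x "insert i I"] by linarith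
  qed measurable
  have iX: "integrable (P \<Otimes>\<^sub>M Pi\<^sub>M I (\<lambda>_. P)) (\<lambda>(v, x). MAX a\<in>W. (A a + f a v) + (\<Sum>j\<in>I. f a (x j)))"
    unfolding case_prod_beta'
  proof (rule X.integrable_MAX_bounded[OF W, where K="?n"])
    fix a p assume "a \<in> W" "p \<in> space (P \<Otimes>\<^sub>M Pi\<^sub>M I (\<lambda>_. P))"
    then show "\<bar>A a + f a (fst p) + (\<Sum>j\<in>I. f a (snd p j))\<bar> \<le> ?n"
      using K[of a] fB[of a "fst p"] sf[of a "snd p" I]
      unfolding space_pair_measure mem_Times_iff by linarith
  qed measurable
  have iY: "integrable (P \<Otimes>\<^sub>M Pi\<^sub>M I (\<lambda>_. Q)) (\<lambda>(v, x). MAX a\<in>W. (A a + f a v) + (\<Sum>j\<in>I. h a (x j)))"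
    unfolding case_prod_beta'
  proof (rule Y.integrable_MAX_bounded[OF W, where K="?n"])
    fix a p assume "a \<in> W" "p \<in> space (P \<Otimes>\<^sub>M Pi\<^sub>M I (\<lambda>_. Q))"
    then show "\<bar>A a + f a (fst p) + (\<Sum>j\<in>I. h a (snd p j))\<bar> \<le> ?n"
      using K[of a] fB[of a "fst p"] sh[of a "snd p" I]
      unfolding space_pair_measure mem_Times_iff by linarith
  qed measurable
  have iZ: "integrable (Pi\<^sub>M I (\<lambda>_. Q) \<Otimes>\<^sub>M Q) (\<lambda>(x, z). MAX a\<in>W. (A a + (\<Sum>j\<in>I. h a (x j))) + h a z)"
    unfolding case_prod_beta'
  proof (rule Z.integrable_MAX_bounded[OF W, where K="?n"])
    fix a p assume "a \<in> W" "p \<in> space (Pi\<^sub>M I (\<lambda>_. Q) \<Otimes>\<^sub>M Q)"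
    then show "\<bar>A a + (\<Sum>j\<in>I. h a (fst p j)) + h a (snd p)\<bar> \<le> ?n"
      using K[of a] hB[of a "snd p"] sh[of a "fst p" I]
      unfolding space_pair_measure mem_Times_iff by linarith
  qed measurable
  have swap: "A a + f a v + s = A a + s + f a v" for a v s by simp
  have "(\<integral>x. (MAX a\<in>W. A a + (\<Sum>j\<in>insert i I. f a (x j))) \<partial>Pi\<^sub>M (insert i I) (\<lambda>_. P))
     = (\<integral>x. \<integral>v. (MAX a\<in>W. (A a + f a v) + (\<Sum>j\<in>I. f a (x j))) \<partial>P \<partial>Pi\<^sub>M I (\<lambda>_. P))"
    by (subst PP.product_integral_insert[OF insert.hyps iPJ]) (simp only: eqf)
  also have "\<dots> = (\<integral>v. \<integral>x. (MAX a\<in>W. (A a + f a v) + (\<Sum>j\<in>I. f a (x j))) \<partial>Pi\<^sub>M I (\<lambda>_. P) \<partial>P)"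
    by (rule X.Fubini_integral[OF iX])
  also have "\<dots> \<le> (\<integral>v. \<integral>x. (MAX a\<in>W. (A a + f a v) + (\<Sum>j\<in>I. h a (x j))) \<partial>Pi\<^sub>M I (\<lambda>_. Q) \<partial>P)"
    by (rule integral_mono[OF X.integrable_fst[OF iX] Y.integrable_fst[OF iY] insert.IH])
  also have "\<dots> = (\<integral>x. \<integral>v. (MAX a\<in>W. (A a + (\<Sum>j\<in>I. h a (x j))) + f a v) \<partial>P \<partial>Pi\<^sub>M I (\<lambda>_. Q))"
    unfolding swap[symmetric] by (rule Y.Fubini_integral[OF iY, symmetric])
  also have "\<dots> \<le> (\<integral>x. \<integral>z. (MAX a\<in>W. (A a + (\<Sum>j\<in>I. h a (x j))) + h a z) \<partial>Q \<partial>Pi\<^sub>M I (\<lambda>_. Q))"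
    by (rule integral_mono[OF Y.integrable_snd[OF iY, unfolded swap] ZZ.integrable_fst[OF iZ] le])
  also have "\<dots> = (\<integral>x. (MAX a\<in>W. A a + (\<Sum>j\<in>insert i I. h a (x j))) \<partial>Pi\<^sub>M (insert i I) (\<lambda>_. Q))"
    by (subst QQ.product_integral_insert[OF insert.hyps iQJ]) (simp only: eqh)
  finally show ?case .
qed

lemma second_moment_sum_PiM:
  fixes u :: "'z \<Rightarrow> real" and I :: "'k set"
  assumes Q: "prob_space Q" and u[measurable]: "u \<in> borel_measurable Q" and uB: "\<And>z. z \<in> space Q \<Longrightarrow> \<bar>u z\<bar> \<le> B"
    and u0: "(\<integral>z. u z \<partial>Q) = 0" and I: "finite I"
  shows "(\<integral>x. (\<Sum>i\<in>I. u (x i))\<^sup>2 \<partial>Pi\<^sub>M I (\<lambda>_. Q)) = real (card I) * (\<integral>z. (u z)\<^sup>2 \<partial>Q)"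
  using I
proof (induction I rule: finite_induct)
  case empty
  then show ?case by (simp add: PiM_empty)
next
  case (insert i I)
  interpret Q: prob_space Q by fact
  interpret QQ: product_prob_space "\<lambda>_::'k. Q" by standard
  interpret QI: prob_space "Pi\<^sub>M I (\<lambda>_. Q)" by (intro prob_space_PiM Q)
  interpret QJ: prob_space "Pi\<^sub>M (insert i I) (\<lambda>_. Q)" by (intro prob_space_PiM Q)
  have sB: "\<bar>\<Sum>j\<in>J. u (x j)\<bar> \<le> real (card J) * B" if "x \<in> space (Pi\<^sub>M J (\<lambda>_. Q))" for x and J :: "'k set"
    using that by (intro order_trans[OF sum_abs] sum_bounded_above uB) (auto simp: space_PiM)
  have sB2: "\<bar>(\<Sum>j\<in>J. u (x j))\<^sup>2\<bar> \<le> (real (card J) * B)\<^sup>2" if "x \<in> space (Pi\<^sub>M J (\<lambda>_. Q))" for x and J :: "'k set"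
    using power_mono[OF sB[OF that] abs_ge_zero, of 2] by simp
  have int: "integrable Q u" using uB by (intro Q.integrable_const_bound[where B=B] AE_I2) auto
  have "integrable Q (\<lambda>z. (u z)\<^sup>2)"
    using power_mono[OF uB abs_ge_zero, of _ 2] by (intro Q.integrable_const_bound[where B="B\<^sup>2"] AE_I2) auto
  note int = int this
  have int2: "integrable (Pi\<^sub>M I (\<lambda>_. Q)) (\<lambda>x. (\<Sum>i\<in>I. u (x i))\<^sup>2)"
    using sB2 by (auto intro!: QI.integrable_const_bound[where B="(real (card I) * B)\<^sup>2"] AE_I2)
  have eq: "(\<Sum>j\<in>insert i I. u ((x(i:=z)) j)) = (\<Sum>j\<in>I. u (x j)) + u z" for x z
    using insert by (subst sum.insert) (auto intro!: sum.cong)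
  have "(\<integral>x. (\<Sum>i\<in>insert i I. u (x i))\<^sup>2 \<partial>Pi\<^sub>M (insert i I) (\<lambda>_. Q))
     = (\<integral>x. \<integral>z. ((\<Sum>j\<in>I. u (x j)) + u z)\<^sup>2 \<partial>Q \<partial>Pi\<^sub>M I (\<lambda>_. Q))"
    using insert.hyps
  proof (subst QQ.product_integral_insert)
    show "integrable (Pi\<^sub>M (insert i I) (\<lambda>_. Q)) (\<lambda>x. (\<Sum>i\<in>insert i I. u (x i))\<^sup>2)"
    proof (rule QJ.integrable_const_bound[where B="(real (card (insert i I)) * B)\<^sup>2"])
      show "AE x in Pi\<^sub>M (insert i I) (\<lambda>_. Q). norm ((\<Sum>i\<in>insert i I. u (x i))\<^sup>2) \<le> (real (card (insert i I)) * B)\<^sup>2"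
        using sB2[of _ "insert i I"] by (intro AE_I2) (simp only: real_norm_def)
    qed measurable
  qed (simp_all only: eq simp_thms)
  also have "\<dots> = (\<integral>x. (\<Sum>j\<in>I. u (x j))\<^sup>2 + (\<integral>z. (u z)\<^sup>2 \<partial>Q) \<partial>Pi\<^sub>M I (\<lambda>_. Q))"
    using int by (simp add: power2_sum u0 Q.prob_space)
  also have "\<dots> = (\<integral>x. (\<Sum>j\<in>I. u (x j))\<^sup>2 \<partial>Pi\<^sub>M I (\<lambda>_. Q)) + (\<integral>z. (u z)\<^sup>2 \<partial>Q)"
    using int2 by (simp add: QI.prob_space)
  finally show ?case using insert by (simp add: algebra_simps)
qed

text \<open>
  A linear function \<open>\<lambda>w. \<Sum>J\<in>C. w J * s J\<close> is bounded on the simplex by the Euclidean norm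
  of \<open>s\<close>, whose second moment adds up over coordinates and observations. This is where the
  factor \<open>sqrt (card C)\<close> comes from.
\<close>

lemma (in prob_space) MAX_signed_sum_le:
  fixes d :: "'j \<Rightarrow> 'a \<Rightarrow> real" and W :: "('j \<Rightarrow> real) set"
  assumes W: "finite W" "W \<noteq> {}" and C: "finite C"
    and w: "\<And>w J. w \<in> W \<Longrightarrow> J \<in> C \<Longrightarrow> 0 \<le> w J" "\<And>w. w \<in> W \<Longrightarrow> (\<Sum>J\<in>C. w J) \<le> 1"
    and d[measurable]: "\<And>J. J \<in> C \<Longrightarrow> d J \<in> borel_measurable M" and dB: "\<And>J v. J \<in> C \<Longrightarrow> v \<in> space M \<Longrightarrow> \<bar>d J v\<bar> \<le> B"
    and d0: "\<And>J. J \<in> C \<Longrightarrow> expectation (d J) = 0" and B: "0 \<le> B" and I: "finite I"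
  shows "(\<integral>x. (MAX w\<in>W. \<Sum>i\<in>I. \<Sum>J\<in>C. w J * d J (x i)) \<partial>Pi\<^sub>M I (\<lambda>_. M))
    \<le> B * sqrt (real (card C) * real (card I))"
proof -
  interpret PI: prob_space "Pi\<^sub>M I (\<lambda>_. M)" by (rule prob_space_PiM) (rule prob_space_axioms)
  define s where "s J x = (\<Sum>i\<in>I. d J (x i))" for J x
  have s[measurable]: "s J \<in> borel_measurable (Pi\<^sub>M I (\<lambda>_. M))" if "J \<in> C" for J
    using that unfolding s_def by measurable
  have sB: "\<bar>s J x\<bar> \<le> real (card I) * B" if "J \<in> C" "x \<in> space (Pi\<^sub>M I (\<lambda>_. M))" for J x
    using that unfolding s_def by (intro order_trans[OF sum_abs] sum_bounded_above dB) (auto simp: space_PiM)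
  have sB2: "(s J x)\<^sup>2 \<le> (real (card I) * B)\<^sup>2" if "J \<in> C" "x \<in> space (Pi\<^sub>M I (\<lambda>_. M))" for J x
    using power_mono[OF sB[OF that] abs_ge_zero, of 2] by simp
  define N where "N x = sqrt (\<Sum>J\<in>C. (s J x)\<^sup>2)" for x
  have N[measurable]: "N \<in> borel_measurable (Pi\<^sub>M I (\<lambda>_. M))" unfolding N_def by measurable
  have N2: "(N x)\<^sup>2 = (\<Sum>J\<in>C. (s J x)\<^sup>2)" for x unfolding N_def by (simp add: sum_nonneg)
  have si: "integrable (Pi\<^sub>M I (\<lambda>_. M)) (\<lambda>x. (s J x)\<^sup>2)" if "J \<in> C" for J
    using that sB2 by (intro PI.integrable_const_bound[where B="(real (card I) * B)\<^sup>2"] AE_I2) auto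
  have N2i: "integrable (Pi\<^sub>M I (\<lambda>_. M)) (\<lambda>x. (N x)\<^sup>2)" unfolding N2 using si by auto
  have Ni: "integrable (Pi\<^sub>M I (\<lambda>_. M)) N"
    by (rule PI.square_integrable_imp_integrable) (use N2i in auto)
  have "(\<Sum>i\<in>I. \<Sum>J\<in>C. w J * d J (x i)) = (\<Sum>J\<in>C. w J * s J x)" for w x
    unfolding s_def sum_distrib_left by (rule sum.swap)
  then have eq: "(MAX w\<in>W. \<Sum>i\<in>I. \<Sum>J\<in>C. w J * d J (x i)) = (MAX w\<in>W. \<Sum>J\<in>C. w J * s J x)" for x
    by simp
  have N0: "0 \<le> N x" for x unfolding N_def by (simp add: sum_nonneg)
  have sN: "\<bar>s J x\<bar> \<le> N x" if "J \<in> C" for J x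
    unfolding N_def using that C by (intro real_le_rsqrt) (auto intro: member_le_sum)
  have wN: "\<bar>\<Sum>J\<in>C. w J * s J x\<bar> \<le> N x" if "w \<in> W" for w x
  proof -
    have "\<bar>\<Sum>J\<in>C. w J * s J x\<bar> \<le> (\<Sum>J\<in>C. w J * N x)"
      using w(1)[OF that] sN by (intro order_trans[OF sum_abs] sum_mono) (auto simp: abs_mult intro!: mult_left_mono)
    also have "\<dots> \<le> N x" unfolding sum_distrib_right[symmetric]
      using w(2)[OF that] N0[of x] by (simp add: mult_left_le_one_le sum_nonneg w(1)[OF that])
    finally show ?thesis .
  qed
  have "(\<integral>x. (MAX w\<in>W. \<Sum>i\<in>I. \<Sum>J\<in>C. w J * d J (x i)) \<partial>Pi\<^sub>M I (\<lambda>_. M)) \<le> PI.expectation N"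
    unfolding eq
  proof (rule integral_mono)
    show "integrable (Pi\<^sub>M I (\<lambda>_. M)) (\<lambda>x. MAX w\<in>W. \<Sum>J\<in>C. w J * s J x)"
      using Ni by (rule Bochner_Integration.integrable_bound)
        (use W in \<open>auto intro!: borel_measurable_Max abs_MAX_le AE_I2 order_trans[OF wN] simp: abs_of_nonneg[OF N0]\<close>)
    show "(MAX w\<in>W. \<Sum>J\<in>C. w J * s J x) \<le> N x" for x
      using abs_MAX_le[OF W, of "\<lambda>w. \<Sum>J\<in>C. w J * s J x" "N x"] wN by force
  qed (rule Ni)
  also have "\<dots> \<le> sqrt (PI.expectation (\<lambda>x. (N x)\<^sup>2))"
    using PI.variance_positive[of N] PI.variance_eq[OF Ni N2i] by (intro real_le_rsqrt) simp
  also have "PI.expectation (\<lambda>x. (N x)\<^sup>2) = (\<Sum>J\<in>C. PI.expectation (\<lambda>x. (s J x)\<^sup>2))"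
    unfolding N2 using si by simp
  also have "\<dots> = (\<Sum>J\<in>C. real (card I) * expectation (\<lambda>v. (d J v)\<^sup>2))"
    unfolding s_def using prob_space_axioms d dB d0 I by (intro sum.cong second_moment_sum_PiM) auto
  also have "\<dots> \<le> (\<Sum>J\<in>C. real (card I) * B\<^sup>2)"
  proof (intro sum_mono mult_left_mono)
    fix J assume J: "J \<in> C"
    have *: "(d J v)\<^sup>2 \<le> B\<^sup>2" if "v \<in> space M" for v using power_mono[OF dB[OF J that] abs_ge_zero, of 2] by simp
    have "integrable M (\<lambda>v. (d J v)\<^sup>2)"
      using J * by (intro integrable_const_bound[where B="B\<^sup>2"] AE_I2) auto
    then have "expectation (\<lambda>v. (d J v)\<^sup>2) \<le> expectation (\<lambda>v. B\<^sup>2)" using * by (intro integral_mono) auto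
    then show "expectation (\<lambda>v. (d J v)\<^sup>2) \<le> B\<^sup>2" by (simp add: prob_space)
  qed auto
  finally show ?thesis using B by (simp add: real_sqrt_mult ac_simps)
qed

lemma (in prob_space) integral_signed:
  fixes g :: "'a \<times> real \<Rightarrow> real"
  assumes g: "integrable (M \<Otimes>\<^sub>M measure_pmf (pmf_of_set {-1, 1 :: real})) g"
  shows "(\<integral>z. g z \<partial>(M \<Otimes>\<^sub>M measure_pmf (pmf_of_set {-1, 1 :: real})))
    = (\<integral>v. (g (v, 1) + g (v, -1)) / 2 \<partial>M)"
proof -
  interpret S: pair_prob_space M "measure_pmf (pmf_of_set {-1, 1 :: real})" ..
  show ?thesis
    using S.integral_fst'[OF g] by (simp add: integral_pmf_of_set add.commute)
qed

text \<open>
  Symmetrising and contracting one observation at a time turns the centred sum into a signed sum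
  that is linear in \<open>w\<close>, to which the second moment bound applies. A signed observation is a
  point of the product with a fair sign.
\<close>

lemma (in prob_space) MAX_centred_sum_le:
  fixes f :: "('j \<Rightarrow> real) \<Rightarrow> 'a \<Rightarrow> real" and d :: "'j \<Rightarrow> 'a \<Rightarrow> real" and W :: "('j \<Rightarrow> real) set" and I :: "'k set"
  assumes W: "finite W" "W \<noteq> {}" and C: "finite C"
    and w: "\<And>w J. w \<in> W \<Longrightarrow> J \<in> C \<Longrightarrow> 0 \<le> w J" "\<And>w. w \<in> W \<Longrightarrow> (\<Sum>J\<in>C. w J) \<le> 1"
    and d[measurable]: "\<And>J. J \<in> C \<Longrightarrow> d J \<in> borel_measurable M" and dB: "\<And>J v. J \<in> C \<Longrightarrow> \<bar>d J v\<bar> \<le> B"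
    and f[measurable]: "\<And>w. w \<in> W \<Longrightarrow> f w \<in> borel_measurable M" and fB: "\<And>w v. w \<in> W \<Longrightarrow> \<bar>f w v\<bar> \<le> B"
    and fd: "\<And>w w' v. w \<in> W \<Longrightarrow> w' \<in> W \<Longrightarrow> \<bar>f w v - f w' v\<bar> \<le> \<bar>(\<Sum>J\<in>C. w J * d J v) - (\<Sum>J\<in>C. w' J * d J v)\<bar>"
    and B: "0 \<le> B" and I: "finite I"
  shows "(\<integral>x. (MAX w\<in>W. \<Sum>i\<in>I. f w (x i) - expectation (f w)) \<partial>Pi\<^sub>M I (\<lambda>_. M))
    \<le> 2 * B * sqrt (real (card C) * real (card I))"
proof -
  define S where "S = M \<Otimes>\<^sub>M measure_pmf (pmf_of_set {-1, 1 :: real})"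
  \<comment> \<open>The sign is clipped so that \<open>d'\<close> is bounded on the whole product space and not only
    where the second coordinate is 1 or -1.\<close>
  define d' where "d' J z = 2 * (max (-1) (min 1 (snd z)) * d J (fst z))" for J and z :: "'a \<times> real"
  define t where "t w v = (\<Sum>J\<in>C. w J * d J v)" for w v
  interpret S: prob_space S unfolding S_def
    by (intro prob_space_pair prob_space_axioms) (rule measure_pmf.prob_space_axioms)
  have sm[measurable]: "snd \<in> borel_measurable S"
    unfolding S_def by (rule measurable_compose[OF measurable_snd]) simp
  have fm[measurable]: "fst \<in> S \<rightarrow>\<^sub>M M" unfolding S_def by measurable
  have d'm[measurable]: "d' J \<in> borel_measurable S" if "J \<in> C" for J
    unfolding d'_def using that by measurable
  have clip: "\<bar>max (-1) (min 1 x)\<bar> \<le> (1::real)" for x by (auto simp: max_def min_def)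
  have d'B: "\<bar>d' J z\<bar> \<le> 2 * B" if "J \<in> C" for J z
    using mult_mono[OF clip dB[OF that, of "fst z"]] B unfolding d'_def by (simp add: abs_mult)
  have tB: "\<bar>t w v\<bar> \<le> B" if "w \<in> W" for w v
  proof -
    have "\<bar>t w v\<bar> \<le> (\<Sum>J\<in>C. w J * B)" unfolding t_def
      using w(1)[OF that] dB by (intro order_trans[OF sum_abs] sum_mono) (auto simp: abs_mult intro!: mult_left_mono)
    also have "\<dots> \<le> B" unfolding sum_distrib_right[symmetric]
      using w(2)[OF that] B by (simp add: mult_left_le_one_le sum_nonneg w(1)[OF that])
    finally show ?thesis .
  qed
  have d'0: "S.expectation (d' J) = 0" if "J \<in> C" for J
  proof -
    have "integrable S (d' J)" using that d'B by (intro S.integrable_const_bound[where B="2 * B"] AE_I2) auto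
    then show ?thesis unfolding S_def by (subst integral_signed) (auto simp: d'_def)
  qed
  have Ef: "\<bar>expectation (f w)\<bar> \<le> B" if "w \<in> W" for w
  proof -
    have "integrable M (f w)" using that fB by (intro integrable_const_bound[where B=B]) auto
    then have "\<bar>expectation (f w)\<bar> \<le> expectation (\<lambda>v. B)"
      using that fB by (intro order_trans[OF integral_abs_bound] integral_mono) auto
    then show ?thesis by (simp add: prob_space)
  qed
  define h where "h w z = (\<Sum>J\<in>C. w J * d' J z)" for w z
  have ht: "h w (v, 1) = 2 * t w v" "h w (v, -1) = - 2 * t w v" for w v
    unfolding h_def t_def d'_def by (simp_all add: sum_distrib_left sum_negf ac_simps)
  have hB: "\<bar>h w z\<bar> \<le> 2 * B" if "w \<in> W" for w z
  proof -
    have "\<bar>h w z\<bar> \<le> (\<Sum>J\<in>C. w J * (2 * B))" unfolding h_def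
      using w(1)[OF that] by (intro order_trans[OF sum_abs] sum_mono) (simp add: abs_mult mult_left_mono d'B)
    also have "\<dots> \<le> 2 * B" unfolding sum_distrib_right[symmetric]
      using w(2)[OF that] B by (simp add: mult_left_le_one_le sum_nonneg w(1)[OF that])
    finally show ?thesis .
  qed
  have step: "(\<integral>v. (MAX w\<in>W. A w + (f w v - expectation (f w))) \<partial>M) \<le> (\<integral>z. (MAX w\<in>W. A w + h w z) \<partial>S)" for A
  proof -
    have "integrable S (\<lambda>z. MAX w\<in>W. A w + h w z)"
    proof (rule S.integrable_MAX_bounded[OF W, where K="(MAX w\<in>W. \<bar>A w\<bar>) + 2 * B"])
      fix w z assume "w \<in> W" then show "\<bar>A w + h w z\<bar> \<le> (MAX w\<in>W. \<bar>A w\<bar>) + 2 * B"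
        using hB[of w z] W by (intro order_trans[OF abs_triangle_ineq] add_mono) auto
    qed (unfold h_def, measurable)
    then have "(\<integral>z. (MAX w\<in>W. A w + h w z) \<partial>S)
        = (\<integral>v. ((MAX w\<in>W. A w + 2 * t w v) + (MAX w\<in>W. A w - 2 * t w v)) / 2 \<partial>M)"
      unfolding S_def by (subst integral_signed) (simp_all add: ht)
    then show ?thesis
      using MAX_centred_le_signed[OF W, of f t B A] fB tB fd unfolding t_def by simp
  qed
  have "(\<integral>x. (MAX w\<in>W. 0 + (\<Sum>i\<in>I. f w (x i) - expectation (f w))) \<partial>Pi\<^sub>M I (\<lambda>_. M))
      \<le> (\<integral>x. (MAX w\<in>W. 0 + (\<Sum>i\<in>I. h w (x i))) \<partial>Pi\<^sub>M I (\<lambda>_. S))"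
  proof (rule MAX_sum_comparison[OF prob_space_axioms S.prob_space_axioms W, where B="2 * B" and A="\<lambda>_. 0"
        and f="\<lambda>w v. f w v - expectation (f w)" and h=h])
    show "\<bar>f w v - expectation (f w)\<bar> \<le> 2 * B" if "w \<in> W" for w v
      using fB[OF that, of v] Ef[OF that] by linarith
    show "h w \<in> borel_measurable S" if "w \<in> W" for w unfolding h_def by measurable
    show "(\<lambda>v. f w v - expectation (f w)) \<in> borel_measurable M" if "w \<in> W" for w using that by measurable
  qed (simp_all only: hB step I)
  also have "\<dots> \<le> 2 * B * sqrt (real (card C) * real (card I))"
    unfolding h_def add_0
  proof (rule S.MAX_signed_sum_le[OF W C])
    show "0 \<le> w J" if "w \<in> W" "J \<in> C" for w J by (rule w(1)[OF that])
    show "(\<Sum>J\<in>C. w J) \<le> 1" if "w \<in> W" for w by (rule w(2)[OF that])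
  qed (use B I d'B d'0 in simp_all)
  finally show ?thesis by simp
qed

section \<open>Events of high probability\<close>

text \<open>
  The property \<open>P\<close> need not define a measurable set; it suffices that it holds on a measurable
  set of high probability. \<open>big_Op\<close>, \<open>unif_Op\<close> and \<open>little_op1\<close> are statements of this form.
\<close>

definition likely :: "'w measure \<Rightarrow> real \<Rightarrow> ('w \<Rightarrow> bool) \<Rightarrow> bool" where
  "likely M e P \<longleftrightarrow> (\<exists>A\<in>sets M. measure M A \<ge> 1 - e \<and> (\<forall>\<omega>\<in>A. P \<omega>))"

lemma likelyI: "A \<in> sets M \<Longrightarrow> measure M A \<ge> 1 - e \<Longrightarrow> (\<And>\<omega>. \<omega> \<in> A \<Longrightarrow> P \<omega>) \<Longrightarrow> likely M e P"
  unfolding likely_def by blast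

lemma likely_mono:
  assumes "likely M e P" "e \<le> e'" "\<And>\<omega>. P \<omega> \<Longrightarrow> Q \<omega>"
  shows "likely M e' Q"
proof -
  obtain A where A: "A \<in> sets M" "measure M A \<ge> 1 - e" "\<And>\<omega>. \<omega> \<in> A \<Longrightarrow> P \<omega>"
    using assms(1) unfolding likely_def by blast
  show ?thesis by (rule likelyI[OF A(1)]) (use A assms(2,3) in \<open>simp_all\<close>)
qed

lemma (in prob_space) likely_AE:
  assumes "likely M e P" and "AE \<omega> in M. P \<omega> \<longrightarrow> Q \<omega>"
  shows "likely M e Q"
proof -
  obtain A where A: "A \<in> sets M" "measure M A \<ge> 1 - e" "\<And>\<omega>. \<omega> \<in> A \<Longrightarrow> P \<omega>"
    using assms(1) unfolding likely_def by blast
  obtain N where N: "{\<omega>\<in>space M. \<not> (P \<omega> \<longrightarrow> Q \<omega>)} \<subseteq> N" "emeasure M N = 0" "N \<in> sets M"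
    using assms(2) by (rule AE_E)
  have N0: "N \<in> null_sets M" using N(2,3) by (rule null_setsI)
  show ?thesis
  proof (rule likelyI)
    show "A - N \<in> sets M" using A(1) N(3) by (rule sets.Diff)
    show "1 - e \<le> measure M (A - N)" using A(2) measure_Diff_null_set[OF A(1) N0] by simp
    show "Q \<omega>" if "\<omega> \<in> A - N" for \<omega>
      using that N(1) A(3)[of \<omega>] sets.sets_into_space[OF A(1)] by blast
  qed
qed

lemma (in prob_space) likely_conj:
  assumes "likely M e P" and "likely M e' Q"
  shows "likely M (e + e') (\<lambda>\<omega>. P \<omega> \<and> Q \<omega>)"
proof -
  obtain A where A: "A \<in> events" "prob A \<ge> 1 - e" "\<And>\<omega>. \<omega> \<in> A \<Longrightarrow> P \<omega>"
    using assms(1) unfolding likely_def by blast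
  obtain B where B: "B \<in> events" "prob B \<ge> 1 - e'" "\<And>\<omega>. \<omega> \<in> B \<Longrightarrow> Q \<omega>"
    using assms(2) unfolding likely_def by blast
  have "prob (A \<union> B) = prob A + prob B - prob (A \<inter> B)"
    by (rule measure_Un3; simp add: fmeasurable_eq_sets A(1) B(1))
  moreover have "prob (A \<union> B) \<le> 1" by simp
  ultimately have "prob (A \<inter> B) \<ge> 1 - (e + e')" using A(2) B(2) by linarith
  then show ?thesis by (intro likelyI[of "A \<inter> B"]) (use A B in simp_all)
qed

lemma unif_Op_likely:
  assumes "unif_Op M S Z r" "0 < e"
  obtains C where "C \<ge> 0" "\<forall>\<^sub>F n in sequentially. likely M e (\<lambda>\<omega>. \<forall>x\<in>S n. \<bar>Z n x \<omega>\<bar> \<le> C * \<bar>r n\<bar>)"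
proof -
  obtain C where C: "\<forall>\<^sub>F n in sequentially. likely M e (\<lambda>\<omega>. \<forall>x\<in>S n. \<bar>Z n x \<omega>\<bar> \<le> C * \<bar>r n\<bar>)"
    using assms unfolding unif_Op_def likely_def by blast
  have "C * \<bar>r n\<bar> \<le> max 0 C * \<bar>r n\<bar>" for n by (intro mult_right_mono) auto
  then have "likely M e (\<lambda>\<omega>. \<forall>x\<in>S n. \<bar>Z n x \<omega>\<bar> \<le> max 0 C * \<bar>r n\<bar>)"
    if "likely M e (\<lambda>\<omega>. \<forall>x\<in>S n. \<bar>Z n x \<omega>\<bar> \<le> C * \<bar>r n\<bar>)" for n
    by (intro likely_mono[OF that order_refl]) (meson order_trans)
  from eventually_mono[OF C this] show ?thesis by (intro that[of "max 0 C"]) simp_all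
qed

lemma big_Op_null_imp_little_op1:
  assumes Z: "big_Op M Z r" and r: "r \<longlonglongrightarrow> 0"
  shows "little_op1 M Z"
  unfolding little_op1_def
proof (intro allI impI)
  fix d e :: real assume d: "0 < d" and "0 < e"
  then obtain C where C: "\<forall>\<^sub>F n in sequentially. \<exists>A\<in>sets M. measure M A \<ge> 1 - e \<and> (\<forall>\<omega>\<in>A. \<bar>Z n \<omega>\<bar> \<le> C * \<bar>r n\<bar>)"
    using Z unfolding big_Op_def by blast
  have "(\<lambda>n. C * \<bar>r n\<bar>) \<longlonglongrightarrow> C * \<bar>0\<bar>" by (intro tendsto_intros r)
  then have "\<forall>\<^sub>F n in sequentially. C * \<bar>r n\<bar> < d" by (rule order_tendstoD) (simp add: d)
  with C show "\<forall>\<^sub>F n in sequentially. \<exists>A\<in>sets M. measure M A \<ge> 1 - e \<and> (\<forall>\<omega>\<in>A. \<bar>Z n \<omega>\<bar> \<le> d)"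
  proof eventually_elim
    case (elim n)
    then show ?case by (meson less_imp_le order_trans)
  qed
qed

section \<open>Deviations uniform in the weights\<close>

text \<open>
  Rounding every weight down to a multiple of \<open>1 / L\<close> gives coordinates whose sum is at most 1
  but in general not equal to 1, so the points of the net are subweights. The net contains 0;
  with it, a maximum over the net of quantities that vanish at 0 is nonnegative.
\<close>

lemma finite_weight_net:
  fixes C :: "nat set"
  assumes C: "finite C" and d: "0 < d"
  shows "\<exists>W. finite W \<and> (\<lambda>_. 0) \<in> W \<and>
    (\<forall>w\<in>W. (\<forall>J\<in>C. 0 \<le> w J) \<and> (\<Sum>J\<in>C. w J) \<le> (1::real)) \<and>
    (\<forall>w \<in> weight_set C. \<exists>w'\<in>W. (\<Sum>J\<in>C. \<bar>w J - w' J\<bar>) \<le> d)"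
proof -
  define L where "L = nat \<lceil>real (card C) / d\<rceil> + 1"
  have L0: "0 < real L" unfolding L_def by simp
  have "real (card C) / d \<le> real L" unfolding L_def by linarith
  then have L: "real (card C) / real L \<le> d" using d L0 by (simp add: field_simps)
  define F where "F = {w. \<forall>J. (J \<in> C \<longrightarrow> w J \<in> (\<lambda>k. real k / real L) ` {..L}) \<and> (J \<notin> C \<longrightarrow> w J = 0)}"
  define W where "W = F \<inter> {w. (\<Sum>J\<in>C. w J) \<le> 1}"
  have "finite F" unfolding F_def by (rule finite_set_of_finite_funs[OF C]) simp
  then have 1: "finite W" unfolding W_def by simp
  have "0 \<in> (\<lambda>k. real k / real L) ` {..L}" by (rule image_eqI[of _ _ 0]) simp_all
  then have 2: "(\<lambda>_. 0) \<in> W" unfolding W_def F_def by simp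
  have 3: "0 \<le> w J" if "w \<in> W" "J \<in> C" for w J
  proof -
    have "w J \<in> (\<lambda>k. real k / real L) ` {..L}" using that unfolding W_def F_def by simp
    then show ?thesis by auto
  qed
  have 4: "\<exists>w'\<in>W. (\<Sum>J\<in>C. \<bar>w J - w' J\<bar>) \<le> d" if w: "w \<in> weight_set C" for w
  proof -
    have w0: "0 \<le> w J" if "J \<in> C" for J using w that unfolding weight_set_def by simp
    have ws: "(\<Sum>J\<in>C. w J) = 1" using w unfolding weight_set_def by simp
    have w1: "w J \<le> 1" if "J \<in> C" for J
      using member_le_sum[OF that, of w] C w0 ws by simp
    define k where "k J = nat \<lfloor>w J * real L\<rfloor>" for J
    define w' where "w' J = (if J \<in> C then real (k J) / L else 0)" for J
    have k: "real (k J) \<le> w J * real L" "w J * real L \<le> real (k J) + 1" if "J \<in> C" for J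
    proof -
      have "0 \<le> w J * real L" using w0[OF that] by simp
      then show "real (k J) \<le> w J * real L" "w J * real L \<le> real (k J) + 1" unfolding k_def by linarith+
    qed
    have le: "w' J \<le> w J" "w J - w' J \<le> 1 / L" if "J \<in> C" for J
    proof -
      have "real (k J) / L \<le> w J" "w J \<le> (real (k J) + 1) / L"
        using k[OF that] L0 by (simp_all add: pos_le_divide_eq pos_divide_le_eq)
      then show "w' J \<le> w J" "w J - w' J \<le> 1 / L" using that unfolding w'_def by (simp_all add: add_divide_distrib)
    qed
    have "k J \<le> L" if "J \<in> C" for J
    proof -
      have "w J * real L \<le> real L" using w1[OF that] L0 by simp
      then show ?thesis using k(1)[OF that] by linarith
    qed
    then have "w' \<in> F" unfolding F_def w'_def by (auto intro!: imageI)
    moreover have "(\<Sum>J\<in>C. w' J) \<le> 1"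
      using sum_mono[of C w' w] le(1) ws by simp
    moreover have "(\<Sum>J\<in>C. \<bar>w J - w' J\<bar>) \<le> (\<Sum>J\<in>C. 1 / L)"
    proof (rule sum_mono)
      fix J assume "J \<in> C" then show "\<bar>w J - w' J\<bar> \<le> 1 / L" using le[of J] by linarith
    qed
    ultimately show ?thesis
      using L unfolding W_def by (intro bexI[of _ w']) simp_all
  qed
  show ?thesis
  proof (intro exI[of _ W] conjI ballI 1 2 3 4)
    show "(\<Sum>J\<in>C. w J) \<le> 1" if "w \<in> W" for w using that unfolding W_def by simp
  qed
qed

text \<open>
  Markov's inequality for the maximum, which is nonnegative because the zero weight competes.
\<close>

lemma (in prob_space) likely_MAX_centred_sum:
  fixes f :: "('j \<Rightarrow> real) \<Rightarrow> 'v \<Rightarrow> real" and d :: "'j \<Rightarrow> 'v \<Rightarrow> real" and V :: "'k \<Rightarrow> 'a \<Rightarrow> 'v"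
  assumes V: "indep_vars (\<lambda>_. S) V I" and P: "\<And>i. i \<in> I \<Longrightarrow> distr M S (V i) = P"
    and I: "finite I" "I \<noteq> {}" and C: "finite C" "C \<noteq> {}" and W: "finite W"
    and W0: "(\<lambda>_. 0) \<in> W" and w: "\<And>w J. w \<in> W \<Longrightarrow> J \<in> C \<Longrightarrow> 0 \<le> w J" "\<And>w. w \<in> W \<Longrightarrow> (\<Sum>J\<in>C. w J) \<le> 1"
    and d: "\<And>J. J \<in> C \<Longrightarrow> d J \<in> borel_measurable S" and dB: "\<And>J v. J \<in> C \<Longrightarrow> \<bar>d J v\<bar> \<le> B"
    and f: "\<And>w. w \<in> W \<Longrightarrow> f w \<in> borel_measurable S" and fB: "\<And>w v. w \<in> W \<Longrightarrow> \<bar>f w v\<bar> \<le> B"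
    and f0: "\<And>v. f (\<lambda>_. 0) v = 0"
    and fd: "\<And>w w' v. w \<in> W \<Longrightarrow> w' \<in> W \<Longrightarrow> \<bar>f w v - f w' v\<bar> \<le> \<bar>(\<Sum>J\<in>C. w J * d J v) - (\<Sum>J\<in>C. w' J * d J v)\<bar>"
    and B: "0 < B" and e: "0 < e"
  shows "likely M e (\<lambda>\<omega>. \<forall>w\<in>W. (\<Sum>i\<in>I. f w (V i \<omega>) - (\<integral>v. f w v \<partial>P)) \<le> 2 * B / e * sqrt (real (card C) * real (card I)))"
proof -
  obtain i0 where "i0 \<in> I" using I by auto
  have V'[measurable]: "V i \<in> M \<rightarrow>\<^sub>M S" if "i \<in> I" for i using V that unfolding indep_vars_def by auto
  have sP: "sets P = sets S" using P[OF \<open>i0 \<in> I\<close>] by auto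
  interpret P: prob_space P unfolding P[OF \<open>i0 \<in> I\<close>, symmetric] using \<open>i0 \<in> I\<close> by (intro prob_space_distr) simp
  note [measurable_cong] = sP
  note [measurable] = f d
  define m where "m x = (MAX w\<in>W. \<Sum>i\<in>I. f w (x i) - P.expectation (f w))" for x
  have Wne: "W \<noteq> {}" using W0 by auto
  have m[measurable]: "m \<in> borel_measurable (Pi\<^sub>M I (\<lambda>_. S))"
    unfolding m_def by (intro borel_measurable_Max W) measurable
  have "prob_space (Pi\<^sub>M I (\<lambda>_. P))" by (intro prob_space_PiM P.prob_space_axioms)
  then interpret PI: prob_space "Pi\<^sub>M I (\<lambda>_. P)" .
  have dist: "distr M (Pi\<^sub>M I (\<lambda>_. S)) (\<lambda>\<omega>. \<lambda>i\<in>I. V i \<omega>) = Pi\<^sub>M I (\<lambda>_. P)"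
    using indep_vars_iff_distr_eq_PiM'[OF I(2), of V "\<lambda>_. S", OF V'] V P by (simp cong: PiM_cong)
  have "m x \<ge> (\<Sum>i\<in>I. f (\<lambda>_. 0) (x i) - P.expectation (f (\<lambda>_. 0)))" for x
    unfolding m_def using W W0 by (intro Max_ge) auto
  moreover have "f (\<lambda>_. 0) = (\<lambda>_. 0)" using f0 by (rule ext)
  ultimately have m0: "0 \<le> m x" for x by simp
  have Ef: "\<bar>P.expectation (f w)\<bar> \<le> B" if "w \<in> W" for w
  proof -
    have "integrable P (f w)" using that fB by (intro P.integrable_const_bound[where B=B]) auto
    then have "\<bar>P.expectation (f w)\<bar> \<le> P.expectation (\<lambda>v. B)"
      using that fB by (intro order_trans[OF integral_abs_bound] integral_mono) auto
    then show ?thesis by (simp add: P.prob_space)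
  qed
  have mb: "\<bar>m x\<bar> \<le> real (card I) * (2 * B)" for x
    unfolding m_def
  proof (rule abs_MAX_le[OF W Wne])
    fix w assume "w \<in> W"
    then have "\<bar>f w v - P.expectation (f w)\<bar> \<le> 2 * B" for v using fB[of w v] Ef[of w] by linarith
    then show "\<bar>\<Sum>i\<in>I. f w (x i) - P.expectation (f w)\<bar> \<le> real (card I) * (2 * B)"
      by (intro order_trans[OF sum_abs] sum_bounded_above)
  qed
  let ?m = "\<lambda>\<omega>. m (\<lambda>i\<in>I. V i \<omega>)"
  have [measurable]: "(\<lambda>\<omega>. \<lambda>i\<in>I. V i \<omega>) \<in> M \<rightarrow>\<^sub>M Pi\<^sub>M I (\<lambda>_. S)" by measurable
  have mi: "integrable M ?m" using mb by (intro integrable_const_bound[where B="real (card I) * (2 * B)"]) auto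
  have "expectation ?m = PI.expectation m" unfolding dist[symmetric] by (subst integral_distr) auto
  also have "\<dots> \<le> 2 * B * sqrt (real (card C) * real (card I))"
    unfolding m_def using B
    by (intro P.MAX_centred_sum_le[where f=f and d=d and B=B and C=C and W=W and I=I])
      (use W Wne C w dB fB fd I in \<open>simp_all add: measurable_cong_sets[OF sP refl] f d\<close>)
  finally have Em: "expectation ?m \<le> 2 * B * sqrt (real (card C) * real (card I))" .
  define a where "a = 2 * B / e * sqrt (real (card C) * real (card I))"
  have a: "0 < a" unfolding a_def using B e I C by (simp add: card_gt_0_iff)
  have "prob {\<omega>\<in>space M. a \<le> ?m \<omega>} \<le> expectation ?m / a"
    using mi m0 a by (intro integral_Markov_inequality_measure[where A="space M"]) auto
  also have "\<dots> \<le> e"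
    using Em a e unfolding a_def by (simp add: field_simps)
  finally have "prob (space M - {\<omega>\<in>space M. a \<le> ?m \<omega>}) \<ge> 1 - e" by (subst prob_compl) auto
  moreover have "(\<Sum>i\<in>I. f w (V i \<omega>) - P.expectation (f w)) \<le> a"
    if "\<omega> \<in> space M - {\<omega>\<in>space M. a \<le> ?m \<omega>}" "w \<in> W" for \<omega> w
  proof -
    have "(\<Sum>i\<in>I. f w (V i \<omega>) - P.expectation (f w)) \<le> ?m \<omega>"
      unfolding m_def using W that(2) by (intro Max_ge) auto
    then show ?thesis using that(1) by auto
  qed
  ultimately show ?thesis unfolding likely_def a_def[symmetric]
    by (intro bexI[of _ "space M - {\<omega>\<in>space M. a \<le> ?m \<omega>}"]) auto
qed

text \<open>
  On a net of mesh \<open>1 / sqrt (card I)\<close> the maximal inequality applies to \<open>f\<close> and to its negative.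
  Leaving the net changes the sum by at most \<open>2 * B * sqrt (card I)\<close>, which is no larger than the
  order of the bound. The cardinality of the net does not enter the maximal inequality, so it may
  be as fine as necessary.
\<close>

lemma (in prob_space) likely_uniform_deviation:
  fixes f :: "(nat \<Rightarrow> real) \<Rightarrow> 'v \<Rightarrow> real" and d :: "nat \<Rightarrow> 'v \<Rightarrow> real" and V :: "'k \<Rightarrow> 'a \<Rightarrow> 'v"
  assumes V: "indep_vars (\<lambda>_. S) V I" and P: "\<And>i. i \<in> I \<Longrightarrow> distr M S (V i) = P"
    and I: "finite I" "I \<noteq> {}" and C: "finite C" "C \<noteq> {}"
    and d: "\<And>J. J \<in> C \<Longrightarrow> d J \<in> borel_measurable S" and dB: "\<And>J v. J \<in> C \<Longrightarrow> \<bar>d J v\<bar> \<le> B"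
    and f: "\<And>w. f w \<in> borel_measurable S" and f0: "\<And>v. f (\<lambda>_. 0) v = 0"
    and fd: "\<And>w w' v. \<bar>f w v - f w' v\<bar> \<le> \<bar>(\<Sum>J\<in>C. w J * d J v) - (\<Sum>J\<in>C. w' J * d J v)\<bar>"
    and B: "0 < B" and e: "0 < e"
  shows "likely M e (\<lambda>\<omega>. \<forall>w\<in>weight_set C. \<bar>\<Sum>i\<in>I. f w (V i \<omega>) - (\<integral>v. f w v \<partial>P)\<bar>
    \<le> (4 / e + 2) * B * sqrt (real (card C) * real (card I)))"
proof -
  obtain i0 where "i0 \<in> I" using I by auto
  have V'[measurable]: "V i \<in> M \<rightarrow>\<^sub>M S" if "i \<in> I" for i using V that unfolding indep_vars_def by auto
  have sP: "sets P = sets S" using P[OF \<open>i0 \<in> I\<close>] by auto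
  interpret P: prob_space P unfolding P[OF \<open>i0 \<in> I\<close>, symmetric] using \<open>i0 \<in> I\<close> by (intro prob_space_distr) simp
  note [measurable_cong] = sP
  note [measurable] = f d
  define r where "r = sqrt (real (card C) * real (card I))"
  have cI: "0 < card I" "0 < card C" using I C by (auto simp: card_gt_0_iff)
  obtain W where W: "finite W" "(\<lambda>_. 0) \<in> W"
    "\<And>w J. w \<in> W \<Longrightarrow> J \<in> C \<Longrightarrow> 0 \<le> w J" "\<And>w. w \<in> W \<Longrightarrow> (\<Sum>J\<in>C. w J) \<le> (1::real)"
    and net: "\<And>w. w \<in> weight_set C \<Longrightarrow> \<exists>w'\<in>W. (\<Sum>J\<in>C. \<bar>w J - w' J\<bar>) \<le> 1 / sqrt (real (card I))"
    using finite_weight_net[OF C(1), of "1 / sqrt (real (card I))"] cI by force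
  have lip: "\<bar>f w v - f w' v\<bar> \<le> (\<Sum>J\<in>C. \<bar>w J - w' J\<bar>) * B" for w w' v
  proof -
    have "\<bar>f w v - f w' v\<bar> \<le> \<bar>\<Sum>J\<in>C. (w J - w' J) * d J v\<bar>"
      using fd[of w v w'] by (simp add: left_diff_distrib sum_subtractf)
    also have "\<dots> \<le> (\<Sum>J\<in>C. \<bar>w J - w' J\<bar> * B)"
      by (intro order_trans[OF sum_abs] sum_mono) (auto simp: abs_mult intro!: mult_left_mono dB)
    finally show ?thesis by (simp add: sum_distrib_right)
  qed
  have fB: "\<bar>f w v\<bar> \<le> (\<Sum>J\<in>C. \<bar>w J\<bar>) * B" for w v using lip[of w v "\<lambda>_. 0"] by (simp add: f0)
  have fW: "\<bar>f w v\<bar> \<le> B" if "w \<in> W" for w v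
  proof -
    have "(\<Sum>J\<in>C. \<bar>w J\<bar>) \<le> 1" using W(3,4)[OF that] by simp
    then have "(\<Sum>J\<in>C. \<bar>w J\<bar>) * B \<le> 1 * B" using B by (intro mult_right_mono) auto
    then show ?thesis using fB[of w v] by linarith
  qed
  have fi: "integrable P (f w)" for w using fB by (intro P.integrable_const_bound[where B="(\<Sum>J\<in>C. \<bar>w J\<bar>) * B"]) auto
  have up: "likely M (e/2) (\<lambda>\<omega>. \<forall>w\<in>W. (\<Sum>i\<in>I. f w (V i \<omega>) - P.expectation (f w)) \<le> 2 * B / (e/2) * r)"
    unfolding r_def
    by (rule likely_MAX_centred_sum[where f=f and d=d and B=B and V=V and S=S and P=P and I=I and C=C and W=W])
      (use V P I C W d dB f fW f0 fd B e in simp_all)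
  have "likely M (e/2) (\<lambda>\<omega>. \<forall>w\<in>W. (\<Sum>i\<in>I. - f w (V i \<omega>) - P.expectation (\<lambda>v. - f w v)) \<le> 2 * B / (e/2) * r)"
    unfolding r_def
  proof (rule likely_MAX_centred_sum[where f="\<lambda>w v. - f w v" and d=d and B=B
        and V=V and S=S and P=P and I=I and C=C and W=W])
    show "\<bar>- f w v - - f w' v\<bar> \<le> \<bar>(\<Sum>J\<in>C. w J * d J v) - (\<Sum>J\<in>C. w' J * d J v)\<bar>" for w w' v
      using fd[of w v w'] by linarith
  qed (use V P I C W d dB f fW f0 B e in simp_all)
  from likely_conj[OF up this]
  have "likely M e (\<lambda>\<omega>. \<forall>w\<in>W. \<bar>\<Sum>i\<in>I. f w (V i \<omega>) - P.expectation (f w)\<bar> \<le> 4 * B / e * r)"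
    by (rule likely_mono) (auto simp: sum_subtractf sum_negf abs_le_iff)
  then show ?thesis
  proof (rule likely_mono[OF _ order_refl], intro ballI)
    fix \<omega> w assume grid: "\<forall>w\<in>W. \<bar>\<Sum>i\<in>I. f w (V i \<omega>) - P.expectation (f w)\<bar> \<le> 4 * B / e * r"
      and "w \<in> weight_set C"
    then obtain w' where w': "w' \<in> W" "(\<Sum>J\<in>C. \<bar>w J - w' J\<bar>) \<le> 1 / sqrt (real (card I))"
      using net by auto
    define q where "q = B / sqrt (real (card I))"
    have *: "\<bar>f w v - f w' v\<bar> \<le> q" for v
      using order_trans[OF lip mult_right_mono[OF w'(2)]] B unfolding q_def by simp
    have "\<bar>P.expectation (\<lambda>v. f w v - f w' v)\<bar> \<le> P.expectation (\<lambda>v. q)"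
      using * fi by (intro order_trans[OF integral_abs_bound] integral_mono) auto
    then have **: "\<bar>P.expectation (f w) - P.expectation (f w')\<bar> \<le> q" using fi by (simp add: P.prob_space)
    have "\<bar>(f w v - P.expectation (f w)) - (f w' v - P.expectation (f w'))\<bar> \<le> 2 * q" for v
      using *[of v] ** by linarith
    then have "\<bar>\<Sum>i\<in>I. (f w (V i \<omega>) - P.expectation (f w)) - (f w' (V i \<omega>) - P.expectation (f w'))\<bar> \<le> real (card I) * (2 * q)"
      by (intro order_trans[OF sum_abs] sum_bounded_above)
    also have "\<dots> = 2 * B * sqrt (real (card I))"
      unfolding q_def using cI by (simp add: real_div_sqrt field_simps)
    also have "\<dots> \<le> 2 * B * r" unfolding r_def real_sqrt_mult using B cI by simp
    finally have "\<bar>(\<Sum>i\<in>I. f w (V i \<omega>) - P.expectation (f w)) - (\<Sum>i\<in>I. f w' (V i \<omega>) - P.expectation (f w'))\<bar> \<le> 2 * B * r"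
      by (simp only: sum_subtractf)
    moreover have "\<bar>\<Sum>i\<in>I. f w' (V i \<omega>) - P.expectation (f w')\<bar> \<le> 4 * B / e * r"
      using grid w'(1) by blast
    ultimately have "\<bar>\<Sum>i\<in>I. f w (V i \<omega>) - P.expectation (f w)\<bar> \<le> 4 * B / e * r + 2 * B * r"
      by linarith
    then show "\<bar>\<Sum>i\<in>I. f w (V i \<omega>) - P.expectation (f w)\<bar> \<le> (4 / e + 2) * B * sqrt (real (card C) * real (card I))"
      unfolding r_def[symmetric] by (simp add: field_simps)
  qed
qed

section \<open>The check loss\<close>

lemma check_loss_eq: "check_loss \<tau> u = \<tau> * u + max 0 (- u)"
  unfolding check_loss_def by (simp add: algebra_simps)

lemma check_loss_measurable[measurable]: "check_loss \<tau> \<in> borel_measurable borel"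
  unfolding check_loss_eq[abs_def] by measurable

lemma check_loss_lipschitz:
  assumes "0 < \<tau>" "\<tau> < 1"
  shows "\<bar>check_loss \<tau> a - check_loss \<tau> b\<bar> \<le> \<bar>a - b\<bar>"
proof -
  have *: "\<bar>check_loss \<tau> a - check_loss \<tau> b\<bar> \<le> a - b" if "b \<le> a" for a b
  proof -
    have "0 \<le> \<tau> * (a - b)" "\<tau> * (a - b) \<le> a - b"
      using assms that by (simp_all add: mult_left_le_one_le)
    then have "\<tau> * b \<le> \<tau> * a" "\<tau> * a - \<tau> * b \<le> a - b" by (auto simp: algebra_simps)
    then show ?thesis unfolding check_loss_eq using that by (auto simp: max_def)
  qed
  show ?thesis using *[of a b] *[of b a] by linarith
qed

lemma check_loss_subgradient: "check_loss \<tau> u - t * (\<tau> - indicator {..0} u) \<le> check_loss \<tau> (u - t)"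
  unfolding check_loss_eq by (auto simp: algebra_simps max_def split: split_indicator)

section \<open>Conditional expectations on events outside the algebra\<close>

text \<open>
  The hypothesis is tested on the part of \<open>B\<close> where \<open>h\<close> exceeds \<open>K\<close>.
\<close>

lemma AE_le_on_of_integral_le:
  fixes h :: "'w \<Rightarrow> real"
  assumes M: "prob_space M" and F: "subalgebra M F"
    and hF: "h \<in> borel_measurable F" and h: "integrable M h" and B: "B \<in> sets F"
    and le: "\<And>E. E \<in> sets F \<Longrightarrow> E \<subseteq> B \<Longrightarrow> (LINT \<omega>:E|M. h \<omega>) \<le> K * measure M E"
  shows "AE \<omega> in M. \<omega> \<in> B \<longrightarrow> h \<omega> \<le> K"
proof -
  interpret prob_space M by fact
  note [measurable] = hF B
  define E where "E = {\<omega>\<in>space F. \<omega> \<in> B \<and> K < h \<omega>}"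
  have EF: "E \<in> sets F" unfolding E_def by measurable
  have EM: "E \<in> events" using EF F unfolding subalgebra_def by blast
  have iE: "integrable M (\<lambda>\<omega>. indicator E \<omega> * h \<omega>)" "integrable M (\<lambda>\<omega>. indicator E \<omega> * K)"
    using integrable_mult_indicator[OF EM h] integrable_mult_indicator[OF EM, of "\<lambda>_. K"] by simp_all
  then have i: "integrable M (\<lambda>\<omega>. indicator E \<omega> * (h \<omega> - K))" by (simp add: right_diff_distrib)
  have nn: "0 \<le> indicator E \<omega> * (h \<omega> - K)" for \<omega>
    unfolding E_def by (simp split: split_indicator)
  have "(LINT \<omega>|M. indicator E \<omega> * (h \<omega> - K)) = (LINT \<omega>:E|M. h \<omega>) - K * measure M E"
    using iE EM by (simp add: right_diff_distrib set_lebesgue_integral_def mult.commute)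
  also have "\<dots> \<le> 0" using le[OF EF] unfolding E_def by auto
  finally have "(LINT \<omega>|M. indicator E \<omega> * (h \<omega> - K)) = 0"
    using nn by (intro antisym integral_nonneg_AE) simp_all
  then have "AE \<omega> in M. indicator E \<omega> * (h \<omega> - K) = 0"
    using integral_nonneg_eq_0_iff_AE[OF i] nn by simp
  then show ?thesis
  proof (rule AE_mp, intro AE_I2 impI)
    fix \<omega> assume "\<omega> \<in> space M" "indicator E \<omega> * (h \<omega> - K) = 0" "\<omega> \<in> B"
    then show "h \<omega> \<le> K" using F unfolding E_def subalgebra_def by (auto split: split_indicator_asm)
  qed
qed

text \<open>
  The accuracy of the estimates is known on events \<open>A\<close> that need not belong to the algebra
  \<open>F\<close> of the data, as they control suprema over uncountably many points, whereas conditional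
  expectations given \<open>F\<close> are controlled by integrals over events of \<open>F\<close>. The set where the
  conditional probability of \<open>A\<close> is positive is the smallest event of \<open>F\<close> containing \<open>A\<close>, up to
  null sets. Every single bound between \<open>F\<close>-measurable quantities that holds on \<open>A\<close> therefore
  holds on it almost surely.
\<close>

lemma measurable_hull:
  assumes M: "prob_space M" and F: "subalgebra M F" and A: "A \<in> sets M"
  obtains B where "B \<in> sets F" "AE \<omega> in M. \<omega> \<in> A \<longrightarrow> \<omega> \<in> B"
    "\<And>C. C \<in> sets F \<Longrightarrow> (AE \<omega> in M. \<omega> \<in> A \<longrightarrow> \<omega> \<in> C) \<Longrightarrow> AE \<omega> in M. \<omega> \<in> B \<longrightarrow> \<omega> \<in> C"
proof -
  interpret prob_space M by fact
  interpret finite_measure_subalgebra M F by standard fact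
  define h where "h = real_cond_exp M F (indicator A)"
  have iA: "integrable M (indicator A :: _ \<Rightarrow> real)"
    using A by (intro integrable_real_indicator) (simp_all add: less_top[symmetric])
  have hF[measurable]: "h \<in> borel_measurable F" unfolding h_def by simp
  have hi: "integrable M h" unfolding h_def using iA by (rule real_cond_exp_int)
  have h0: "AE \<omega> in M. 0 \<le> h \<omega>" unfolding h_def using A by (intro real_cond_exp_pos) simp_all
  define B where "B = {\<omega>\<in>space F. 0 < h \<omega>}"
  have BF: "B \<in> sets F" unfolding B_def by measurable
  have sp: "space F = space M" using F unfolding subalgebra_def by simp
  have int: "(LINT \<omega>:C|M. h \<omega>) = prob (C \<inter> A)" if "C \<in> sets F" for C
  proof -
    have C: "C \<in> events" using that F unfolding subalgebra_def by blast
    have "(LINT \<omega>:C|M. h \<omega>) = (LINT \<omega>:C|M. indicator A \<omega>)"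
      unfolding h_def by (rule real_cond_exp_intA[OF iA that, symmetric])
    also have "\<dots> = prob (C \<inter> A)"
      using A C by (simp add: set_lebesgue_integral_def indicator_inter_arith[symmetric])
    finally show ?thesis .
  qed
  have null: "AE \<omega> in M. \<omega> \<in> A \<longrightarrow> \<omega> \<notin> C" if "C \<in> sets F" "prob (C \<inter> A) = 0" for C
  proof -
    have "C \<inter> A \<in> events" using that(1) F A unfolding subalgebra_def by blast
    then have "AE \<omega> in M. \<omega> \<notin> C \<inter> A" using that(2) by (simp add: prob_eq_0)
    then show ?thesis by (rule AE_mp) (intro AE_I2, blast)
  qed
  show ?thesis
  proof (rule that[OF BF])
    define C where "C = space F - B"
    have CF: "C \<in> sets F" unfolding C_def using BF by (rule sets.compl_sets)
    have "(LINT \<omega>:C|M. h \<omega>) = (LINT \<omega>|M. 0)"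
      unfolding set_lebesgue_integral_def
    proof (rule integral_cong_AE)
      show "AE \<omega> in M. indicat_real C \<omega> *\<^sub>R h \<omega> = 0"
        using h0 by (rule AE_mp) (intro AE_I2, auto simp: C_def B_def split: split_indicator)
      have "C \<in> events" using CF F unfolding subalgebra_def by blast
      then show "(\<lambda>\<omega>. indicat_real C \<omega> *\<^sub>R h \<omega>) \<in> borel_measurable M" using hi by measurable
    qed simp
    then have "prob (C \<inter> A) = 0" using int[OF CF] by simp
    from null[OF CF this] show "AE \<omega> in M. \<omega> \<in> A \<longrightarrow> \<omega> \<in> B"
      by (rule AE_mp) (intro AE_I2, auto simp: C_def sp)
  next
    fix C assume C: "C \<in> sets F" "AE \<omega> in M. \<omega> \<in> A \<longrightarrow> \<omega> \<in> C"
    have D: "B - C \<in> sets F" using BF C(1) by (rule sets.Diff)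
    then have DM: "B - C \<in> events" using F unfolding subalgebra_def by blast
    have "AE \<omega> in M. \<omega> \<notin> (B - C) \<inter> A" using C(2) by (rule AE_mp) (intro AE_I2, blast)
    then have "prob ((B - C) \<inter> A) = 0" using DM A by (simp add: prob_eq_0)
    then have z: "(LINT \<omega>|M. indicat_real (B - C) \<omega> *\<^sub>R h \<omega>) = 0"
      using int[OF D] unfolding set_lebesgue_integral_def by simp
    have i: "integrable M (\<lambda>\<omega>. indicat_real (B - C) \<omega> *\<^sub>R h \<omega>)"
      by (rule integrable_mult_indicator[OF DM hi])
    have nn: "0 \<le> indicat_real (B - C) \<omega> *\<^sub>R h \<omega>" for \<omega>
      by (auto simp: B_def split: split_indicator)
    have "AE \<omega> in M. indicat_real (B - C) \<omega> *\<^sub>R h \<omega> = 0"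
      using z integral_nonneg_eq_0_iff_AE[OF i] nn by simp
    then show "AE \<omega> in M. \<omega> \<in> B \<longrightarrow> \<omega> \<in> C"
      by (rule AE_mp) (intro AE_I2, auto simp: B_def split: split_indicator_asm)
  qed
qed

text \<open>
  \<open>real_cond_exp\<close> is defined for all arguments and can be positive only if its conditioning
  algebra is a subalgebra and the conditioned function is measurable.
\<close>

lemma real_cond_exp_indicator_pos:
  assumes "0 < real_cond_exp M F (\<lambda>x. indicator A (g x)) \<omega>"
  shows "subalgebra M F" "(\<lambda>x. indicator A (g x) :: real) \<in> borel_measurable M"
proof -
  have "0 < enn2real (nn_cond_exp M F (\<lambda>x. ennreal (indicator A (g x))) \<omega>)"
    using assms enn2real_nonneg[of "nn_cond_exp M F (\<lambda>x. ennreal (- indicator A (g x))) \<omega>"]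
    unfolding real_cond_exp_def by linarith
  then have *: "subalgebra M F" "(\<lambda>x. ennreal (indicator A (g x))) \<in> borel_measurable M"
    unfolding nn_cond_exp_def by (auto split: if_splits)
  show "subalgebra M F" by (rule *)
  have "(\<lambda>x. enn2real (ennreal (indicator A (g x)))) \<in> borel_measurable M" using *(2) by measurable
  then show "(\<lambda>x. indicator A (g x) :: real) \<in> borel_measurable M" by simp
qed

lemma set_integral_cond_exp_le:
  fixes X :: "'w \<Rightarrow> real"
  assumes M: "prob_space M" and F: "subalgebra M F" and X: "integrable M X" and E: "E \<in> sets F"
    and le: "AE \<omega> in M. \<omega> \<in> E \<longrightarrow> real_cond_exp M F X \<omega> \<le> K"
  shows "(\<integral>\<omega>. indicator E \<omega> * X \<omega> \<partial>M) \<le> K * measure M E"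
proof -
  interpret prob_space M by fact
  interpret finite_measure_subalgebra M F by standard fact
  have EM: "E \<in> events" using E F unfolding subalgebra_def by blast
  have i: "integrable M (\<lambda>\<omega>. indicator E \<omega> * real_cond_exp M F X \<omega>)" "integrable M (\<lambda>\<omega>. indicator E \<omega> * K)"
    using integrable_mult_indicator[OF EM real_cond_exp_int(1)[OF X]] integrable_mult_indicator[OF EM, of "\<lambda>_. K"] by simp_all
  have "(\<integral>\<omega>. indicator E \<omega> * X \<omega> \<partial>M) = (\<integral>\<omega>. indicator E \<omega> * real_cond_exp M F X \<omega> \<partial>M)"
    using real_cond_exp_intA[OF X E] unfolding set_lebesgue_integral_def by simp
  also have "\<dots> \<le> (\<integral>\<omega>. indicator E \<omega> * K \<partial>M)"
    using le by (intro integral_mono_AE i) (auto split: split_indicator)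
  also have "\<dots> = K * measure M E" using EM by simp
  finally show ?thesis .
qed

section \<open>Integrals of perturbed products\<close>

lemma ennreal_le_plusI: "0 \<le> a \<Longrightarrow> 0 \<le> b \<Longrightarrow> x \<le> a + b \<Longrightarrow> ennreal x \<le> ennreal a + ennreal b"
  using ennreal_leI[of x "a + b"] by (simp add: ennreal_plus)

text \<open>
  If \<open>g\<close> is not integrable, the right-hand side is infinite.
\<close>

lemma abs_integral_diff_le_nn_integral:
  fixes g g0 :: "'a \<Rightarrow> real"
  assumes g: "g \<in> borel_measurable N" and g0: "integrable N g0"
  shows "ennreal \<bar>(\<integral>t. g t \<partial>N) - (\<integral>t. g0 t \<partial>N)\<bar> \<le> (\<integral>\<^sup>+t. ennreal \<bar>g t - g0 t\<bar> \<partial>N)"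
proof (cases "(\<integral>\<^sup>+t. ennreal \<bar>g t - g0 t\<bar> \<partial>N) = \<infinity>")
  case False
  have m: "(\<lambda>t. g t - g0 t) \<in> borel_measurable N" using g g0 by simp
  have d: "integrable N (\<lambda>t. g t - g0 t)"
    using False m by (intro integrableI_bounded) (simp_all add: top.not_eq_extremum)
  have "integrable N (\<lambda>t. (g t - g0 t) + g0 t)" using d g0 by (rule Bochner_Integration.integrable_add)
  then have "integrable N g" by simp
  then have "(\<integral>t. g t \<partial>N) - (\<integral>t. g0 t \<partial>N) = (\<integral>t. g t - g0 t \<partial>N)" using g0 by simp
  then show ?thesis using integral_norm_bound_ennreal[OF d] by simp
qed simp

lemma product_perturbation:
  fixes b b0 x x0 \<delta> :: real
  assumes "\<bar>b - b0\<bar> \<le> \<delta>"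
  shows "\<bar>b * x - b0 * x0\<bar> \<le> (\<bar>b0\<bar> + \<delta>) * \<bar>x - x0\<bar> + \<delta> * \<bar>x0\<bar>"
proof -
  have "b * x - b0 * x0 = b * (x - x0) + (b - b0) * x0" by (simp add: algebra_simps)
  then have "\<bar>b * x - b0 * x0\<bar> \<le> \<bar>b\<bar> * \<bar>x - x0\<bar> + \<bar>b - b0\<bar> * \<bar>x0\<bar>"
    by (metis abs_mult abs_triangle_ineq)
  also have "\<dots> \<le> (\<bar>b0\<bar> + \<delta>) * \<bar>x - x0\<bar> + \<delta> * \<bar>x0\<bar>"
    using assms by (intro add_mono mult_right_mono) auto
  finally show ?thesis .
qed

lemma integral_product_perturbation:
  fixes b x b0 x0 :: "'a \<Rightarrow> real"
  assumes N: "finite_measure N" and b: "b \<in> borel_measurable N" and x: "x \<in> borel_measurable N"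
    and b0: "integrable N b0" and x0: "integrable N x0" and bx: "integrable N (\<lambda>t. b0 t * x0 t)"
    and db: "\<And>t. t \<in> space N \<Longrightarrow> \<bar>b t - b0 t\<bar> \<le> \<delta>" and dx: "\<And>t. t \<in> space N \<Longrightarrow> \<bar>x t - x0 t\<bar> \<le> \<gamma>"
    and \<delta>: "0 \<le> \<delta>"
  shows "\<bar>(\<integral>t. b t * x t \<partial>N) - (\<integral>t. b0 t * x0 t \<partial>N)\<bar>
    \<le> ((\<integral>t. \<bar>b0 t\<bar> \<partial>N) + \<delta> * measure N (space N)) * \<gamma> + \<delta> * (\<integral>t. \<bar>x0 t\<bar> \<partial>N)"
proof -
  interpret finite_measure N by fact
  let ?R = "\<lambda>t. (\<bar>b0 t\<bar> + \<delta>) * \<gamma> + \<delta> * \<bar>x0 t\<bar>"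
  have iR: "integrable N ?R" using b0 x0 by simp
  have le: "\<bar>b t * x t - b0 t * x0 t\<bar> \<le> ?R t" if t: "t \<in> space N" for t
  proof -
    have "(\<bar>b0 t\<bar> + \<delta>) * \<bar>x t - x0 t\<bar> \<le> (\<bar>b0 t\<bar> + \<delta>) * \<gamma>"
      using dx[OF t] \<delta> by (intro mult_left_mono) auto
    then show ?thesis using product_perturbation[OF db[OF t], of "x t" "x0 t"] by linarith
  qed
  have R0: "0 \<le> ?R t" if "t \<in> space N" for t using le[OF that] by linarith
  have "ennreal \<bar>(\<integral>t. b t * x t \<partial>N) - (\<integral>t. b0 t * x0 t \<partial>N)\<bar> \<le> (\<integral>\<^sup>+t. ennreal (?R t) \<partial>N)"
    using b x le
    by (intro order_trans[OF abs_integral_diff_le_nn_integral[OF _ bx]] nn_integral_mono ennreal_leI) simp_all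
  also have "\<dots> = ennreal (\<integral>t. ?R t \<partial>N)" using iR R0 by (intro nn_integral_eq_integral AE_I2)
  finally have "\<bar>(\<integral>t. b t * x t \<partial>N) - (\<integral>t. b0 t * x0 t \<partial>N)\<bar> \<le> (\<integral>t. ?R t \<partial>N)"
    using R0 by (subst (asm) ennreal_le_iff) (auto intro!: integral_nonneg_AE AE_I2)
  also have "\<dots> = ((\<integral>t. \<bar>b0 t\<bar> \<partial>N) + \<delta> * measure N (space N)) * \<gamma> + \<delta> * (\<integral>t. \<bar>x0 t\<bar> \<partial>N)"
    using b0 x0 by (simp add: algebra_simps)
  finally show ?thesis .
qed

lemma L2_on_mult_integrable:
  assumes "S \<in> sets borel" "f \<in> L2_on S" "g \<in> L2_on S"
  shows "set_integrable lborel S (\<lambda>t. f t * g t)"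
proof -
  have f: "set_borel_measurable lborel S f" "set_integrable lborel S (\<lambda>t. (f t)\<^sup>2)"
    and g: "set_borel_measurable lborel S g" "set_integrable lborel S (\<lambda>t. (g t)\<^sup>2)"
    using assms(2,3) unfolding L2_on_def by auto
  have i: "integrable lborel (\<lambda>t. indicator S t *\<^sub>R (f t)\<^sup>2 + indicator S t *\<^sub>R (g t)\<^sup>2)"
    using f(2) g(2) unfolding set_integrable_def by (rule Bochner_Integration.integrable_add)
  have eq: "(\<lambda>t. indicat_real S t *\<^sub>R (f t * g t)) = (\<lambda>t. (indicat_real S t *\<^sub>R f t) * (indicat_real S t *\<^sub>R g t))"
    by (auto simp: indicator_def)
  show ?thesis unfolding set_integrable_def
  proof (rule Bochner_Integration.integrable_bound[OF i])
    show "(\<lambda>t. indicat_real S t *\<^sub>R (f t * g t)) \<in> borel_measurable lborel"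
      unfolding eq using f(1) g(1) unfolding set_borel_measurable_def by (rule borel_measurable_times)
    have "\<bar>f t * g t\<bar> \<le> (f t)\<^sup>2 + (g t)\<^sup>2" for t
      using sum_squares_bound[of "\<bar>f t\<bar>" "\<bar>g t\<bar>"] mult_nonneg_nonneg[of "\<bar>f t\<bar>" "\<bar>g t\<bar>"]
      unfolding abs_mult power2_abs by linarith
    then show "AE t in lborel. norm (indicat_real S t *\<^sub>R (f t * g t)) \<le> norm (indicat_real S t *\<^sub>R (f t)\<^sup>2 + indicat_real S t *\<^sub>R (g t)\<^sup>2)"
      by (intro AE_I2) (auto simp: indicator_def)
  qed
qed

section \<open>Near-minimisers and blocks\<close>

text \<open>
  The criterion \<open>V\<close> agrees up to \<open>l\<close> with \<open>\<theta> * S\<close> plus a constant, and \<open>R\<close> agrees up to \<open>k\<close>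
  with \<open>S\<close>. A minimiser \<open>u\<close> of \<open>V\<close> thus minimises \<open>\<theta> * S\<close> up to \<open>2 * l\<close>, hence \<open>S\<close> up to
  \<open>4 * l\<close>, hence \<open>R\<close> up to \<open>2 * k + 4 * l\<close>, and the infimum of \<open>R\<close> is at least \<open>s / 2\<close>.
\<close>

lemma minimizer_ratio:
  fixes S R V :: "'a \<Rightarrow> real"
  assumes W: "u \<in> W" and min: "\<And>w. w \<in> W \<Longrightarrow> V u \<le> V w"
    and R: "\<And>w. w \<in> W \<Longrightarrow> \<bar>R w - S w\<bar> \<le> k"
    and V: "\<And>w. w \<in> W \<Longrightarrow> \<bar>V w - b - \<theta> * S w\<bar> \<le> l"
    and \<theta>: "1 / 2 \<le> \<theta>" and S: "\<And>w. w \<in> W \<Longrightarrow> s \<le> S w" and s: "0 < s" and k: "k \<le> s / 2"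
  shows "\<bar>R u / (INF w\<in>W. R w) - 1\<bar> \<le> (2 * k + 4 * l) * (2 / s)"
proof -
  have ne: "W \<noteq> {}" using W by auto
  have l0: "0 \<le> l" using V[OF W] by linarith
  have "S u \<le> S w + 4 * l" if w: "w \<in> W" for w
  proof -
    have "\<theta> * (S u - S w) \<le> 2 * l"
      using V[OF W] V[OF w] min[OF w] unfolding right_diff_distrib by linarith
    show ?thesis
    proof (cases "S w \<le> S u")
      case True
      then have "1 / 2 * (S u - S w) \<le> \<theta> * (S u - S w)" using \<theta> by (intro mult_right_mono) simp_all
      from order_trans[OF this \<open>\<theta> * (S u - S w) \<le> 2 * l\<close>] show ?thesis by simp
    qed (use l0 in linarith)
  qed
  then have le: "R u - (2 * k + 4 * l) \<le> R w" if "w \<in> W" for w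
    using R[OF W] R[OF that] that by fastforce
  have low: "s / 2 \<le> R w" if "w \<in> W" for w using R[OF that] S[OF that] k by linarith
  define I where "I = (INF w\<in>W. R w)"
  have bdd: "bdd_below (R ` W)" using low by (intro bdd_belowI[of _ "s / 2"]) blast
  have "I \<le> R u" unfolding I_def by (rule cINF_lower[OF bdd W])
  moreover have "R u - (2 * k + 4 * l) \<le> I" unfolding I_def by (rule cINF_greatest[OF ne le])
  moreover have I: "s / 2 \<le> I" unfolding I_def by (rule cINF_greatest[OF ne low])
  ultimately have d: "0 \<le> R u - I" "R u - I \<le> 2 * k + 4 * l" by linarith+
  have I0: "0 < I" using I s by linarith
  have "\<bar>R u / I - 1\<bar> = (R u - I) / I" using d(1) I0 by (simp add: diff_divide_distrib abs_of_nonneg[of "R u / I - 1"])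
  also have "\<dots> \<le> (2 * k + 4 * l) / (s / 2)"
    using d I s by (intro frac_le) linarith+
  also have "\<dots> = (2 * k + 4 * l) * (2 / s)" using s by simp
  finally show ?thesis unfolding I_def .
qed

lemma sum_blocks:
  fixes h :: "nat \<Rightarrow> real"
  shows "(\<Sum>k=1..K. \<Sum>r=1..L. h ((k - 1) * L + r)) = (\<Sum>i=1..K * L. h i)"
proof (induction K)
  case (Suc K)
  have "(\<Sum>r=1..L. h (K * L + r)) = (\<Sum>i=K * L + 1..K * L + L. h i)"
    using sum.shift_bounds_cl_nat_ivl[of h 1 "K * L" L] by (simp add: add.commute)
  then have "(\<Sum>i=1..K * L. h i) + (\<Sum>r=1..L. h (K * L + r)) = (\<Sum>i=1..K * L + L. h i)"
    using sum.ub_add_nat[of 1 "K * L" h L] by simp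
  then show ?case using Suc by (simp add: add.commute)
qed simp

section \<open>The limiting risk\<close>

lemma space_path_space [simp]: "space (path_space S) = UNIV"
  unfolding path_space_def by (simp add: space_measure_of_conv)

lemma path_integral_measurable:
  assumes "f \<in> L2_on S"
  shows "(\<lambda>x. LINT t:S|lborel. f t * x t) \<in> borel_measurable (path_space S)"
proof (rule measurableI)
  fix B :: "real set" assume "B \<in> sets borel"
  then have "(\<lambda>x. LINT t:S|lborel. f t * x t) -` B \<in> sets (path_space S)"
    unfolding path_space_def using assms by (subst sets_measure_of) (auto intro!: sigma_sets.Basic)
  then show "(\<lambda>x. LINT t:S|lborel. f t * x t) -` B \<inter> space (path_space S) \<in> sets (path_space S)" by simp
qed simp

locale quantile_averaging =
  fixes m :: "'w fq_model" and p :: "'w fq_proc" and q :: "'w fq_limits"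
    and c g :: "nat \<Rightarrow> real"
    and D :: "nat \<Rightarrow> nat \<Rightarrow> real \<Rightarrow> 'w \<Rightarrow> real"
    and FPE :: "nat \<Rightarrow> (nat \<Rightarrow> real) \<Rightarrow> 'w \<Rightarrow> real"
    and what :: "nat \<Rightarrow> 'w \<Rightarrow> nat \<Rightarrow> real"
  assumes curve: "curve_model m" and quantile: "quantile_model m" and observation: "observation_model m"
    and estimation: "estimation m p" and FPE: "FPE_version m p FPE" and CV_weights: "CV_weights m p what"
    and limits: "limit_objects m p q" and bounded: "bounded_limits m p q"
    and cond1: "condition1 m p q D c" and cond2: "condition2 m p q"
    and cond3: "condition3 m p g" and cond4: "condition4 m p q c g"

sublocale quantile_averaging \<subseteq> prob_space "prb m"
  using curve unfolding curve_model_def by blast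

context quantile_averaging
begin

abbreviation weights :: "nat \<Rightarrow> (nat \<Rightarrow> real) set" where
  "weights n \<equiv> weight_set (cand p n)"

abbreviation loss :: "real \<Rightarrow> real" where
  "loss \<equiv> check_loss (qlev m)"

abbreviation risk_lim :: "nat \<Rightarrow> (nat \<Rightarrow> real) \<Rightarrow> real" where
  "risk_lim n \<equiv> EFPE_lim m p q n"

abbreviation model_rate :: "nat \<Rightarrow> real" where
  "model_rate n \<equiv> sqrt (real (card (cand p n))) / sqrt (real n)"

abbreviation risk_scale :: "nat \<Rightarrow> real" where
  "risk_scale n \<equiv> inverse (eta m p q n) * real n"

abbreviation pair_space :: "(real \<times> (real \<Rightarrow> real)) measure" where
  "pair_space \<equiv> borel \<Otimes>\<^sub>M paths_of m"

abbreviation cond_exp :: "nat \<Rightarrow> ('w \<Rightarrow> real) \<Rightarrow> 'w \<Rightarrow> real" where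
  "cond_exp n \<equiv> real_cond_exp (prb m) (data_alg m n)"

lemma qlev: "0 < qlev m" "qlev m < 1"
  using curve unfolding curve_model_def by simp_all

lemma cand: assumes "1 \<le> n" shows "finite (cand p n)" "cand p n \<noteq> {}"
  using estimation assms unfolding estimation_def by simp_all

lemma folds: "2 \<le> folds p"
  using estimation unfolding estimation_def by blast

definition obs_pair :: "nat \<Rightarrow> 'w \<Rightarrow> real \<times> (real \<Rightarrow> real)" where
  "obs_pair i \<omega> = (resp m i \<omega>, curve m i \<omega>)"

definition pair_law :: "(real \<times> (real \<Rightarrow> real)) measure" where
  "pair_law = distr (prb m) pair_space (obs_pair 0)"

lemma indep_pairs: "indep_vars (\<lambda>_. pair_space) obs_pair UNIV"
  using curve unfolding curve_model_def obs_pair_def[abs_def] by blast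

lemma obs_pair_measurable[measurable]: "obs_pair i \<in> prb m \<rightarrow>\<^sub>M pair_space"
  using indep_pairs unfolding indep_vars_def by blast

lemma resp_measurable[measurable]: "resp m i \<in> borel_measurable (prb m)"
  using measurable_compose[OF obs_pair_measurable measurable_fst] unfolding obs_pair_def by simp

lemma curve_measurable[measurable]: "curve m i \<in> prb m \<rightarrow>\<^sub>M paths_of m"
  using measurable_compose[OF obs_pair_measurable measurable_snd] unfolding obs_pair_def by simp

lemma distr_obs_pair: "distr (prb m) pair_space (obs_pair i) = pair_law"
proof -
  have "\<forall>i. distr (prb m) pair_space (\<lambda>\<omega>. (resp m i \<omega>, curve m i \<omega>)) =
          distr (prb m) pair_space (\<lambda>\<omega>. (resp m 0 \<omega>, curve m 0 \<omega>))"
    using curve unfolding curve_model_def by blast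
  then show ?thesis unfolding pair_law_def obs_pair_def[abs_def] by blast
qed

text \<open>
  \<open>cond_quant\<close> integrates the product of the slope with the centred path. With the integral split
  into two, the function is measurable on the path space, and it agrees with \<open>cond_quant\<close> on
  square-integrable paths.
\<close>

definition cond_quant' :: "(real \<Rightarrow> real) \<Rightarrow> real" where
  "cond_quant' x = icept m + ((LINT t:dom_of m|lborel. slope m t * x t) -
     (LINT t:dom_of m|lborel. slope m t * mean_fun m t))"

lemma slope_L2: "slope m \<in> L2_on (dom_of m)" and mean_L2: "mean_fun m \<in> L2_on (dom_of m)"
  using quantile curve unfolding quantile_model_def curve_model_def by blast+

lemma cond_quant'_measurable[measurable]: "cond_quant' \<in> borel_measurable (paths_of m)"
  unfolding cond_quant'_def[abs_def] using path_integral_measurable[OF slope_L2] by measurable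

lemma AE_cond_quant: "AE \<omega> in prb m. cond_quant m (curve m i \<omega>) = cond_quant' (curve m i \<omega>)"
proof -
  have "AE \<omega> in prb m. curve m i \<omega> \<in> L2_on (dom_of m)"
    using curve unfolding curve_model_def by blast
  then show ?thesis
  proof (rule AE_mp, intro AE_I2 impI)
    fix \<omega> assume "curve m i \<omega> \<in> L2_on (dom_of m)"
    then have "set_integrable lborel (dom_of m) (\<lambda>t. slope m t * curve m i \<omega> t)"
      "set_integrable lborel (dom_of m) (\<lambda>t. slope m t * mean_fun m t)"
      using slope_L2 mean_L2 L2_on_mult_integrable[of "dom_of m"] by (simp_all add: dom_of_def)
    then show "cond_quant m (curve m i \<omega>) = cond_quant' (curve m i \<omega>)"
      unfolding cond_quant_def cond_quant'_def right_diff_distrib by (simp add: set_integral_diff)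
  qed
qed

definition dev_bound :: real where
  "dev_bound = (SOME r. r > 0 \<and> (\<forall>n\<ge>1. \<forall>i\<le>n. \<forall>J\<in>cand p n. AE \<omega> in prb m.
        \<bar>quant_lim q n J (curve m i \<omega>) - cond_quant m (curve m i \<omega>)\<bar> \<le> r))"

lemma dev_bound: "dev_bound > 0"
  "1 \<le> n \<Longrightarrow> i \<le> n \<Longrightarrow> J \<in> cand p n \<Longrightarrow> AE \<omega> in prb m. \<bar>quant_lim q n J (curve m i \<omega>) - cond_quant m (curve m i \<omega>)\<bar> \<le> dev_bound"
  using someI_ex[OF cond2[unfolded condition2_def]] unfolding dev_bound_def[symmetric] by simp_all

text \<open>
  The truncation affects only a null set of paths of the subjects and makes the deviation bounded
  for every path.
\<close>

definition quant_dev :: "nat \<Rightarrow> nat \<Rightarrow> (real \<Rightarrow> real) \<Rightarrow> real" where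
  "quant_dev n J x = max (- dev_bound) (min dev_bound (quant_lim q n J x - cond_quant' x))"

definition avg_dev :: "nat \<Rightarrow> (nat \<Rightarrow> real) \<Rightarrow> (real \<Rightarrow> real) \<Rightarrow> real" where
  "avg_dev n w x = (\<Sum>J\<in>cand p n. w J * quant_dev n J x)"

text \<open>
  Subtracting the loss at the conditional quantile makes the loss bounded, although the response
  may be unbounded.
\<close>

definition excess_loss :: "nat \<Rightarrow> (nat \<Rightarrow> real) \<Rightarrow> real \<times> (real \<Rightarrow> real) \<Rightarrow> real" where
  "excess_loss n w v = loss (fst v - cond_quant' (snd v) - avg_dev n w (snd v)) -
     loss (fst v - cond_quant' (snd v))"

lemma quant_lim_measurable: "1 \<le> n \<Longrightarrow> J \<in> cand p n \<Longrightarrow> quant_lim q n J \<in> borel_measurable (paths_of m)"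
  using limits unfolding limit_objects_def by blast

lemma quant_dev_measurable: "1 \<le> n \<Longrightarrow> J \<in> cand p n \<Longrightarrow> quant_dev n J \<in> borel_measurable (paths_of m)"
  unfolding quant_dev_def[abs_def] using quant_lim_measurable by measurable

lemma quant_dev_bound: "\<bar>quant_dev n J x\<bar> \<le> dev_bound"
  unfolding quant_dev_def using dev_bound(1) by (auto simp: max_def min_def)

lemma avg_dev_measurable: "1 \<le> n \<Longrightarrow> avg_dev n w \<in> borel_measurable (paths_of m)"
  unfolding avg_dev_def[abs_def] by (intro borel_measurable_sum borel_measurable_times borel_measurable_const quant_dev_measurable)

lemma excess_loss_measurable:
  assumes "1 \<le> n" shows "excess_loss n w \<in> borel_measurable pair_space"
  using avg_dev_measurable[OF assms, measurable] unfolding excess_loss_def[abs_def] by measurable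

lemma excess_loss_zero: "excess_loss n (\<lambda>_. 0) v = 0"
  unfolding excess_loss_def avg_dev_def by simp

lemma excess_loss_lipschitz: "\<bar>excess_loss n w v - excess_loss n w' v\<bar> \<le> \<bar>avg_dev n w (snd v) - avg_dev n w' (snd v)\<bar>"
  using check_loss_lipschitz[OF qlev, of "fst v - cond_quant' (snd v) - avg_dev n w (snd v)" "fst v - cond_quant' (snd v) - avg_dev n w' (snd v)"]
  unfolding excess_loss_def by linarith

lemma avg_dev_diff_le: "\<bar>avg_dev n w x - avg_dev n w' x\<bar> \<le> (\<Sum>J\<in>cand p n. \<bar>w J - w' J\<bar>) * dev_bound"
  unfolding avg_dev_def sum_subtractf[symmetric] left_diff_distrib[symmetric] sum_distrib_right
  by (intro order_trans[OF sum_abs] sum_mono) (simp add: abs_mult mult_left_mono quant_dev_bound)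

lemma excess_loss_diff_le: "\<bar>excess_loss n w v - excess_loss n w' v\<bar> \<le> (\<Sum>J\<in>cand p n. \<bar>w J - w' J\<bar>) * dev_bound"
  by (rule order_trans[OF excess_loss_lipschitz avg_dev_diff_le])

lemma avg_dev_bound: "\<bar>avg_dev n w x\<bar> \<le> (\<Sum>J\<in>cand p n. \<bar>w J\<bar>) * dev_bound"
  using avg_dev_diff_le[of n w x "\<lambda>_. 0"] unfolding avg_dev_def by simp

lemma excess_loss_bound: "\<bar>excess_loss n w v\<bar> \<le> (\<Sum>J\<in>cand p n. \<bar>w J\<bar>) * dev_bound"
  using excess_loss_diff_le[of n w v "\<lambda>_. 0"] by (simp add: excess_loss_zero)

lemma excess_loss_pair_integrable: "1 \<le> n \<Longrightarrow> integrable (prb m) (\<lambda>\<omega>. excess_loss n w (obs_pair i \<omega>))"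
  using measurable_compose[OF obs_pair_measurable excess_loss_measurable] excess_loss_bound
  by (intro integrable_const_bound[where B="(\<Sum>J\<in>cand p n. \<bar>w J\<bar>) * dev_bound"]) auto

lemma pair_law_excess_loss: "1 \<le> n \<Longrightarrow> (\<integral>v. excess_loss n w v \<partial>pair_law) = (\<integral>\<omega>. excess_loss n w (obs_pair 0 \<omega>) \<partial>prb m)"
  unfolding pair_law_def using excess_loss_measurable by (subst integral_distr) auto

lemma AE_quant_lim:
  assumes n: "1 \<le> n"
  shows "AE \<omega> in prb m. \<forall>i\<le>n. q_err m i \<omega> = resp m i \<omega> - cond_quant' (curve m i \<omega>) \<and>
    (\<forall>J\<in>cand p n. quant_lim q n J (curve m i \<omega>) = cond_quant' (curve m i \<omega>) + quant_dev n J (curve m i \<omega>))"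
    (is "AE \<omega> in _. \<forall>i\<le>n. ?P \<omega> i")
proof -
  have "AE \<omega> in prb m. \<forall>i\<in>{..n}. ?P \<omega> i"
  proof (rule AE_finite_allI[OF finite_atMost])
    fix i assume i: "i \<in> {..n}"
    have "AE \<omega> in prb m. \<forall>J\<in>cand p n. \<bar>quant_lim q n J (curve m i \<omega>) - cond_quant m (curve m i \<omega>)\<bar> \<le> dev_bound"
      using i by (intro AE_finite_allI cand n dev_bound) auto
    with AE_cond_quant[of i] show "AE \<omega> in prb m. ?P \<omega> i"
    proof eventually_elim
      case (elim \<omega>)
      have "quant_lim q n J (curve m i \<omega>) = cond_quant' (curve m i \<omega>) + quant_dev n J (curve m i \<omega>)" if "J \<in> cand p n" for J
      proof -
        have "\<bar>quant_lim q n J (curve m i \<omega>) - cond_quant' (curve m i \<omega>)\<bar> \<le> dev_bound" using elim that by simp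
        then show ?thesis unfolding quant_dev_def by linarith
      qed
      then show ?case using elim(1) unfolding q_err_def by simp
    qed
  qed
  then show ?thesis unfolding Ball_def atMost_iff .
qed

lemma weight_sum: "w \<in> weight_set C \<Longrightarrow> (\<Sum>J\<in>C. w J) = 1" "w \<in> weight_set C \<Longrightarrow> J \<in> C \<Longrightarrow> 0 \<le> w J"
  "w \<in> weight_set C \<Longrightarrow> (\<Sum>J\<in>C. \<bar>w J\<bar>) = 1"
  unfolding weight_set_def by auto

lemma AE_excess_loss:
  assumes n: "1 \<le> n"
  shows "AE \<omega> in prb m. \<forall>i\<le>n. \<forall>w\<in>weights n.
    loss (resp m i \<omega> - avg_quant_lim p q n w (curve m i \<omega>)) =
      loss (q_err m i \<omega>) + excess_loss n w (obs_pair i \<omega>)"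
  using AE_quant_lim[OF n]
proof eventually_elim
  case (elim \<omega>)
  show ?case
  proof (intro allI impI ballI)
    fix i w assume i: "i \<le> n" and w: "w \<in> weights n"
    have "avg_quant_lim p q n w (curve m i \<omega>) = (\<Sum>J\<in>cand p n. w J * (cond_quant' (curve m i \<omega>) + quant_dev n J (curve m i \<omega>)))"
      unfolding avg_quant_lim_def using elim i by (intro sum.cong) auto
    also have "\<dots> = cond_quant' (curve m i \<omega>) + avg_dev n w (curve m i \<omega>)"
      unfolding avg_dev_def by (simp add: distrib_left sum.distrib weight_sum(1)[OF w] flip: sum_distrib_right)
    finally show "loss (resp m i \<omega> - avg_quant_lim p q n w (curve m i \<omega>)) =
        loss (q_err m i \<omega>) + excess_loss n w (obs_pair i \<omega>)"
      using elim i unfolding excess_loss_def obs_pair_def by (simp add: diff_diff_eq)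
  qed
qed

lemma base_integrable: "integrable (prb m) (\<lambda>\<omega>. loss (q_err m 0 \<omega>))"
  using quantile unfolding quantile_model_def by blast

lemma limit_loss_integrable:
  assumes n: "1 \<le> n" and w: "w \<in> weights n"
  shows "integrable (prb m) (\<lambda>\<omega>. loss (resp m 0 \<omega> - avg_quant_lim p q n w (curve m 0 \<omega>)))"
    and "risk_lim n w = (\<integral>\<omega>. excess_loss n w (obs_pair 0 \<omega>) \<partial>prb m)"
proof -
  note [measurable] = quant_lim_measurable[OF n]
  have m1[measurable]: "(\<lambda>\<omega>. loss (resp m 0 \<omega> - avg_quant_lim p q n w (curve m 0 \<omega>))) \<in> borel_measurable (prb m)"
    unfolding avg_quant_lim_def by measurable
  have i: "integrable (prb m) (\<lambda>\<omega>. loss (q_err m 0 \<omega>) + excess_loss n w (obs_pair 0 \<omega>))"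
    using base_integrable excess_loss_pair_integrable[OF n] by (rule Bochner_Integration.integrable_add)
  have ae: "AE \<omega> in prb m. loss (resp m 0 \<omega> - avg_quant_lim p q n w (curve m 0 \<omega>)) =
      loss (q_err m 0 \<omega>) + excess_loss n w (obs_pair 0 \<omega>)"
    using AE_excess_loss[OF n] by (rule AE_mp) (intro AE_I2 impI, simp add: w)
  show "integrable (prb m) (\<lambda>\<omega>. loss (resp m 0 \<omega> - avg_quant_lim p q n w (curve m 0 \<omega>)))"
    using i integrable_cong_AE[OF m1 borel_measurable_integrable[OF i] ae] by blast
  have "(\<integral>\<omega>. loss (resp m 0 \<omega> - avg_quant_lim p q n w (curve m 0 \<omega>)) \<partial>prb m) =
    (\<integral>\<omega>. loss (q_err m 0 \<omega>) + excess_loss n w (obs_pair 0 \<omega>) \<partial>prb m)"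
    using i ae by (intro integral_cong_AE m1) (rule borel_measurable_integrable)
  also have "\<dots> = base_risk m + (\<integral>\<omega>. excess_loss n w (obs_pair 0 \<omega>) \<partial>prb m)"
    unfolding base_risk_def by (rule Bochner_Integration.integral_add[OF base_integrable excess_loss_pair_integrable[OF n]])
  finally show "risk_lim n w = (\<integral>\<omega>. excess_loss n w (obs_pair 0 \<omega>) \<partial>prb m)"
    unfolding EFPE_lim_def by simp
qed

lemma EFPE_lim_diff_le:
  assumes n: "1 \<le> n" and w: "w \<in> weights n" "w' \<in> weights n"
  shows "\<bar>risk_lim n w - risk_lim n w'\<bar> \<le> (\<Sum>J\<in>cand p n. \<bar>w J - w' J\<bar>) * dev_bound"
proof -
  note i = excess_loss_pair_integrable[OF n]
  have "\<bar>risk_lim n w - risk_lim n w'\<bar> = \<bar>\<integral>\<omega>. excess_loss n w (obs_pair 0 \<omega>) - excess_loss n w' (obs_pair 0 \<omega>) \<partial>prb m\<bar>"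
    using limit_loss_integrable(2)[OF n] w i by simp
  also have "\<dots> \<le> (\<integral>\<omega>. (\<Sum>J\<in>cand p n. \<bar>w J - w' J\<bar>) * dev_bound \<partial>prb m)"
    using i excess_loss_diff_le
    by (intro order_trans[OF integral_abs_bound] integral_mono) simp_all
  also have "\<dots> = (\<Sum>J\<in>cand p n. \<bar>w J - w' J\<bar>) * dev_bound" by (simp add: prob_space)
  finally show ?thesis .
qed

lemma space_data_alg: "space (data_alg m n) = space (prb m)"
  and space_copy_alg: "space (copy_alg m) = space (prb m)"
  unfolding data_alg_def copy_alg_def generated_algebra_def by (simp_all add: space_measure_of_conv)

lemma data_alg_subalgebra: "subalgebra (prb m) (data_alg m n)"
proof -
  have "indep_set (sets (pair_alg m 0)) (sets (data_alg m n))"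
    using observation unfolding observation_model_def by blast
  from indep_setD_ev2[OF this] show ?thesis unfolding subalgebra_def by (simp add: space_data_alg)
qed

lemma AE_err_cond: "AE \<omega> in prb m. real_cond_exp (prb m) (joint_alg m n) (\<lambda>\<omega>. indicator {..0} (q_err m 0 \<omega>)) \<omega> = qlev m"
proof -
  have "AE \<omega> in prb m. real_cond_exp (prb m) (joint_alg m n) (\<lambda>\<omega>. indicator {..0} (q_err m 0 \<omega>)) \<omega> = err_cdf m 0 (curve m 0 \<omega>)"
    using observation unfolding observation_model_def by blast
  moreover have "AE \<omega> in prb m. quantile (qlev m) (resp_law m (curve m 0 \<omega>)) = cond_quant m (curve m 0 \<omega>) \<and> err_cdf m 0 (curve m 0 \<omega>) = qlev m"
    using quantile unfolding quantile_model_def by blast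
  ultimately show ?thesis by eventually_elim simp
qed

text \<open>
  Given the joint algebra, the error is nonpositive with conditional probability \<open>qlev m > 0\<close>.
  A positive value of \<open>real_cond_exp\<close> entails both claims.
\<close>

lemma joint_alg_subalgebra: "subalgebra (prb m) (joint_alg m n)"
  and err_indicator_measurable: "(\<lambda>\<omega>. indicator {..0} (q_err m 0 \<omega>) :: real) \<in> borel_measurable (prb m)"
proof -
  have "AE \<omega> in prb m. subalgebra (prb m) (joint_alg m n) \<and> (\<lambda>\<omega>. indicator {..0} (q_err m 0 \<omega>) :: real) \<in> borel_measurable (prb m)"
    using AE_err_cond[of n]
  proof (rule AE_mp, intro AE_I2 impI)
    fix \<omega> assume "real_cond_exp (prb m) (joint_alg m n) (\<lambda>\<omega>. indicator {..0} (q_err m 0 \<omega>)) \<omega> = qlev m"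
    then have "0 < real_cond_exp (prb m) (joint_alg m n) (\<lambda>\<omega>. indicator {..0} (q_err m 0 \<omega>)) \<omega>" using qlev by simp
    from real_cond_exp_indicator_pos[OF this]
    show "subalgebra (prb m) (joint_alg m n) \<and> (\<lambda>\<omega>. indicator {..0} (q_err m 0 \<omega>) :: real) \<in> borel_measurable (prb m)" by blast
  qed
  then show "subalgebra (prb m) (joint_alg m n)"
    "(\<lambda>\<omega>. indicator {..0} (q_err m 0 \<omega>) :: real) \<in> borel_measurable (prb m)" by simp_all
qed

lemma curve_joint_alg: "curve m 0 \<in> joint_alg m n \<rightarrow>\<^sub>M paths_of m"
proof (rule measurableI)
  fix A assume A: "A \<in> sets (paths_of m)"
  have sub: "sets (data_alg m n) \<union> sets (copy_alg m) \<union> sets (curve_alg m 0) \<subseteq> Pow (space (prb m))"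
    using sets.sets_into_space[of _ "data_alg m n"] sets.sets_into_space[of _ "copy_alg m"] sets.sets_into_space[of _ "curve_alg m 0"]
    unfolding space_data_alg space_copy_alg by (auto simp: curve_alg_def)
  have "curve m 0 -` A \<inter> space (prb m) \<in> sets (curve_alg m 0)"
    unfolding curve_alg_def using A by (rule in_vimage_algebra)
  then show "curve m 0 -` A \<inter> space (joint_alg m n) \<in> sets (joint_alg m n)"
    unfolding joint_alg_def using sub by (simp add: space_measure_of_conv sets_measure_of sigma_sets.Basic)
qed simp

text \<open>
  The conditional quantile minimises the expected check loss: the subgradient of the loss at the
  error of subject 0 has conditional mean zero given the curve, because the error is nonpositive
  with conditional probability \<open>qlev m\<close>, and the deviation of the limit quantile is a function of
  the curve.
\<close>

lemma EFPE_lim_nonneg: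
  assumes n: "1 \<le> n" and w: "w \<in> weights n"
  shows "0 \<le> risk_lim n w"
proof -
  interpret F: finite_measure_subalgebra "prb m" "joint_alg m n"
    using joint_alg_subalgebra by unfold_locales
  define t where "t \<omega> = avg_dev n w (curve m 0 \<omega>)" for \<omega>
  define k where "k \<omega> = (indicator {..0} (q_err m 0 \<omega>) :: real)" for \<omega>
  have tF: "t \<in> borel_measurable (joint_alg m n)"
    unfolding t_def[abs_def] by (rule measurable_compose[OF curve_joint_alg avg_dev_measurable[OF n]])
  have tM[measurable]: "t \<in> borel_measurable (prb m)" by (rule measurable_from_subalg[OF joint_alg_subalgebra tF])
  have kM[measurable]: "k \<in> borel_measurable (prb m)" unfolding k_def[abs_def] by (rule err_indicator_measurable)
  have tb: "\<bar>t \<omega>\<bar> \<le> dev_bound" for \<omega> using avg_dev_bound[of n w "curve m 0 \<omega>"] weight_sum(3)[OF w] unfolding t_def by simp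
  have kb: "\<bar>k \<omega>\<bar> \<le> 1" for \<omega> unfolding k_def by (simp split: split_indicator)
  have ti: "integrable (prb m) t" using tb by (intro integrable_const_bound[where B=dev_bound]) auto
  have tki: "integrable (prb m) (\<lambda>\<omega>. t \<omega> * k \<omega>)"
    using mult_mono[OF tb kb] dev_bound(1) by (intro integrable_const_bound[where B="dev_bound"]) (auto simp: abs_mult)
  have "(\<integral>\<omega>. t \<omega> * k \<omega> \<partial>prb m) = (\<integral>\<omega>. t \<omega> * real_cond_exp (prb m) (joint_alg m n) k \<omega> \<partial>prb m)"
    by (rule F.real_cond_exp_intg(2)[OF tki tF kM, symmetric])
  also have "\<dots> = (\<integral>\<omega>. t \<omega> * qlev m \<partial>prb m)"
  proof (rule integral_cong_AE)
    show "AE \<omega> in prb m. t \<omega> * real_cond_exp (prb m) (joint_alg m n) k \<omega> = t \<omega> * qlev m"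
      using AE_err_cond[of n] unfolding k_def[abs_def] by eventually_elim simp
  qed measurable
  finally have "(\<integral>\<omega>. - (t \<omega> * (qlev m - k \<omega>)) \<partial>prb m) = 0"
    using ti tki by (simp add: right_diff_distrib)
  moreover have "(\<integral>\<omega>. - (t \<omega> * (qlev m - k \<omega>)) \<partial>prb m) \<le> (\<integral>\<omega>. excess_loss n w (obs_pair 0 \<omega>) \<partial>prb m)"
  proof (rule integral_mono_AE[OF _ excess_loss_pair_integrable[OF n]])
    show "integrable (prb m) (\<lambda>\<omega>. - (t \<omega> * (qlev m - k \<omega>)))" using ti tki by (simp add: right_diff_distrib)
    show "AE \<omega> in prb m. - (t \<omega> * (qlev m - k \<omega>)) \<le> excess_loss n w (obs_pair 0 \<omega>)"
      using AE_quant_lim[OF n]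
    proof eventually_elim
      case (elim \<omega>)
      then have e: "resp m 0 \<omega> - cond_quant' (curve m 0 \<omega>) = q_err m 0 \<omega>" by simp
      show ?case
        using check_loss_subgradient[of "qlev m" "q_err m 0 \<omega>" "t \<omega>"]
        unfolding excess_loss_def obs_pair_def fst_conv snd_conv e t_def[symmetric] k_def by linarith
    qed
  qed
  ultimately show ?thesis using limit_loss_integrable(2)[OF n w] by simp
qed

lemma likely_empirical_risk:
  assumes n: "folds p \<le> n" and e: "0 < e"
  shows "likely (prb m) e (\<lambda>\<omega>. \<forall>w\<in>weights n.
    1 / real n * \<bar>\<Sum>i=1..folds p * grp_size p n. excess_loss n w (obs_pair i \<omega>) - risk_lim n w\<bar>
      \<le> (4 / e + 2) * dev_bound * model_rate n)"
proof -
  have n1: "1 \<le> n" using n folds by simp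
  let ?N = "folds p * grp_size p n"
  have N: "1 \<le> ?N" "?N \<le> n" using n folds unfolding grp_size_def by (auto simp: div_greater_zero_iff Suc_le_eq)
  have "likely (prb m) e (\<lambda>\<omega>. \<forall>w\<in>weights n. \<bar>\<Sum>i\<in>{1..?N}. excess_loss n w (obs_pair i \<omega>) - (\<integral>v. excess_loss n w v \<partial>pair_law)\<bar>
    \<le> (4 / e + 2) * dev_bound * sqrt (real (card (cand p n)) * real (card {1..?N})))"
  proof (rule likely_uniform_deviation[where S="pair_space" and d="\<lambda>J v. quant_dev n J (snd v)"])
    show "indep_vars (\<lambda>_. pair_space) obs_pair {1..?N}" by (rule indep_vars_subset[OF indep_pairs]) simp
    show "{1..?N} \<noteq> {}" using N(1) by (simp only: atLeastatMost_empty_iff not_le) simp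
    show "(\<lambda>v. quant_dev n J (snd v)) \<in> borel_measurable pair_space" if "J \<in> cand p n" for J
      by (rule measurable_compose[OF measurable_snd quant_dev_measurable[OF n1 that]])
    show "\<bar>excess_loss n w v - excess_loss n w' v\<bar> \<le> \<bar>(\<Sum>J\<in>cand p n. w J * quant_dev n J (snd v)) - (\<Sum>J\<in>cand p n. w' J * quant_dev n J (snd v))\<bar>" for w w' v
      using excess_loss_lipschitz[of n w v w'] unfolding avg_dev_def .
  qed (use distr_obs_pair cand[OF n1] quant_dev_bound excess_loss_measurable[OF n1] excess_loss_zero dev_bound(1) e in simp_all)
  then show ?thesis
  proof (rule likely_mono[OF _ order_refl], intro ballI)
    fix \<omega> w assume w: "w \<in> weights n"
      and a: "\<forall>w\<in>weights n. \<bar>\<Sum>i\<in>{1..?N}. excess_loss n w (obs_pair i \<omega>) - (\<integral>v. excess_loss n w v \<partial>pair_law)\<bar>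
        \<le> (4 / e + 2) * dev_bound * sqrt (real (card (cand p n)) * real (card {1..?N}))"
    have "sqrt (real (card (cand p n)) * real (card {1..?N})) \<le> sqrt (real (card (cand p n)) * real n)"
      using of_nat_mono[OF N(2), where 'a=real] by (intro real_sqrt_le_mono mult_left_mono) simp_all
    then have "sqrt (real (card (cand p n)) * real (card {1..?N})) \<le> sqrt (real (card (cand p n))) * sqrt (real n)"
      by (simp only: real_sqrt_mult)
    moreover have "0 \<le> (4 / e + 2) * dev_bound" using e dev_bound(1) by simp
    ultimately have "(4 / e + 2) * dev_bound * sqrt (real (card (cand p n)) * real (card {1..?N})) \<le> (4 / e + 2) * dev_bound * (sqrt (real (card (cand p n))) * sqrt (real n))"
      by (rule mult_left_mono)
    then have "\<bar>\<Sum>i=1..?N. excess_loss n w (obs_pair i \<omega>) - risk_lim n w\<bar> \<le> (4 / e + 2) * dev_bound * (sqrt (real (card (cand p n))) * sqrt (real n))"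
      using order_trans[OF bspec[OF a w]] unfolding limit_loss_integrable(2)[OF n1 w] pair_law_excess_loss[OF n1] by blast
    then have "1 / real n * \<bar>\<Sum>i=1..?N. excess_loss n w (obs_pair i \<omega>) - risk_lim n w\<bar>
      \<le> 1 / real n * ((4 / e + 2) * dev_bound * (sqrt (real (card (cand p n))) * sqrt (real n)))"
      by (intro mult_left_mono) simp_all
    also have "\<dots> = (4 / e + 2) * dev_bound * (sqrt (real (card (cand p n))) * (sqrt (real n) / real n))" by simp
    also have "sqrt (real n) / real n = 1 / sqrt (real n)" using n1 by (simp add: field_simps)
    finally show "1 / real n * \<bar>\<Sum>i=1..?N. excess_loss n w (obs_pair i \<omega>) - risk_lim n w\<bar>
      \<le> (4 / e + 2) * dev_bound * model_rate n" by simp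
  qed
qed

section \<open>Errors of the estimated quantiles\<close>

abbreviation dom_measure :: "real measure" where
  "dom_measure \<equiv> restrict_space lborel (dom_of m)"

abbreviation path_domain :: "('w \<times> real) measure" where
  "path_domain \<equiv> prb m \<Otimes>\<^sub>M dom_measure"

abbreviation dom_length :: real where
  "dom_length \<equiv> measure dom_measure (space dom_measure)"

lemma space_dom_measure: "space dom_measure = dom_of m"
  by (simp add: space_restrict_space dom_of_def)

lemma finite_dom_measure: "finite_measure dom_measure"
proof
  have "emeasure dom_measure (space dom_measure) = emeasure lborel {lo m..hi m}"
    unfolding space_dom_measure by (subst emeasure_restrict_space) (simp_all add: dom_of_def)
  also have "\<dots> \<noteq> \<infinity>" using emeasure_lborel_cbox_finite[of "lo m" "hi m"] by (simp add: less_top[symmetric])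
  finally show "emeasure dom_measure (space dom_measure) \<noteq> \<infinity>" .
qed

lemma sets_dom_measure: "sets dom_measure = sets (restrict_space borel (dom_of m))"
  by (rule sets_restrict_space_cong) simp

lemma set_integrable_dom: "set_integrable lborel (dom_of m) f \<longleftrightarrow> integrable dom_measure f" for f :: "real \<Rightarrow> real"
  unfolding set_integrable_def by (subst integrable_restrict_space) (simp_all add: dom_of_def)

lemma set_integral_dom: "(LINT t:dom_of m|lborel. f t) = (\<integral>t. f t \<partial>dom_measure)" for f :: "real \<Rightarrow> real"
  unfolding set_lebesgue_integral_def by (subst integral_restrict_space) (simp_all add: dom_of_def)

lemma set_borel_measurable_dom: "set_borel_measurable lborel (dom_of m) f \<Longrightarrow> f \<in> borel_measurable dom_measure" for f :: "real \<Rightarrow> real"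
  unfolding set_borel_measurable_def by (subst borel_measurable_restrict_space_iff) (simp_all add: dom_of_def)

sublocale dom: finite_measure dom_measure by (rule finite_dom_measure)

sublocale prod: pair_sigma_finite "prb m" dom_measure ..

lemma random_function_measurable:
  assumes "random_function F (dom_of m) Z"
  shows "(\<lambda>(\<omega>, t). Z \<omega> t) \<in> borel_measurable (F \<Otimes>\<^sub>M dom_measure)"
  using assms measurable_cong_sets[OF sets_pair_measure_cong[OF refl sets_dom_measure] refl]
  unfolding random_function_def by blast

lemma random_function_at:
  assumes "random_function F (dom_of m) Z" "t \<in> dom_of m"
  shows "(\<lambda>\<omega>. Z \<omega> t) \<in> borel_measurable F"
  using measurable_compose[OF measurable_Pair2'[of t dom_measure F] random_function_measurable[OF assms(1)]] assms(2)
  by (simp add: space_dom_measure)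

lemma random_function_subalgebra:
  assumes F: "subalgebra (prb m) F" and Z: "random_function F (dom_of m) Z"
  shows "(\<lambda>(\<omega>, t). Z \<omega> t) \<in> borel_measurable path_domain"
proof -
  have "(\<lambda>x. x) \<in> prb m \<rightarrow>\<^sub>M F" by (rule measurable_from_subalg[OF F measurable_ident_sets[OF refl]])
  then have "(\<lambda>z. (fst z, snd z)) \<in> path_domain \<rightarrow>\<^sub>M F \<Otimes>\<^sub>M dom_measure"
    by (intro measurable_Pair measurable_snd measurable_compose[OF measurable_fst])
  from measurable_compose[OF this random_function_measurable[OF Z]] show ?thesis
    by (simp add: case_prod_beta')
qed

lemma section_measurable:
  assumes "(\<lambda>(\<omega>, t). Z \<omega> t) \<in> borel_measurable path_domain" "\<omega> \<in> space (prb m)"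
  shows "Z \<omega> \<in> borel_measurable dom_measure"
  using measurable_compose[OF measurable_Pair1'[OF assms(2), of dom_measure] assms(1)]
  by simp

lemma estimates_measurable:
  assumes n: "1 \<le> n"
  shows "random_function (data_alg m n) (dom_of m) (\<lambda>\<omega>. mean_est (fit p n 0 \<omega>))"
    and "1 \<le> j \<Longrightarrow> random_function (data_alg m n) (dom_of m) (\<lambda>\<omega>. eig_fun_est (fit p n 0 \<omega>) j)"
    and "J \<in> cand p n \<Longrightarrow> (\<lambda>\<omega>. fst (coef p n 0 J \<omega>)) \<in> borel_measurable (data_alg m n)"
    and "J \<in> cand p n \<Longrightarrow> j \<in> {1..J} \<Longrightarrow> (\<lambda>\<omega>. snd (coef p n 0 J \<omega>) j) \<in> borel_measurable (data_alg m n)"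
    and "i \<le> n \<Longrightarrow> 1 \<le> j \<Longrightarrow> score_est m p n 0 i j \<in> borel_measurable (prb m)"
  using estimation n le0[of "folds p"] unfolding estimation_def by blast+

lemma slope_est_random_function:
  assumes n: "1 \<le> n" and J: "J \<in> cand p n"
  shows "random_function (data_alg m n) (dom_of m) (slope_est p n 0 J)"
  unfolding random_function_def slope_est_def case_prod_beta'
proof (intro borel_measurable_sum borel_measurable_times)
  fix j assume j: "j \<in> {1..J}"
  show "(\<lambda>z. snd (coef p n 0 J (fst z)) j) \<in> borel_measurable (data_alg m n \<Otimes>\<^sub>M restrict_space borel (dom_of m))"
    by (rule measurable_compose[OF measurable_fst estimates_measurable(4)[OF n J j]])
  show "(\<lambda>z. eig_fun_est (fit p n 0 (fst z)) j (snd z)) \<in> borel_measurable (data_alg m n \<Otimes>\<^sub>M restrict_space borel (dom_of m))"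
    using estimates_measurable(2)[OF n, of j] j unfolding random_function_def case_prod_beta' by simp
qed

lemma mean_est_joint:
  assumes n: "1 \<le> n"
  shows "(\<lambda>(\<omega>, t). mean_est (fit p n 0 \<omega>) t) \<in> borel_measurable path_domain"
  by (rule random_function_subalgebra[OF data_alg_subalgebra estimates_measurable(1)[OF n]])

lemma slope_est_joint:
  assumes n: "1 \<le> n" and J: "J \<in> cand p n"
  shows "(\<lambda>(\<omega>, t). slope_est p n 0 J \<omega> t) \<in> borel_measurable path_domain"
  by (rule random_function_subalgebra[OF data_alg_subalgebra slope_est_random_function[OF n J]])

lemma curve_est_joint:
  assumes n: "1 \<le> n" and i: "i \<le> n"
  shows "(\<lambda>(\<omega>, t). curve_est m p n i J \<omega> t) \<in> borel_measurable path_domain"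
  unfolding curve_est_def case_prod_beta'
proof (intro borel_measurable_add borel_measurable_sum borel_measurable_times)
  show "(\<lambda>z. mean_est (fit p n 0 (fst z)) (snd z)) \<in> borel_measurable path_domain"
    using mean_est_joint[OF n] unfolding case_prod_beta' .
  fix j assume j: "j \<in> {1..J}"
  show "(\<lambda>z. score_est m p n 0 i j (fst z)) \<in> borel_measurable path_domain"
    using j by (intro measurable_compose[OF measurable_fst estimates_measurable(5)[OF n i]]) simp
  show "(\<lambda>z. eig_fun_est (fit p n 0 (fst z)) j (snd z)) \<in> borel_measurable path_domain"
    using random_function_subalgebra[OF data_alg_subalgebra estimates_measurable(2)[OF n, of j]] j
    unfolding case_prod_beta' by simp
qed

lemma curve_lim_joint:
  assumes n: "1 \<le> n" and i: "i \<le> n" and J: "J \<in> cand p n"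
  shows "(\<lambda>(\<omega>, t). curve_lim q n i J \<omega> t) \<in> borel_measurable path_domain"
proof -
  have "random_function (prb m) (dom_of m) (curve_lim q n i J)"
    using limits n i J unfolding limit_objects_def by blast
  then show ?thesis by (rule random_function_measurable)
qed

lemma estimates_joint:
  assumes n: "1 \<le> n" and J: "J \<in> cand p n" and i: "i \<le> n"
  shows "(\<lambda>z. slope_est p n 0 J (fst z) (snd z)) \<in> borel_measurable path_domain"
    and "(\<lambda>z. mean_est (fit p n 0 (fst z)) (snd z)) \<in> borel_measurable path_domain"
    and "(\<lambda>z. curve_est m p n i J (fst z) (snd z)) \<in> borel_measurable path_domain"
  using slope_est_joint[OF n J] mean_est_joint[OF n] curve_est_joint[OF n i]
  unfolding case_prod_beta' by auto

lemma slope_lim_measurable: "1 \<le> n \<Longrightarrow> J \<in> cand p n \<Longrightarrow> slope_lim q n J \<in> borel_measurable dom_measure"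
  using limits unfolding limit_objects_def by (blast intro: set_borel_measurable_dom)

lemma mean_fun_measurable: "mean_fun m \<in> borel_measurable dom_measure"
  using mean_L2 unfolding L2_on_def by (blast intro: set_borel_measurable_dom)

lemma AE_limit_curve:
  assumes n: "1 \<le> n" and i: "i \<le> n" and J: "J \<in> cand p n"
  shows "AE \<omega> in prb m. integrable dom_measure (\<lambda>t. curve_lim q n i J \<omega> t - mean_fun m t) \<and>
    integrable dom_measure (\<lambda>t. slope_lim q n J t * (curve_lim q n i J \<omega> t - mean_fun m t)) \<and>
    quant_lim q n J (curve m i \<omega>) = icept_lim q n J +
      (\<integral>t. slope_lim q n J t * (curve_lim q n i J \<omega> t - mean_fun m t) \<partial>dom_measure)"
proof -
  have "AE \<omega> in prb m. set_integrable lborel (dom_of m) (\<lambda>t. curve_lim q n i J \<omega> t - mean_fun m t)"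
    using bounded n i J unfolding bounded_limits_def by blast
  moreover have "AE \<omega> in prb m. set_integrable lborel (dom_of m)
        (\<lambda>t. slope_lim q n J t * (curve_lim q n i J \<omega> t - mean_fun m t)) \<and>
      quant_lim q n J (curve m i \<omega>) = icept_lim q n J +
        (LINT t:dom_of m|lborel. slope_lim q n J t * (curve_lim q n i J \<omega> t - mean_fun m t))"
    using limits n i J unfolding limit_objects_def by blast
  ultimately show ?thesis
    by eventually_elim (simp add: set_integrable_dom set_integral_dom)
qed

lemma quant_est_eq: "quant_est m p n 0 i J \<omega> = fst (coef p n 0 J \<omega>) +
   (\<integral>t. slope_est p n 0 J \<omega> t * (curve_est m p n i J \<omega> t - mean_est (fit p n 0 \<omega>) t) \<partial>dom_measure)"
  unfolding quant_est_def set_integral_dom ..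

abbreviation quant_error :: "nat \<Rightarrow> nat \<Rightarrow> nat \<Rightarrow> 'w \<Rightarrow> real" where
  "quant_error n i J \<omega> \<equiv> \<bar>quant_est m p n 0 i J \<omega> - quant_lim q n J (curve m i \<omega>)\<bar>"

abbreviation curve_size :: "nat \<Rightarrow> nat \<Rightarrow> nat \<Rightarrow> 'w \<Rightarrow> real" where
  "curve_size n i J \<omega> \<equiv> \<integral>t. \<bar>curve_lim q n i J \<omega> t - mean_fun m t\<bar> \<partial>dom_measure"

text \<open>
  This bounds the error of an estimated quantile when all estimates are accurate up to \<open>\<delta>\<close>,
  the limit slope has \<open>L\<^sub>1\<close> norm at most \<open>C2\<close>, and the centred limit curve at most \<open>C1\<close>.
\<close>

definition error_factor :: "real \<Rightarrow> real \<Rightarrow> real \<Rightarrow> real" where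
  "error_factor \<delta> C2 C1 = \<delta> * (1 + 2 * (C2 + \<delta> * dom_length) + C1)"

lemma AE_sample_error:
  assumes n: "1 \<le> n" and \<delta>: "0 \<le> \<delta>"
  shows "AE \<omega> in prb m. \<forall>i\<in>{1..n}. \<forall>J\<in>cand p n.
    \<bar>fst (coef p n 0 J \<omega>) - icept_lim q n J\<bar> \<le> \<delta> \<longrightarrow>
    (\<forall>t\<in>dom_of m. \<bar>slope_est p n 0 J \<omega> t - slope_lim q n J t\<bar> \<le> \<delta>) \<longrightarrow>
    (\<forall>t\<in>dom_of m. \<bar>mean_est (fit p n 0 \<omega>) t - mean_fun m t\<bar> \<le> \<delta>) \<longrightarrow>
    (\<forall>t\<in>dom_of m. \<bar>curve_est m p n i J \<omega> t - curve_lim q n i J \<omega> t\<bar> \<le> \<delta>) \<longrightarrow>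
    integrable dom_measure (slope_lim q n J) \<longrightarrow> (\<integral>t. \<bar>slope_lim q n J t\<bar> \<partial>dom_measure) \<le> C2 \<longrightarrow>
    quant_error n i J \<omega>
      \<le> error_factor \<delta> C2 (curve_size n i J \<omega>)"
    (is "AE \<omega> in _. \<forall>i\<in>_. \<forall>J\<in>_. ?P \<omega> i J")
proof (intro AE_finite_allI cand n)
  fix i J assume "i \<in> {1..n}" and J: "J \<in> cand p n"
  then have i: "i \<le> n" by simp
  show "AE \<omega> in prb m. ?P \<omega> i J"
    using AE_limit_curve[OF n i J] AE_space
  proof eventually_elim
    case (elim \<omega>)
    note lim = elim(1) and \<omega> = elim(2)
    show ?case
    proof (intro impI)
      assume a: "\<bar>fst (coef p n 0 J \<omega>) - icept_lim q n J\<bar> \<le> \<delta>"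
        and b: "\<forall>t\<in>dom_of m. \<bar>slope_est p n 0 J \<omega> t - slope_lim q n J t\<bar> \<le> \<delta>"
        and \<mu>: "\<forall>t\<in>dom_of m. \<bar>mean_est (fit p n 0 \<omega>) t - mean_fun m t\<bar> \<le> \<delta>"
        and x: "\<forall>t\<in>dom_of m. \<bar>curve_est m p n i J \<omega> t - curve_lim q n i J \<omega> t\<bar> \<le> \<delta>"
        and s: "integrable dom_measure (slope_lim q n J)" "(\<integral>t. \<bar>slope_lim q n J t\<bar> \<partial>dom_measure) \<le> C2"
      have xd: "\<bar>(curve_est m p n i J \<omega> t - mean_est (fit p n 0 \<omega>) t) - (curve_lim q n i J \<omega> t - mean_fun m t)\<bar> \<le> 2 * \<delta>"
        if "t \<in> dom_of m" for t using bspec[OF \<mu> that] bspec[OF x that] by linarith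
      have "\<bar>(\<integral>t. slope_est p n 0 J \<omega> t * (curve_est m p n i J \<omega> t - mean_est (fit p n 0 \<omega>) t) \<partial>dom_measure) -
         (\<integral>t. slope_lim q n J t * (curve_lim q n i J \<omega> t - mean_fun m t) \<partial>dom_measure)\<bar>
        \<le> ((\<integral>t. \<bar>slope_lim q n J t\<bar> \<partial>dom_measure) + \<delta> * dom_length) * (2 * \<delta>) +
          \<delta> * (curve_size n i J \<omega>)"
        using lim s b xd \<delta> section_measurable[OF slope_est_joint[OF n J] \<omega>]
          section_measurable[OF mean_est_joint[OF n] \<omega>] section_measurable[OF curve_est_joint[OF n i, of J] \<omega>]
        by (intro integral_product_perturbation[OF finite_dom_measure]) (simp_all add: space_dom_measure)
      also have "\<dots> \<le> (C2 + \<delta> * dom_length) * (2 * \<delta>) +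
          \<delta> * (curve_size n i J \<omega>)"
        using s(2) \<delta> by (intro add_right_mono mult_right_mono) simp_all
      finally show "quant_error n i J \<omega>
        \<le> error_factor \<delta> C2 (curve_size n i J \<omega>)"
        using a lim unfolding quant_est_eq error_factor_def by (simp add: algebra_simps)
    qed
  qed
qed simp

text \<open>
  For subject 0 only the conditional mean of the error of the predicted curve is small, and this
  for one \<open>t\<close> at a time, with a null set depending on \<open>t\<close>. Integrating over \<open>E\<close> first, which
  Tonelli's theorem permits, makes it possible to use the bound for each \<open>t\<close> separately. The
  \<open>L\<^sub>1\<close> norm of the limit curve is random and is bounded by going back to the other order of
  integration.
\<close>

lemma copy_error_on:
  assumes n: "1 \<le> n" and J: "J \<in> cand p n" and E: "E \<in> sets (data_alg m n)" and \<delta>: "0 \<le> \<delta>"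
    and a: "AE \<omega> in prb m. \<omega> \<in> E \<longrightarrow> \<bar>fst (coef p n 0 J \<omega>) - icept_lim q n J\<bar> \<le> \<delta>"
    and b: "\<And>t. t \<in> dom_of m \<Longrightarrow> AE \<omega> in prb m. \<omega> \<in> E \<longrightarrow> \<bar>slope_est p n 0 J \<omega> t - slope_lim q n J t\<bar> \<le> \<delta>"
    and \<mu>: "\<And>t. t \<in> dom_of m \<Longrightarrow> AE \<omega> in prb m. \<omega> \<in> E \<longrightarrow> \<bar>mean_est (fit p n 0 \<omega>) t - mean_fun m t\<bar> \<le> \<delta>"
    and x: "\<And>t. t \<in> dom_of m \<Longrightarrow> AE \<omega> in prb m. \<omega> \<in> E \<longrightarrow>
      cond_exp n (\<lambda>\<omega>. \<bar>curve_est m p n 0 J \<omega> t - curve_lim q n 0 J \<omega> t\<bar>) \<omega> \<le> \<delta>"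
    and x0: "AE \<omega> in prb m. \<omega> \<in> E \<longrightarrow> cond_exp n
      (\<lambda>\<omega>. curve_size n 0 J \<omega>) \<omega> \<le> C1"
    and s: "integrable dom_measure (slope_lim q n J)" "(\<integral>t. \<bar>slope_lim q n J t\<bar> \<partial>dom_measure) \<le> C2"
    and C1: "0 \<le> C1"
  shows "(\<integral>\<^sup>+\<omega>. ennreal (indicator E \<omega> * quant_error n 0 J \<omega>) \<partial>prb m)
    \<le> ennreal (error_factor \<delta> C2 C1 * prob E)"
proof -
  let ?b = "slope_est p n 0 J" and ?blim = "slope_lim q n J"
  let ?x = "\<lambda>\<omega> t. curve_est m p n 0 J \<omega> t - mean_est (fit p n 0 \<omega>) t"
  let ?xlim = "\<lambda>\<omega> t. curve_lim q n 0 J \<omega> t - mean_fun m t"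
  let ?X = "\<lambda>\<omega> t. \<bar>curve_est m p n 0 J \<omega> t - curve_lim q n 0 J \<omega> t\<bar>"
  let ?L = "\<lambda>\<omega>. \<integral>t. \<bar>?xlim \<omega> t\<bar> \<partial>dom_measure"
  let ?r = "\<lambda>\<omega> t. indicator E \<omega> * \<bar>?b \<omega> t * ?x \<omega> t - ?blim t * ?xlim \<omega> t\<bar>"
  let ?s = "\<lambda>\<omega> t. indicator E \<omega> * (\<delta> * \<bar>?xlim \<omega> t\<bar>)"
  let ?v = "\<lambda>\<omega> t. indicator E \<omega> * ((\<bar>?blim t\<bar> + \<delta>) * (?X \<omega> t + \<delta>))"
  have EM[measurable]: "E \<in> events" using E data_alg_subalgebra[of n] unfolding subalgebra_def by blast
  note [measurable] = mean_fun_measurable slope_lim_measurable[OF n J]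
  note [measurable] = estimates_joint[OF n J le0]
  have m4[measurable]: "(\<lambda>z. curve_lim q n 0 J (fst z) (snd z)) \<in> borel_measurable path_domain"
    using curve_lim_joint[OF n le0 J] unfolding case_prod_beta' .
  have at: "(\<lambda>\<omega>. curve_lim q n 0 J \<omega> t) \<in> borel_measurable (prb m)" if "t \<in> dom_of m" for t
    using measurable_compose[OF measurable_Pair2'[of t dom_measure "prb m"] m4] that by (simp add: space_dom_measure)
  have ct: "(\<lambda>\<omega>. curve_est m p n 0 J \<omega> t) \<in> borel_measurable (prb m)" if "t \<in> dom_of m" for t
    using measurable_compose[OF measurable_Pair2'[of t dom_measure "prb m"] estimates_joint(3)[OF n J le0]] that by (simp add: space_dom_measure)
  have Xi: "integrable (prb m) (\<lambda>\<omega>. ?X \<omega> t)" if "t \<in> dom_of m" for t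
    using cond1 n J that unfolding condition1_def by blast
  have Li: "integrable (prb m) ?L"
    using bounded n J unfolding bounded_limits_def set_integral_dom by blast
  have fm[measurable]: "(\<lambda>\<omega>. fst (coef p n 0 J \<omega>)) \<in> borel_measurable (prb m)"
    by (rule measurable_from_subalg[OF data_alg_subalgebra estimates_measurable(3)[OF n J]])
  have sect: "?b \<omega> \<in> borel_measurable dom_measure" "?x \<omega> \<in> borel_measurable dom_measure" if "\<omega> \<in> space (prb m)" for \<omega>
    using section_measurable[OF slope_est_joint[OF n J] that]
      section_measurable[OF mean_est_joint[OF n] that] section_measurable[OF curve_est_joint[OF n le0, of J] that] by simp_all
  have "AE \<omega> in prb m. ennreal (indicator E \<omega> * quant_error n 0 J \<omega>)
      \<le> ennreal (indicator E \<omega> * \<delta>) + (\<integral>\<^sup>+t. ennreal (?r \<omega> t) \<partial>dom_measure)"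
    using AE_limit_curve[OF n le0 J] a AE_space
  proof eventually_elim
    case (elim \<omega>)
    note lim = elim(1) and a' = elim(2) and \<omega> = elim(3)
    show ?case
    proof (cases "\<omega> \<in> E")
      case True
      let ?d = "(\<integral>t. ?b \<omega> t * ?x \<omega> t \<partial>dom_measure) - (\<integral>t. ?blim t * ?xlim \<omega> t \<partial>dom_measure)"
      have "quant_error n 0 J \<omega> \<le> \<delta> + \<bar>?d\<bar>"
        using a' True lim unfolding quant_est_eq by linarith
      then have "ennreal (quant_error n 0 J \<omega>) \<le> ennreal \<delta> + ennreal \<bar>?d\<bar>"
        using \<delta> by (intro ennreal_le_plusI) simp_all
      also have "ennreal \<bar>?d\<bar> \<le> (\<integral>\<^sup>+t. ennreal \<bar>?b \<omega> t * ?x \<omega> t - ?blim t * ?xlim \<omega> t\<bar> \<partial>dom_measure)"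
        using sect[OF \<omega>] lim by (intro abs_integral_diff_le_nn_integral borel_measurable_times) simp_all
      finally show ?thesis using True by (simp add: add_left_mono)
    qed simp
  qed
  then have "(\<integral>\<^sup>+\<omega>. ennreal (indicator E \<omega> * quant_error n 0 J \<omega>) \<partial>prb m)
    \<le> (\<integral>\<^sup>+\<omega>. ennreal (indicator E \<omega> * \<delta>) + (\<integral>\<^sup>+t. ennreal (?r \<omega> t) \<partial>dom_measure) \<partial>prb m)"
    by (rule nn_integral_mono_AE)
  also have "\<dots> = (\<integral>\<^sup>+\<omega>. ennreal (indicator E \<omega> * \<delta>) \<partial>prb m) +
     (\<integral>\<^sup>+\<omega>. \<integral>\<^sup>+t. ennreal (?r \<omega> t) \<partial>dom_measure \<partial>prb m)"
    by (rule nn_integral_add) measurable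
  also have "(\<integral>\<^sup>+\<omega>. ennreal (indicator E \<omega> * \<delta>) \<partial>prb m) = ennreal (\<delta> * prob E)"
    using \<delta> by (subst nn_integral_eq_integral) (auto intro!: integrable_real_mult_indicator simp: less_top[symmetric])
  also have "(\<integral>\<^sup>+\<omega>. \<integral>\<^sup>+t. ennreal (?r \<omega> t) \<partial>dom_measure \<partial>prb m) =
     (\<integral>\<^sup>+t. \<integral>\<^sup>+\<omega>. ennreal (?r \<omega> t) \<partial>prb m \<partial>dom_measure)"
    by (rule prod.Fubini'[symmetric]) measurable
  also have "\<dots> \<le> (\<integral>\<^sup>+t. ennreal ((\<bar>?blim t\<bar> + \<delta>) * (2 * \<delta> * prob E)) + (\<integral>\<^sup>+\<omega>. ennreal (?s \<omega> t) \<partial>prb m) \<partial>dom_measure)"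
  proof (rule nn_integral_mono)
    fix t assume "t \<in> space dom_measure"
    then have t: "t \<in> dom_of m" by (simp add: space_dom_measure)
    note [measurable] = at[OF t] ct[OF t]
    have "AE \<omega> in prb m. ennreal (?r \<omega> t) \<le>
      ennreal (?v \<omega> t) + ennreal (?s \<omega> t)"
      using b[OF t] \<mu>[OF t]
    proof eventually_elim
      case (elim \<omega>)
      note b' = elim(1) and \<mu>' = elim(2)
      show ?case
      proof (cases "\<omega> \<in> E")
        case True
        have "\<bar>?x \<omega> t - ?xlim \<omega> t\<bar> \<le> ?X \<omega> t + \<delta>" using \<mu>' True by linarith
        then have "(\<bar>?blim t\<bar> + \<delta>) * \<bar>?x \<omega> t - ?xlim \<omega> t\<bar> \<le> (\<bar>?blim t\<bar> + \<delta>) * (?X \<omega> t + \<delta>)"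
          using \<delta> by (intro mult_left_mono) simp_all
        then have "\<bar>?b \<omega> t * ?x \<omega> t - ?blim t * ?xlim \<omega> t\<bar> \<le> (\<bar>?blim t\<bar> + \<delta>) * (?X \<omega> t + \<delta>) + \<delta> * \<bar>?xlim \<omega> t\<bar>"
          using product_perturbation[of "?b \<omega> t" "?blim t" \<delta> "?x \<omega> t" "?xlim \<omega> t"] b' True by linarith
        then show ?thesis using \<delta> True by (intro ennreal_le_plusI) simp_all
      qed simp
    qed
    then have "(\<integral>\<^sup>+\<omega>. ennreal (?r \<omega> t) \<partial>prb m) \<le>
      (\<integral>\<^sup>+\<omega>. ennreal (?v \<omega> t) + ennreal (?s \<omega> t) \<partial>prb m)"
      by (rule nn_integral_mono_AE)
    also have "\<dots> = (\<integral>\<^sup>+\<omega>. ennreal (?v \<omega> t) \<partial>prb m) +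
      (\<integral>\<^sup>+\<omega>. ennreal (?s \<omega> t) \<partial>prb m)"
      by (rule nn_integral_add) measurable
    also have "(\<integral>\<^sup>+\<omega>. ennreal (?v \<omega> t) \<partial>prb m) \<le> ennreal ((\<bar>?blim t\<bar> + \<delta>) * (2 * \<delta> * prob E))"
    proof -
      have i1: "integrable (prb m) (\<lambda>\<omega>. indicator E \<omega> * ?X \<omega> t)" "integrable (prb m) (\<lambda>\<omega>. indicator E \<omega> * \<delta>)"
        using integrable_mult_indicator[OF EM Xi[OF t]] integrable_mult_indicator[OF EM, of "\<lambda>_. \<delta>"] by simp_all
      have eq: "?v \<omega> t = (\<bar>?blim t\<bar> + \<delta>) * (indicator E \<omega> * ?X \<omega> t + indicator E \<omega> * \<delta>)" for \<omega>
        by (simp add: algebra_simps)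
      have i2: "integrable (prb m) (\<lambda>\<omega>. ?v \<omega> t)"
        unfolding eq using i1 by (intro integrable_mult_right Bochner_Integration.integrable_add)
      have "(\<integral>\<^sup>+\<omega>. ennreal (?v \<omega> t) \<partial>prb m) =
         ennreal (\<integral>\<omega>. ?v \<omega> t \<partial>prb m)"
        using \<delta> by (intro nn_integral_eq_integral[OF i2] AE_I2) simp
      also have "(\<integral>\<omega>. ?v \<omega> t \<partial>prb m) =
         (\<bar>?blim t\<bar> + \<delta>) * ((\<integral>\<omega>. indicator E \<omega> * ?X \<omega> t \<partial>prb m) + \<delta> * prob E)"
        unfolding eq using i1 by simp
      also have "\<dots> \<le> (\<bar>?blim t\<bar> + \<delta>) * (2 * \<delta> * prob E)"
        using set_integral_cond_exp_le[OF prob_space_axioms data_alg_subalgebra Xi[OF t] E x[OF t]] \<delta>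
        by (intro mult_left_mono) simp_all
      finally show ?thesis by (simp add: ennreal_leI)
    qed
    finally show "(\<integral>\<^sup>+\<omega>. ennreal (?r \<omega> t) \<partial>prb m) \<le>
      ennreal ((\<bar>?blim t\<bar> + \<delta>) * (2 * \<delta> * prob E)) + (\<integral>\<^sup>+\<omega>. ennreal (?s \<omega> t) \<partial>prb m)"
      by (simp add: add_right_mono)
  qed
  also have "\<dots> = (\<integral>\<^sup>+t. ennreal ((\<bar>?blim t\<bar> + \<delta>) * (2 * \<delta> * prob E)) \<partial>dom_measure) +
      (\<integral>\<^sup>+t. \<integral>\<^sup>+\<omega>. ennreal (?s \<omega> t) \<partial>prb m \<partial>dom_measure)"
  proof (rule nn_integral_add)
    have "(\<lambda>z. ennreal (indicator E (fst z) * (\<delta> * \<bar>?xlim (fst z) (snd z)\<bar>))) \<in> borel_measurable path_domain"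
      by measurable
    from measurable_pair_swap[OF this]
    have "(\<lambda>(t, \<omega>). ennreal (?s \<omega> t)) \<in> borel_measurable (dom_measure \<Otimes>\<^sub>M prb m)"
      by simp
    then show "(\<lambda>t. \<integral>\<^sup>+\<omega>. ennreal (?s \<omega> t) \<partial>prb m) \<in> borel_measurable dom_measure"
      by (rule borel_measurable_nn_integral)
  qed measurable
  also have "(\<integral>\<^sup>+t. ennreal ((\<bar>?blim t\<bar> + \<delta>) * (2 * \<delta> * prob E)) \<partial>dom_measure) \<le> ennreal ((C2 + \<delta> * dom_length) * (2 * \<delta> * prob E))"
  proof -
    have "(\<integral>\<^sup>+t. ennreal ((\<bar>?blim t\<bar> + \<delta>) * (2 * \<delta> * prob E)) \<partial>dom_measure) =
       ennreal (\<integral>t. (\<bar>?blim t\<bar> + \<delta>) * (2 * \<delta> * prob E) \<partial>dom_measure)"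
      using s(1) \<delta> by (intro nn_integral_eq_integral AE_I2) simp_all
    also have "(\<integral>t. (\<bar>?blim t\<bar> + \<delta>) * (2 * \<delta> * prob E) \<partial>dom_measure) = ((\<integral>t. \<bar>?blim t\<bar> \<partial>dom_measure) + \<delta> * dom_length) * (2 * \<delta> * prob E)"
      using s(1) by (simp add: mult.commute)
    also have "\<dots> \<le> (C2 + \<delta> * dom_length) * (2 * \<delta> * prob E)"
      using s(2) \<delta> by (intro mult_right_mono) simp_all
    finally show ?thesis by (simp add: ennreal_leI)
  qed
  also have "(\<integral>\<^sup>+t. \<integral>\<^sup>+\<omega>. ennreal (?s \<omega> t) \<partial>prb m \<partial>dom_measure) =
    (\<integral>\<^sup>+\<omega>. \<integral>\<^sup>+t. ennreal (?s \<omega> t) \<partial>dom_measure \<partial>prb m)"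
    by (rule prod.Fubini') measurable
  also have "\<dots> = (\<integral>\<^sup>+\<omega>. ennreal (\<delta> * (indicator E \<omega> * ?L \<omega>)) \<partial>prb m)"
  proof (rule nn_integral_cong_AE)
    show "AE \<omega> in prb m. (\<integral>\<^sup>+t. ennreal (?s \<omega> t) \<partial>dom_measure) = ennreal (\<delta> * (indicator E \<omega> * ?L \<omega>))"
      using AE_limit_curve[OF n le0 J]
    proof eventually_elim
      case (elim \<omega>)
      then have "integrable dom_measure (\<lambda>t. indicator E \<omega> * (\<delta> * \<bar>?xlim \<omega> t\<bar>))" by simp
      then have "(\<integral>\<^sup>+t. ennreal (?s \<omega> t) \<partial>dom_measure) = ennreal (\<integral>t. indicator E \<omega> * (\<delta> * \<bar>?xlim \<omega> t\<bar>) \<partial>dom_measure)"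
        using \<delta> by (intro nn_integral_eq_integral AE_I2) simp_all
      then show ?case
        by (simp add: mult.left_commute)
    qed
  qed
  also have "\<dots> = ennreal (\<delta> * (\<integral>\<omega>. indicator E \<omega> * ?L \<omega> \<partial>prb m))"
  proof -
    have i: "integrable (prb m) (\<lambda>\<omega>. indicator E \<omega> * ?L \<omega>)" using integrable_mult_indicator[OF EM Li] by simp
    have "0 \<le> ?L \<omega>" for \<omega> by (rule integral_nonneg_AE) simp
    then show ?thesis using i \<delta> by (subst nn_integral_eq_integral) simp_all
  qed
  also have "\<dots> \<le> ennreal (\<delta> * (C1 * prob E))"
    using set_integral_cond_exp_le[OF prob_space_axioms data_alg_subalgebra Li E x0] \<delta>
    by (intro ennreal_leI mult_left_mono)
  finally have "(\<integral>\<^sup>+\<omega>. ennreal (indicator E \<omega> * quant_error n 0 J \<omega>) \<partial>prb m)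
    \<le> ennreal (\<delta> * prob E) + (ennreal ((C2 + \<delta> * dom_length) * (2 * \<delta> * prob E)) + ennreal (\<delta> * (C1 * prob E)))"
    by (simp add: add_left_mono add_mono)
  also have "\<dots> = ennreal (error_factor \<delta> C2 C1 * prob E)"
  proof -
    have "0 \<le> (\<integral>t. \<bar>?blim t\<bar> \<partial>dom_measure)" by (rule integral_nonneg_AE) simp
    then have "0 \<le> C2" using s(2) by linarith
    then have "0 \<le> (C2 + \<delta> * dom_length) * (2 * \<delta> * prob E)" using \<delta> by simp
    then show ?thesis
      using \<delta> C1 unfolding error_factor_def by (simp add: ennreal_plus[symmetric] del: ennreal_plus) (simp add: algebra_simps)
  qed
  finally show ?thesis .
qed

section \<open>The prediction error is close to the limiting risk\<close>

lemma indep_copy_data: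
  assumes h[measurable]: "h \<in> borel_measurable pair_space" and hi: "integrable (prb m) (\<lambda>\<omega>. h (obs_pair 0 \<omega>))"
    and E: "E \<in> sets (data_alg m n)"
  shows "(\<integral>\<omega>. indicator E \<omega> * h (obs_pair 0 \<omega>) \<partial>prb m) = prob E * (\<integral>\<omega>. h (obs_pair 0 \<omega>) \<partial>prb m)"
proof -
  have EM: "E \<in> events" using E data_alg_subalgebra[of n] unfolding subalgebra_def by blast
  have sp: "space (pair_alg m 0) = space (prb m)" unfolding pair_alg_def by simp
  have "obs_pair 0 \<in> pair_alg m 0 \<rightarrow>\<^sub>M pair_space"
    unfolding pair_alg_def obs_pair_def[abs_def] by (rule measurable_vimage_algebra1) (simp add: space_pair_measure)
  from measurable_compose[OF this h] have hp: "(\<lambda>\<omega>. h (obs_pair 0 \<omega>)) \<in> borel_measurable (pair_alg m 0)" .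
  have "{(\<lambda>\<omega>. h (obs_pair 0 \<omega>)) -` A \<inter> space (prb m) |A. A \<in> sets borel} \<subseteq> sets (pair_alg m 0)"
    using measurable_sets[OF hp] unfolding sp by blast
  from sets.sigma_sets_subset[OF this]
  have 1: "sigma_sets (space (prb m)) {(\<lambda>\<omega>. h (obs_pair 0 \<omega>)) -` A \<inter> space (prb m) |A. A \<in> sets borel} \<subseteq> sets (pair_alg m 0)"
    unfolding sp .
  have iF: "(indicator E :: 'w \<Rightarrow> real) \<in> borel_measurable (data_alg m n)" using E by (rule borel_measurable_indicator)
  have "{(indicator E :: 'w \<Rightarrow> real) -` A \<inter> space (prb m) |A. A \<in> sets borel} \<subseteq> sets (data_alg m n)"
    using measurable_sets[OF iF] unfolding space_data_alg by blast
  from sets.sigma_sets_subset[OF this]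
  have 2: "sigma_sets (space (prb m)) {(indicator E :: 'w \<Rightarrow> real) -` A \<inter> space (prb m) |A. A \<in> sets borel} \<subseteq> sets (data_alg m n)"
    unfolding space_data_alg .
  have "indep_set (sets (pair_alg m 0)) (sets (data_alg m n))"
    using observation unfolding observation_model_def by blast
  then have "indep_set (sigma_sets (space (prb m)) {(\<lambda>\<omega>. h (obs_pair 0 \<omega>)) -` A \<inter> space (prb m) |A. A \<in> sets borel})
      (sigma_sets (space (prb m)) {(indicator E :: 'w \<Rightarrow> real) -` A \<inter> space (prb m) |A. A \<in> sets borel})"
    unfolding indep_set_def by (rule indep_sets_mono_sets) (use 1 2 in \<open>simp split: bool.split\<close>)
  then have "indep_var borel (\<lambda>\<omega>. h (obs_pair 0 \<omega>)) borel (indicator E :: 'w \<Rightarrow> real)"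
    unfolding indep_var_eq using EM by simp
  then have "(\<integral>\<omega>. h (obs_pair 0 \<omega>) * indicator E \<omega> \<partial>prb m) = (\<integral>\<omega>. h (obs_pair 0 \<omega>) \<partial>prb m) * (\<integral>\<omega>. indicator E \<omega> \<partial>prb m)"
    using hi EM by (intro indep_var_lebesgue_integral integrable_real_indicator) (simp_all add: less_top[symmetric])
  then show ?thesis using EM by (simp add: mult.commute)
qed

lemma quant_est_measurable:
  assumes n: "1 \<le> n" and J: "J \<in> cand p n" and i: "i \<le> n"
  shows "quant_est m p n 0 i J \<in> borel_measurable (prb m)"
proof -
  note [measurable] = estimates_joint[OF n J i]
  have [measurable]: "(\<lambda>\<omega>. fst (coef p n 0 J \<omega>)) \<in> borel_measurable (prb m)"
    by (rule measurable_from_subalg[OF data_alg_subalgebra estimates_measurable(3)[OF n J]])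
  show ?thesis unfolding quant_est_eq[abs_def] by measurable
qed

lemma loss_avg_diff_le:
  assumes "w \<in> weight_set C"
  shows "\<bar>loss (y - (\<Sum>J\<in>C. w J * u J)) - loss (y - (\<Sum>J\<in>C. w J * v J))\<bar> \<le> (\<Sum>J\<in>C. w J * \<bar>u J - v J\<bar>)"
proof -
  have "\<bar>loss (y - (\<Sum>J\<in>C. w J * u J)) - loss (y - (\<Sum>J\<in>C. w J * v J))\<bar> \<le> \<bar>\<Sum>J\<in>C. w J * (u J - v J)\<bar>"
    using check_loss_lipschitz[OF qlev, of "y - (\<Sum>J\<in>C. w J * u J)" "y - (\<Sum>J\<in>C. w J * v J)"]
    by (simp add: right_diff_distrib sum_subtractf)
  also have "\<dots> \<le> (\<Sum>J\<in>C. w J * \<bar>u J - v J\<bar>)"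
    using weight_sum(2)[OF assms] by (intro order_trans[OF sum_abs] sum_mono) (simp add: abs_mult)
  finally show ?thesis .
qed

lemma weighted_sum_le:
  assumes "w \<in> weight_set C" "\<And>J. J \<in> C \<Longrightarrow> u J \<le> K"
  shows "(\<Sum>J\<in>C. w J * u J) \<le> K"
proof -
  have "(\<Sum>J\<in>C. w J * u J) \<le> (\<Sum>J\<in>C. w J * K)"
    using weight_sum(2)[OF assms(1)] assms(2) by (intro sum_mono mult_left_mono)
  then show ?thesis using weight_sum(1)[OF assms(1)] by (simp flip: sum_distrib_right)
qed

lemma weighted_nonneg: "w \<in> weight_set C \<Longrightarrow> 0 \<le> (\<Sum>J\<in>C. w J * \<bar>u J\<bar>)"
  using weight_sum(2)[of w C] by (simp add: sum_nonneg)

text \<open>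
  Over an event \<open>E\<close> of the data, the limit loss of the independent copy has integral \<open>prob E\<close>
  times its mean, and the loss of the estimated quantile differs from it by at most the error of
  the estimated quantile, because the check loss is Lipschitz.
\<close>

lemma FPE_close_on:
  assumes n: "1 \<le> n" and w: "w \<in> weights n" and B: "B \<in> sets (data_alg m n)" and K: "0 \<le> K"
    and err: "\<And>E J. E \<in> sets (data_alg m n) \<Longrightarrow> E \<subseteq> B \<Longrightarrow> J \<in> cand p n \<Longrightarrow>
      (\<integral>\<^sup>+\<omega>. ennreal (indicator E \<omega> * quant_error n 0 J \<omega>) \<partial>prb m) \<le> ennreal (K * prob E)"
  shows "AE \<omega> in prb m. \<omega> \<in> B \<longrightarrow> \<bar>EFPE m FPE n w \<omega> - risk_lim n w\<bar> \<le> K"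
proof -
  interpret F: finite_measure_subalgebra "prb m" "data_alg m n"
    using data_alg_subalgebra by unfold_locales
  let ?Y = "\<lambda>\<omega>. loss (resp m 0 \<omega> - avg_quant_est m p n 0 0 w \<omega>)"
  let ?h = "\<lambda>v. loss (fst v - avg_quant_lim p q n w (snd v))"
  let ?G = "\<lambda>\<omega>. ?h (obs_pair 0 \<omega>)"
  have Gi: "integrable (prb m) ?G"
    using limit_loss_integrable(1)[OF n w] unfolding obs_pair_def by simp
  have EG: "(\<integral>\<omega>. ?G \<omega> \<partial>prb m) = risk_lim n w + base_risk m"
    unfolding EFPE_lim_def obs_pair_def by simp
  note [measurable] = quant_lim_measurable[OF n]
  have hm: "?h \<in> borel_measurable pair_space"
    unfolding avg_quant_lim_def by measurable
  have Yi: "integrable (prb m) ?Y"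
    and Yc: "AE \<omega> in prb m. FPE n w \<omega> = cond_exp n ?Y \<omega>"
    using FPE n w unfolding FPE_version_def by blast+
  let ?c = "risk_lim n w + base_risk m"
  let ?Z = "\<lambda>\<omega>. cond_exp n ?Y \<omega> - ?c"
  have Zi: "integrable (prb m) ?Z" using F.real_cond_exp_int(1)[OF Yi] by simp
  have ZF: "?Z \<in> borel_measurable (data_alg m n)" by simp
  have main: "\<bar>LINT \<omega>:E|prb m. ?Z \<omega>\<bar> \<le> K * prob E" if E: "E \<in> sets (data_alg m n)" "E \<subseteq> B" for E
  proof -
    have EM[measurable]: "E \<in> events" using E(1) data_alg_subalgebra[of n] unfolding subalgebra_def by blast
    have iY: "integrable (prb m) (\<lambda>\<omega>. indicator E \<omega> * ?Y \<omega>)" "integrable (prb m) (\<lambda>\<omega>. indicator E \<omega> * ?G \<omega>)"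
      "integrable (prb m) (\<lambda>\<omega>. indicator E \<omega> * ?c)"
      "integrable (prb m) (\<lambda>\<omega>. indicator E \<omega> * cond_exp n ?Y \<omega>)"
      using integrable_mult_indicator[OF EM Yi] integrable_mult_indicator[OF EM Gi] integrable_mult_indicator[OF EM, of "\<lambda>_. ?c"]
        integrable_mult_indicator[OF EM F.real_cond_exp_int(1)[OF Yi]] by simp_all
    have "(LINT \<omega>:E|prb m. ?Z \<omega>) = (\<integral>\<omega>. indicator E \<omega> * cond_exp n ?Y \<omega> - indicator E \<omega> * ?c \<partial>prb m)"
      unfolding set_lebesgue_integral_def by (simp only: real_scaleR_def right_diff_distrib)
    also have "\<dots> = (\<integral>\<omega>. indicator E \<omega> * cond_exp n ?Y \<omega> \<partial>prb m) - (\<integral>\<omega>. indicator E \<omega> * ?c \<partial>prb m)"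
      using iY by (intro Bochner_Integration.integral_diff)
    also have "(\<integral>\<omega>. indicator E \<omega> * cond_exp n ?Y \<omega> \<partial>prb m) = (\<integral>\<omega>. indicator E \<omega> * ?Y \<omega> \<partial>prb m)"
      using F.real_cond_exp_intA[OF Yi E(1)] unfolding set_lebesgue_integral_def real_scaleR_def by (rule sym)
    also have "(\<integral>\<omega>. indicator E \<omega> * ?c \<partial>prb m) = (\<integral>\<omega>. indicator E \<omega> * ?G \<omega> \<partial>prb m)"
      using indep_copy_data[OF hm Gi E(1)] EG EM by simp
    also have "(\<integral>\<omega>. indicator E \<omega> * ?Y \<omega> \<partial>prb m) - (\<integral>\<omega>. indicator E \<omega> * ?G \<omega> \<partial>prb m) = (\<integral>\<omega>. indicator E \<omega> * (?Y \<omega> - ?G \<omega>) \<partial>prb m)"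
      using iY by (simp add: right_diff_distrib)
    finally have eq: "(LINT \<omega>:E|prb m. ?Z \<omega>) = (\<integral>\<omega>. indicator E \<omega> * (?Y \<omega> - ?G \<omega>) \<partial>prb m)" .
    have i: "integrable (prb m) (\<lambda>\<omega>. indicator E \<omega> * (?Y \<omega> - ?G \<omega>))" using iY by (simp add: right_diff_distrib)
    have qm[measurable]: "quant_est m p n 0 0 J \<in> borel_measurable (prb m)" if "J \<in> cand p n" for J
      by (rule quant_est_measurable[OF n that le0])
    have "ennreal \<bar>\<integral>\<omega>. indicator E \<omega> * (?Y \<omega> - ?G \<omega>) \<partial>prb m\<bar> \<le> (\<integral>\<^sup>+\<omega>. ennreal \<bar>indicator E \<omega> * (?Y \<omega> - ?G \<omega>)\<bar> \<partial>prb m)"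
      using integral_norm_bound_ennreal[OF i] by simp
    also have "\<dots> \<le> (\<integral>\<^sup>+\<omega>. (\<Sum>J\<in>cand p n. ennreal (w J) * ennreal (indicator E \<omega> * quant_error n 0 J \<omega>)) \<partial>prb m)"
    proof (rule nn_integral_mono)
      fix \<omega>
      have "\<bar>?Y \<omega> - ?G \<omega>\<bar> \<le> (\<Sum>J\<in>cand p n. w J * quant_error n 0 J \<omega>)"
        unfolding avg_quant_est_def avg_quant_lim_def obs_pair_def fst_conv snd_conv by (rule loss_avg_diff_le[OF w])
      then have "\<bar>indicator E \<omega> * (?Y \<omega> - ?G \<omega>)\<bar> \<le> (\<Sum>J\<in>cand p n. w J * (indicator E \<omega> * quant_error n 0 J \<omega>))"
        by (simp split: split_indicator)
      then have "ennreal \<bar>indicator E \<omega> * (?Y \<omega> - ?G \<omega>)\<bar> \<le> ennreal (\<Sum>J\<in>cand p n. w J * (indicator E \<omega> * quant_error n 0 J \<omega>))"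
        by (rule ennreal_leI)
      also have "\<dots> = (\<Sum>J\<in>cand p n. ennreal (w J * (indicator E \<omega> * quant_error n 0 J \<omega>)))"
        using weight_sum(2)[OF w] by (intro sum_ennreal[symmetric] mult_nonneg_nonneg) simp_all
      also have "\<dots> = (\<Sum>J\<in>cand p n. ennreal (w J) * ennreal (indicator E \<omega> * quant_error n 0 J \<omega>))"
        using weight_sum(2)[OF w] by (intro sum.cong refl ennreal_mult) simp_all
      finally show "ennreal \<bar>indicator E \<omega> * (?Y \<omega> - ?G \<omega>)\<bar> \<le> (\<Sum>J\<in>cand p n. ennreal (w J) * ennreal (indicator E \<omega> * quant_error n 0 J \<omega>))" .
    qed
    also have "\<dots> = (\<Sum>J\<in>cand p n. ennreal (w J) * (\<integral>\<^sup>+\<omega>. ennreal (indicator E \<omega> * quant_error n 0 J \<omega>) \<partial>prb m))"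
      by (subst nn_integral_sum; (intro sum.cong refl nn_integral_cmult)?; measurable)
    also have "\<dots> \<le> (\<Sum>J\<in>cand p n. ennreal (w J) * ennreal (K * prob E))"
      using err[OF E] by (intro sum_mono mult_left_mono) simp_all
    also have "\<dots> = ennreal (\<Sum>J\<in>cand p n. w J * (K * prob E))"
      using weight_sum(2)[OF w] K by (subst sum_ennreal[symmetric]) (simp_all add: ennreal_mult)
    also have "(\<Sum>J\<in>cand p n. w J * (K * prob E)) = K * prob E"
      using weight_sum(1)[OF w] by (simp flip: sum_distrib_right)
    finally show ?thesis using K unfolding eq by (subst (asm) ennreal_le_iff) simp_all
  qed
  have "AE \<omega> in prb m. \<omega> \<in> B \<longrightarrow> ?Z \<omega> \<le> K"
    using main by (intro AE_le_on_of_integral_le[OF prob_space_axioms data_alg_subalgebra ZF Zi B]) (simp add: abs_le_iff)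
  moreover have "AE \<omega> in prb m. \<omega> \<in> B \<longrightarrow> - ?Z \<omega> \<le> K"
  proof (rule AE_le_on_of_integral_le[OF prob_space_axioms data_alg_subalgebra _ _ B])
    fix E assume E: "E \<in> sets (data_alg m n)" "E \<subseteq> B"
    have "(LINT \<omega>:E|prb m. - ?Z \<omega>) = - (LINT \<omega>:E|prb m. ?Z \<omega>)"
      unfolding set_lebesgue_integral_def real_scaleR_def mult_minus_right by (rule integral_minus)
    then show "(LINT \<omega>:E|prb m. - ?Z \<omega>) \<le> K * prob E" using main[OF E] by linarith
  next
    show "integrable (prb m) (\<lambda>\<omega>. - ?Z \<omega>)" using Zi by (rule integrable_minus)
    show "(\<lambda>\<omega>. - ?Z \<omega>) \<in> borel_measurable (data_alg m n)" using ZF by (rule borel_measurable_uminus)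
  qed
  ultimately show ?thesis using Yc
  proof eventually_elim
    fix \<omega> assume "\<omega> \<in> B \<longrightarrow> ?Z \<omega> \<le> K" "\<omega> \<in> B \<longrightarrow> - ?Z \<omega> \<le> K" "FPE n w \<omega> = cond_exp n ?Y \<omega>"
    then show "\<omega> \<in> B \<longrightarrow> \<bar>EFPE m FPE n w \<omega> - risk_lim n w\<bar> \<le> K" unfolding EFPE_def by linarith
  qed
qed

lemma EFPE_lim_tendsto:
  assumes n: "1 \<le> n" and x: "\<And>k. x k \<in> weights n" and w: "w \<in> weights n" and lim: "x \<longlonglongrightarrow> w"
  shows "(\<lambda>k. risk_lim n (x k)) \<longlonglongrightarrow> risk_lim n w"
proof -
  have c: "(\<lambda>k. x k J) \<longlonglongrightarrow> w J" for J
    by (rule continuous_on_tendsto_compose[OF continuous_on_product_coordinates lim]) simp_all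
  have "(\<lambda>k. (\<Sum>J\<in>cand p n. \<bar>x k J - w J\<bar>) * dev_bound) \<longlonglongrightarrow> (\<Sum>J\<in>cand p n. \<bar>w J - w J\<bar>) * dev_bound"
    by (intro tendsto_intros c)
  then have z: "(\<lambda>k. (\<Sum>J\<in>cand p n. \<bar>x k J - w J\<bar>) * dev_bound) \<longlonglongrightarrow> 0" by simp
  have le: "norm (risk_lim n (x k) - risk_lim n w) \<le> (\<Sum>J\<in>cand p n. \<bar>x k J - w J\<bar>) * dev_bound" for k
    using EFPE_lim_diff_le[OF n x w, of k] by simp
  have "(\<lambda>k. risk_lim n (x k) - risk_lim n w) \<longlonglongrightarrow> 0"
    by (rule Lim_null_comparison[OF always_eventually[OF allI[OF le]] z])
  then show ?thesis by (simp add: LIM_zero_iff)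
qed

text \<open>
  The exceptional null set of \<open>FPE_close_on\<close> depends on \<open>w\<close>. A countable dense set of weights and
  the continuity of both functions in \<open>w\<close> make it common to all weights.
\<close>

lemma AE_EFPE_close:
  assumes n: "1 \<le> n" and \<delta>: "0 \<le> \<delta>" and C1: "0 \<le> C1" and C2: "0 \<le> C2" and A: "A \<in> events"
    and s: "\<And>J. J \<in> cand p n \<Longrightarrow> integrable dom_measure (slope_lim q n J)"
      "\<And>J. J \<in> cand p n \<Longrightarrow> (\<integral>t. \<bar>slope_lim q n J t\<bar> \<partial>dom_measure) \<le> C2"
    and a: "\<And>\<omega> J. \<omega> \<in> A \<Longrightarrow> J \<in> cand p n \<Longrightarrow> \<bar>fst (coef p n 0 J \<omega>) - icept_lim q n J\<bar> \<le> \<delta>"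
    and b: "\<And>\<omega> J t. \<omega> \<in> A \<Longrightarrow> J \<in> cand p n \<Longrightarrow> t \<in> dom_of m \<Longrightarrow> \<bar>slope_est p n 0 J \<omega> t - slope_lim q n J t\<bar> \<le> \<delta>"
    and \<mu>: "\<And>\<omega> t. \<omega> \<in> A \<Longrightarrow> t \<in> dom_of m \<Longrightarrow> \<bar>mean_est (fit p n 0 \<omega>) t - mean_fun m t\<bar> \<le> \<delta>"
    and d: "\<And>\<omega> J t. \<omega> \<in> A \<Longrightarrow> J \<in> cand p n \<Longrightarrow> t \<in> dom_of m \<Longrightarrow> \<bar>D n J t \<omega>\<bar> \<le> \<delta>"
    and x0: "\<And>\<omega> J. \<omega> \<in> A \<Longrightarrow> J \<in> cand p n \<Longrightarrow> \<bar>cond_exp n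
      (\<lambda>\<omega>. LINT t:dom_of m|lborel. \<bar>curve_lim q n 0 J \<omega> t - mean_fun m t\<bar>) \<omega>\<bar> \<le> C1"
  shows "AE \<omega> in prb m. \<omega> \<in> A \<longrightarrow> (\<forall>w\<in>weights n.
    \<bar>EFPE m FPE n w \<omega> - risk_lim n w\<bar> \<le> error_factor \<delta> C2 C1)"
proof -
  let ?F = "data_alg m n" and ?K = "error_factor \<delta> C2 C1"
  have K: "0 \<le> ?K" unfolding error_factor_def using \<delta> C1 C2 by simp
  obtain B where B: "B \<in> sets ?F" and AB: "AE \<omega> in prb m. \<omega> \<in> A \<longrightarrow> \<omega> \<in> B"
    and hull: "\<And>C. C \<in> sets ?F \<Longrightarrow> (AE \<omega> in prb m. \<omega> \<in> A \<longrightarrow> \<omega> \<in> C) \<Longrightarrow> AE \<omega> in prb m. \<omega> \<in> B \<longrightarrow> \<omega> \<in> C"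
    by (rule measurable_hull[OF prob_space_axioms data_alg_subalgebra A, of n]) blast
  have hull_le: "AE \<omega> in prb m. \<omega> \<in> B \<longrightarrow> f \<omega> \<le> K'"
    if f[measurable]: "f \<in> borel_measurable ?F" and le: "AE \<omega> in prb m. \<omega> \<in> A \<longrightarrow> f \<omega> \<le> K'" for f :: "'w \<Rightarrow> real" and K'
  proof -
    have "{\<omega>\<in>space ?F. f \<omega> \<le> K'} \<in> sets ?F" by measurable
    moreover have "AE \<omega> in prb m. \<omega> \<in> A \<longrightarrow> \<omega> \<in> {\<omega>\<in>space ?F. f \<omega> \<le> K'}"
      using le AE_space unfolding space_data_alg by eventually_elim blast
    ultimately have "AE \<omega> in prb m. \<omega> \<in> B \<longrightarrow> \<omega> \<in> {\<omega>\<in>space ?F. f \<omega> \<le> K'}" by (rule hull)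
    then show ?thesis by eventually_elim blast
  qed
  have mono: "AE \<omega> in prb m. \<omega> \<in> E \<longrightarrow> f \<omega> \<le> K'" if "AE \<omega> in prb m. \<omega> \<in> B \<longrightarrow> f \<omega> \<le> K'" "E \<subseteq> B"
    for E and f :: "'w \<Rightarrow> real" and K'
    using that(1) by eventually_elim (use that(2) in blast)
  have err: "(\<integral>\<^sup>+\<omega>. ennreal (indicator E \<omega> * quant_error n 0 J \<omega>) \<partial>prb m) \<le> ennreal (?K * prob E)"
    if E: "E \<in> sets ?F" "E \<subseteq> B" and J: "J \<in> cand p n" for E J
  proof (rule copy_error_on[OF n J E(1) \<delta> _ _ _ _ _ s[OF J] C1])
    show "AE \<omega> in prb m. \<omega> \<in> E \<longrightarrow> \<bar>fst (coef p n 0 J \<omega>) - icept_lim q n J\<bar> \<le> \<delta>"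
      using estimates_measurable(3)[OF n J] a[OF _ J]
      by (intro mono[OF hull_le E(2)] borel_measurable_abs borel_measurable_diff) simp_all
    show "AE \<omega> in prb m. \<omega> \<in> E \<longrightarrow> \<bar>slope_est p n 0 J \<omega> t - slope_lim q n J t\<bar> \<le> \<delta>" if t: "t \<in> dom_of m" for t
      using random_function_at[OF slope_est_random_function[OF n J] t] b[OF _ J t]
      by (intro mono[OF hull_le E(2)] borel_measurable_abs borel_measurable_diff) simp_all
    show "AE \<omega> in prb m. \<omega> \<in> E \<longrightarrow> \<bar>mean_est (fit p n 0 \<omega>) t - mean_fun m t\<bar> \<le> \<delta>" if t: "t \<in> dom_of m" for t
      using random_function_at[OF estimates_measurable(1)[OF n] t] \<mu>[OF _ t]
      by (intro mono[OF hull_le E(2)] borel_measurable_abs borel_measurable_diff) simp_all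
    show "AE \<omega> in prb m. \<omega> \<in> E \<longrightarrow> real_cond_exp (prb m) ?F (\<lambda>\<omega>. \<bar>curve_est m p n 0 J \<omega> t - curve_lim q n 0 J \<omega> t\<bar>) \<omega> \<le> \<delta>"
      if t: "t \<in> dom_of m" for t
    proof (rule mono[OF hull_le E(2)])
      have "AE \<omega> in prb m. D n J t \<omega> = real_cond_exp (prb m) ?F (\<lambda>\<omega>. \<bar>curve_est m p n 0 J \<omega> t - curve_lim q n 0 J \<omega> t\<bar>) \<omega>"
        using cond1 n J t unfolding condition1_def by blast
      then show "AE \<omega> in prb m. \<omega> \<in> A \<longrightarrow> real_cond_exp (prb m) ?F (\<lambda>\<omega>. \<bar>curve_est m p n 0 J \<omega> t - curve_lim q n 0 J \<omega> t\<bar>) \<omega> \<le> \<delta>"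
      proof eventually_elim
        fix \<omega> assume "D n J t \<omega> = real_cond_exp (prb m) ?F (\<lambda>\<omega>. \<bar>curve_est m p n 0 J \<omega> t - curve_lim q n 0 J \<omega> t\<bar>) \<omega>"
        then show "\<omega> \<in> A \<longrightarrow> real_cond_exp (prb m) ?F (\<lambda>\<omega>. \<bar>curve_est m p n 0 J \<omega> t - curve_lim q n 0 J \<omega> t\<bar>) \<omega> \<le> \<delta>"
          using d[OF _ J t, of \<omega>] by linarith
      qed
    qed simp
    show "AE \<omega> in prb m. \<omega> \<in> E \<longrightarrow> real_cond_exp (prb m) ?F (\<lambda>\<omega>. curve_size n 0 J \<omega>) \<omega> \<le> C1"
    proof (rule mono[OF hull_le E(2)])
      show "AE \<omega> in prb m. \<omega> \<in> A \<longrightarrow> real_cond_exp (prb m) ?F (\<lambda>\<omega>. curve_size n 0 J \<omega>) \<omega> \<le> C1"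
        using x0[OF _ J] unfolding set_integral_dom abs_le_iff by (intro AE_I2) blast
    qed simp
  qed
  obtain T where T: "countable T" "T \<subseteq> weights n" "weights n \<subseteq> closure T"
    using separable[of "weights n"] by blast
  have "AE \<omega> in prb m. \<forall>w\<in>T. \<omega> \<in> B \<longrightarrow> \<bar>EFPE m FPE n w \<omega> - risk_lim n w\<bar> \<le> ?K"
    using T(1)
  proof (rule AE_ball_countable'[rotated])
    fix w assume "w \<in> T"
    then show "AE \<omega> in prb m. \<omega> \<in> B \<longrightarrow> \<bar>EFPE m FPE n w \<omega> - risk_lim n w\<bar> \<le> ?K"
      using T(2) by (intro FPE_close_on[OF n _ B K err]) blast+
  qed
  moreover have "AE \<omega> in prb m. continuous_on (weights n) (\<lambda>w. FPE n w \<omega>)"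
    using FPE n unfolding FPE_version_def by blast
  ultimately show ?thesis using AB
  proof eventually_elim
    fix \<omega> assume close: "\<forall>w\<in>T. \<omega> \<in> B \<longrightarrow> \<bar>EFPE m FPE n w \<omega> - risk_lim n w\<bar> \<le> ?K"
      and cont: "continuous_on (weights n) (\<lambda>w. FPE n w \<omega>)" and AB: "\<omega> \<in> A \<longrightarrow> \<omega> \<in> B"
    show "\<omega> \<in> A \<longrightarrow> (\<forall>w\<in>weights n. \<bar>EFPE m FPE n w \<omega> - risk_lim n w\<bar> \<le> ?K)"
    proof (intro impI ballI)
      fix w assume "\<omega> \<in> A" and w: "w \<in> weights n"
      \<comment> \<open>Approximate \<open>w\<close> by the countably many weights already treated.\<close>
      then obtain x where x: "\<And>k. x k \<in> T" "x \<longlonglongrightarrow> w"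
        using T(3) unfolding closure_sequential[symmetric] by (metis closure_sequential subsetD)
      then have xW: "x k \<in> weights n" for k using T(2) by blast
      have "(\<lambda>k. FPE n (x k) \<omega>) \<longlonglongrightarrow> FPE n w \<omega>"
        using xW by (intro continuous_on_tendsto_compose[OF cont x(2) w]) simp
      then have "(\<lambda>k. \<bar>FPE n (x k) \<omega> - base_risk m - risk_lim n (x k)\<bar>) \<longlonglongrightarrow> \<bar>FPE n w \<omega> - base_risk m - risk_lim n w\<bar>"
        by (intro tendsto_intros EFPE_lim_tendsto[OF n xW w x(2)])
      then have "(\<lambda>k. \<bar>EFPE m FPE n (x k) \<omega> - risk_lim n (x k)\<bar>) \<longlonglongrightarrow> \<bar>EFPE m FPE n w \<omega> - risk_lim n w\<bar>"
        unfolding EFPE_def .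
      then show "\<bar>EFPE m FPE n w \<omega> - risk_lim n w\<bar> \<le> ?K"
        using close x(1) AB \<open>\<omega> \<in> A\<close> by (intro LIMSEQ_le_const2) auto
    qed
  qed
qed

section \<open>The cross-validation criterion\<close>

text \<open>
  The quantiles that leave out a fold are replaced by those from all data, and these by their
  limits. Each replacement costs at most the average difference of the quantiles, because the
  check loss is Lipschitz.
\<close>

lemma CV_close:
  assumes n: "1 \<le> n" and w: "w \<in> weights n"
    and loss: "\<And>i. i \<le> n \<Longrightarrow> loss (resp m i \<omega> - avg_quant_lim p q n w (curve m i \<omega>)) =
      loss (q_err m i \<omega>) + excess_loss n w (obs_pair i \<omega>)"
    and err: "\<And>i J. i \<in> {1..n} \<Longrightarrow> J \<in> cand p n \<Longrightarrow>
      quant_error n i J \<omega> \<le> error_factor \<delta> C2 (L i J)"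
    and L: "\<And>J. J \<in> cand p n \<Longrightarrow> 1 / real n * (\<Sum>i=1..n. L i J) \<le> C1" and \<delta>: "0 \<le> \<delta>"
    and fold: "\<And>k r. k \<in> {1..folds p} \<Longrightarrow> r \<in> {1..grp_size p n} \<Longrightarrow>
      \<bar>avg_quant_est m p n 0 ((k - 1) * grp_size p n + r) w \<omega> - avg_quant_est m p n k ((k - 1) * grp_size p n + r) w \<omega>\<bar> \<le> \<gamma>"
    and \<gamma>: "0 \<le> \<gamma>"
  shows "\<bar>CV m p n \<omega> w - 1 / real n * (\<Sum>i=1..folds p * grp_size p n. loss (q_err m i \<omega>) + excess_loss n w (obs_pair i \<omega>))\<bar>
    \<le> \<gamma> + error_factor \<delta> C2 C1"
proof -
  let ?K = "folds p" and ?G = "grp_size p n"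
  let ?i = "\<lambda>k r. (k - 1) * ?G + r"
  let ?h = "\<lambda>i. loss (q_err m i \<omega>) + excess_loss n w (obs_pair i \<omega>)"
  let ?e = "\<lambda>i J. quant_error n i J \<omega>"
  let ?u = "\<lambda>i. \<Sum>J\<in>cand p n. w J * ?e i J"
  have scale: "\<bar>1 / real n * x\<bar> \<le> 1 / real n * y" if "\<bar>x\<bar> \<le> y" for x y :: real
    using that by (simp add: abs_mult divide_right_mono)
  have mono: "1 / real n * x \<le> 1 / real n * y" if "x \<le> y" for x y :: real
    using that by (simp add: divide_right_mono)
  have N: "?K * ?G \<le> n" unfolding grp_size_def by simp
  have idx: "?i k r \<in> {1..n}" if "k \<in> {1..?K}" "r \<in> {1..?G}" for k r
  proof -
    have "?i k r \<le> (k - 1) * ?G + ?G" using that by simp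
    also have "\<dots> = k * ?G" using that by (cases k) simp_all
    also have "\<dots> \<le> ?K * ?G" using that by simp
    finally show ?thesis using N that by simp
  qed
  have pt: "\<bar>loss (resp m (?i k r) \<omega> - avg_quant_est m p n k (?i k r) w \<omega>) - ?h (?i k r)\<bar> \<le> \<gamma> + ?u (?i k r)"
    if kr: "k \<in> {1..?K}" "r \<in> {1..?G}" for k r
  proof -
    let ?j = "?i k r"
    have "\<bar>loss (resp m ?j \<omega> - avg_quant_est m p n k ?j w \<omega>) - loss (resp m ?j \<omega> - avg_quant_est m p n 0 ?j w \<omega>)\<bar> \<le> \<gamma>"
      using check_loss_lipschitz[OF qlev, of "resp m ?j \<omega> - avg_quant_est m p n k ?j w \<omega>" "resp m ?j \<omega> - avg_quant_est m p n 0 ?j w \<omega>"] fold[OF kr]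
      by linarith
    moreover have "\<bar>loss (resp m ?j \<omega> - avg_quant_est m p n 0 ?j w \<omega>) - loss (resp m ?j \<omega> - avg_quant_lim p q n w (curve m ?j \<omega>))\<bar> \<le> ?u ?j"
      unfolding avg_quant_est_def avg_quant_lim_def by (rule loss_avg_diff_le[OF w])
    moreover have "loss (resp m ?j \<omega> - avg_quant_lim p q n w (curve m ?j \<omega>)) = ?h ?j"
      using loss[of ?j] idx[OF kr] by simp
    ultimately show ?thesis by linarith
  qed
  define f where "f k r = loss (resp m (?i k r) \<omega> - avg_quant_est m p n k (?i k r) w \<omega>)" for k r
  define h where "h i = ?h i" for i
  define u where "u i = ?u i" for i
  have fh: "\<bar>f k r - h (?i k r)\<bar> \<le> \<gamma> + u (?i k r)" if "k \<in> {1..?K}" "r \<in> {1..?G}" for k r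
    using pt[OF that] unfolding f_def h_def u_def .
  have "CV m p n \<omega> w - 1 / real n * (\<Sum>i=1..?K * ?G. h i) = 1 / real n * (\<Sum>k=1..?K. \<Sum>r=1..?G. f k r - h (?i k r))"
    unfolding CV_def f_def[symmetric] sum_blocks[symmetric] right_diff_distrib[symmetric] sum_subtractf ..
  also have "\<bar>\<dots>\<bar> \<le> 1 / real n * (\<Sum>k=1..?K. \<Sum>r=1..?G. \<gamma> + u (?i k r))"
    using fh by (intro scale order_trans[OF sum_abs] sum_mono)
  also have "(\<Sum>k=1..?K. \<Sum>r=1..?G. \<gamma> + u (?i k r)) = (\<Sum>i=1..?K * ?G. \<gamma> + u i)"
    by (rule sum_blocks)
  also have "1 / real n * \<dots> \<le> 1 / real n * (\<Sum>i=1..n. \<gamma> + u i)"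
  proof (rule mono, rule sum_mono2)
    show "{1..?K * ?G} \<subseteq> {1..n}" using N by simp
    show "0 \<le> \<gamma> + u i" for i unfolding u_def using \<gamma> weighted_nonneg[OF w] by (rule add_nonneg_nonneg)
  qed simp
  also have "(\<Sum>i=1..n. \<gamma> + u i) = real n * \<gamma> + (\<Sum>J\<in>cand p n. w J * (\<Sum>i=1..n. ?e i J))"
  proof -
    have "(\<Sum>i=1..n. u i) = (\<Sum>J\<in>cand p n. \<Sum>i=1..n. w J * ?e i J)" unfolding u_def by (rule sum.swap)
    then show ?thesis by (simp add: sum.distrib sum_distrib_left)
  qed
  also have "1 / real n * \<dots> = \<gamma> + (\<Sum>J\<in>cand p n. w J * (1 / real n * (\<Sum>i=1..n. ?e i J)))"
    using n by (simp add: distrib_left sum_distrib_left mult.left_commute)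
  also have "(\<Sum>J\<in>cand p n. w J * (1 / real n * (\<Sum>i=1..n. ?e i J))) \<le> error_factor \<delta> C2 C1"
  proof (rule weighted_sum_le[OF w])
    fix J assume J: "J \<in> cand p n"
    have "1 / real n * (\<Sum>i=1..n. ?e i J) \<le> 1 / real n * (\<Sum>i=1..n. error_factor \<delta> C2 (L i J))"
      using err[OF _ J] by (intro mult_left_mono sum_mono) simp_all
    also have "\<dots> = error_factor \<delta> C2 (1 / real n * (\<Sum>i=1..n. L i J))"
      using n unfolding error_factor_def by (simp add: distrib_left sum.distrib sum_distrib_left[symmetric] add_divide_distrib)
    also have "\<dots> \<le> error_factor \<delta> C2 C1"
      using L[OF J] \<delta> unfolding error_factor_def by (intro mult_left_mono add_left_mono)
    finally show "1 / real n * (\<Sum>i=1..n. ?e i J) \<le> error_factor \<delta> C2 C1" .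
  qed
  finally show ?thesis unfolding h_def by simp
qed

lemma error_factor_le:
  assumes "0 \<le> c'" "c' \<le> 1" "0 \<le> C" "0 \<le> C2" "0 \<le> C1"
  shows "error_factor (C * c') C2 C1 \<le> error_factor C C2 C1 * c'"
proof -
  have "C * c' * (1 + 2 * (C2 + C * c' * dom_length) + C1) \<le> C * c' * (1 + 2 * (C2 + C * 1 * dom_length) + C1)"
    using assms by (intro mult_left_mono add_mono mult_right_mono order_refl) simp_all
  then show ?thesis unfolding error_factor_def by (simp add: mult.commute mult.left_commute)
qed

lemma AE_CV_minimizer: "AE \<omega> in prb m. \<forall>n\<ge>1. what n \<omega> \<in> weights n \<and>
    (\<forall>w\<in>weights n. CV m p n \<omega> (what n \<omega>) \<le> CV m p n \<omega> w)"
proof -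
  have "AE \<omega> in prb m. \<forall>n\<ge>1. is_arg_min (CV m p n \<omega>) (\<lambda>w. w \<in> weights n) (what n \<omega>)"
    using CV_weights unfolding CV_weights_def .
  then show ?thesis unfolding is_arg_min_def by (rule AE_mp) (intro AE_I2, force simp: not_less)
qed

section \<open>The ratio of prediction errors\<close>

definition rate :: "nat \<Rightarrow> real" where
  "rate n = c n + g n + model_rate n"

lemma c_g: "0 \<le> c n" "0 \<le> g n" "c \<longlonglongrightarrow> 0"
  using cond1 cond3 unfolding condition1_def condition3_def by blast+

lemma eta_pos: "\<forall>\<^sub>F n in sequentially. 0 < eta m p q n"
proof -
  have "\<forall>\<^sub>F n in sequentially. eta m p q n \<noteq> 0" using cond4 unfolding condition4_def by blast
  moreover have "\<forall>\<^sub>F n::nat in sequentially. 1 \<le> n" by (rule eventually_ge_at_top)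
  ultimately show ?thesis
  proof eventually_elim
    case (elim n)
    obtain J where J: "J \<in> cand p n" using cand[OF elim(2)] by blast
    have "(\<lambda>j. if j = J then 1 else 0) \<in> weights n"
      unfolding weight_set_def using J cand[OF elim(2)] by simp
    then have "0 \<le> (INF w\<in>weights n. risk_lim n w)"
      by (intro cINF_greatest EFPE_lim_nonneg[OF elim(2)]) blast+
    then have "0 \<le> eta m p q n" unfolding eta_def by simp
    then show ?case using elim(1) by simp
  qed
qed

lemma EFPE_lim_ge:
  assumes "1 \<le> n" "w \<in> weights n"
  shows "eta m p q n / real n \<le> risk_lim n w"
proof -
  have "bdd_below (risk_lim n ` weights n)"
    using EFPE_lim_nonneg[OF assms(1)] by (intro bdd_belowI[of _ 0]) blast
  from cINF_lower[OF this assms(2)] show ?thesis using assms(1) unfolding eta_def by simp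
qed

lemma rate_tendsto: "(\<lambda>n. risk_scale n * rate n) \<longlonglongrightarrow> 0"
proof -
  have "(\<lambda>n. risk_scale n * c n + risk_scale n * g n
     + inverse (eta m p q n) * sqrt (real n) * sqrt (real (card (cand p n)))) \<longlonglongrightarrow> 0 + 0 + 0"
    using cond4 unfolding condition4_def by (intro tendsto_add) blast+
  moreover have "risk_scale n * c n + risk_scale n * g n
     + inverse (eta m p q n) * sqrt (real n) * sqrt (real (card (cand p n))) = risk_scale n * rate n" for n
  proof -
    have "real n / sqrt (real n) = sqrt (real n)" by (rule real_div_sqrt) simp
    then have "real n * model_rate n = sqrt (real n) * sqrt (real (card (cand p n)))"
      by (metis mult.commute times_divide_eq_left times_divide_eq_right)
    then show ?thesis unfolding rate_def by (simp only: distrib_left mult.assoc)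
  qed
  ultimately show ?thesis by simp
qed

text \<open>
  The minimiser of the criterion is compared with the infimum of \<open>EFPE\<close> by \<open>minimizer_ratio\<close>,
  with \<open>EFPE_lim\<close> in the middle. The number of subjects used in cross-validation is at least half
  of the sample size, and \<open>EFPE_lim\<close> is at least \<open>eta m p q n / n\<close>, which is eventually at
  least twice the error of \<open>EFPE\<close>.
\<close>

lemma EFPE_ratio_big_Op:
  "big_Op (prb m) (\<lambda>n \<omega>. EFPE_ratio m p FPE what n \<omega> - 1) (\<lambda>n. risk_scale n * rate n)"
  unfolding big_Op_def
proof (intro allI impI)
  fix e :: real assume "0 < e"
  \<comment> \<open>There are nine exceptional events: five from \<open>condition1\<close>, two from \<open>bounded_limits\<close>,
    one from \<open>condition3\<close>, and the deviation of the empirical risk.\<close>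
  then have e: "0 < e / 9" by simp
  note c1 = cond1[unfolded condition1_def, THEN conjunct2, THEN conjunct2]
  note c5 = c1[THEN conjunct2, THEN conjunct2, THEN conjunct2]
  note b3 = bounded[unfolded bounded_limits_def, THEN conjunct2, THEN conjunct2]
  obtain Ca where Ca: "0 \<le> Ca" "\<forall>\<^sub>F n in sequentially. likely (prb m) (e/9) (\<lambda>\<omega>. \<forall>J\<in>cand p n.
      \<bar>fst (coef p n 0 J \<omega>) - icept_lim q n J\<bar> \<le> Ca * \<bar>c n\<bar>)"
    using unif_Op_likely[OF c1[THEN conjunct1] e] by blast
  obtain Cb where Cb: "0 \<le> Cb" "\<forall>\<^sub>F n in sequentially. likely (prb m) (e/9) (\<lambda>\<omega>. \<forall>x\<in>cand p n \<times> dom_of m.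
      \<bar>(case x of (J, t) \<Rightarrow> \<lambda>\<omega>. slope_est p n 0 J \<omega> t - slope_lim q n J t) \<omega>\<bar> \<le> Cb * \<bar>c n\<bar>)"
    using unif_Op_likely[OF c1[THEN conjunct2, THEN conjunct1] e] by blast
  obtain Cm where Cm: "0 \<le> Cm" "\<forall>\<^sub>F n in sequentially. likely (prb m) (e/9) (\<lambda>\<omega>. \<forall>t\<in>dom_of m.
      \<bar>mean_est (fit p n 0 \<omega>) t - mean_fun m t\<bar> \<le> Cm * \<bar>c n\<bar>)"
    using unif_Op_likely[OF c1[THEN conjunct2, THEN conjunct2, THEN conjunct1] e] by blast
  obtain Cx where Cx: "0 \<le> Cx" "\<forall>\<^sub>F n in sequentially. likely (prb m) (e/9) (\<lambda>\<omega>. \<forall>x\<in>{1..n} \<times> cand p n \<times> dom_of m.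
      \<bar>(case x of (i, J, t) \<Rightarrow> \<lambda>\<omega>. curve_est m p n i J \<omega> t - curve_lim q n i J \<omega> t) \<omega>\<bar> \<le> Cx * \<bar>c n\<bar>)"
    using unif_Op_likely[OF c5[THEN conjunct1] e] by blast
  obtain Cd where Cd: "0 \<le> Cd" "\<forall>\<^sub>F n in sequentially. likely (prb m) (e/9) (\<lambda>\<omega>. \<forall>x\<in>cand p n \<times> dom_of m.
      \<bar>(case x of (J, t) \<Rightarrow> \<lambda>\<omega>. D n J t \<omega>) \<omega>\<bar> \<le> Cd * \<bar>c n\<bar>)"
    using unif_Op_likely[OF c5[THEN conjunct2, THEN conjunct2] e] by blast
  obtain CL where CL: "0 \<le> CL" "\<forall>\<^sub>F n in sequentially. likely (prb m) (e/9) (\<lambda>\<omega>. \<forall>J\<in>cand p n.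
      \<bar>1 / real n * (\<Sum>i=1..n. LINT t:dom_of m|lborel. \<bar>curve_lim q n i J \<omega> t - mean_fun m t\<bar>)\<bar> \<le> CL * \<bar>1\<bar>)"
    using unif_Op_likely[OF b3[THEN conjunct1] e] by blast
  obtain CC where CC: "0 \<le> CC" "\<forall>\<^sub>F n in sequentially. likely (prb m) (e/9) (\<lambda>\<omega>. \<forall>J\<in>cand p n.
      \<bar>cond_exp n (\<lambda>\<omega>. LINT t:dom_of m|lborel. \<bar>curve_lim q n 0 J \<omega> t - mean_fun m t\<bar>) \<omega>\<bar> \<le> CC * \<bar>1\<bar>)"
    using unif_Op_likely[OF b3[THEN conjunct2, THEN conjunct2] e] by blast
  obtain Cg where Cg: "0 \<le> Cg" "\<forall>\<^sub>F n in sequentially. likely (prb m) (e/9) (\<lambda>\<omega>. \<forall>x\<in>weights n \<times> {1..folds p} \<times> {1..grp_size p n}.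
      \<bar>(case x of (w, k, r) \<Rightarrow> \<lambda>\<omega>. avg_quant_est m p n 0 ((k - 1) * grp_size p n + r) w \<omega> -
          avg_quant_est m p n k ((k - 1) * grp_size p n + r) w \<omega>) \<omega>\<bar> \<le> Cg * \<bar>g n\<bar>)"
    using unif_Op_likely[OF cond3[unfolded condition3_def, THEN conjunct2, THEN conjunct2] e] by blast
  obtain C2' where C2': "\<forall>\<^sub>F n in sequentially. \<forall>J\<in>cand p n.
        set_integrable lborel (dom_of m) (slope_lim q n J) \<and> (LINT t:dom_of m|lborel. \<bar>slope_lim q n J t\<bar>) \<le> C2'"
    using bounded unfolding bounded_limits_def by blast
  define C2 where "C2 = max 0 C2'"
  have C2: "0 \<le> C2" "C2' \<le> C2" unfolding C2_def by simp_all
  define C where "C = Ca + Cb + Cm + Cx + Cd"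
  have C: "0 \<le> C" "Ca \<le> C" "Cb \<le> C" "Cm \<le> C" "Cx \<le> C" "Cd \<le> C"
    unfolding C_def using Ca(1) Cb(1) Cm(1) Cx(1) Cd(1) by simp_all
  define K1 where "K1 = error_factor C C2 CC"
  define K2 where "K2 = error_factor C C2 CL"
  define K3 where "K3 = (4 / (e/9) + 2) * dev_bound"
  have K: "0 \<le> K1" "0 \<le> K2" "0 \<le> K3"
    unfolding K1_def K2_def K3_def error_factor_def using C C2 CC(1) CL(1) dev_bound(1) e by simp_all
  define K where "K = 2 * (2 * K1 + 4 * (Cg + K2 + K3))"
  have ev1: "\<forall>\<^sub>F n in sequentially. 2 * folds p \<le> n" by (rule eventually_ge_at_top)
  have ev2: "\<forall>\<^sub>F n in sequentially. c n < 1" using c_g(3) by (rule order_tendstoD) simp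
  have "(\<lambda>n. risk_scale n * c n) \<longlonglongrightarrow> 0" using cond4 unfolding condition4_def by blast
  then have "(\<lambda>n. K1 * (risk_scale n * c n)) \<longlonglongrightarrow> K1 * 0" by (intro tendsto_intros)
  then have ev3: "\<forall>\<^sub>F n in sequentially. K1 * (risk_scale n * c n) < 1 / 2"
    by (rule order_tendstoD) simp
  have "\<forall>\<^sub>F n in sequentially. likely (prb m) e (\<lambda>\<omega>. \<bar>EFPE_ratio m p FPE what n \<omega> - 1\<bar> \<le>
            K * \<bar>risk_scale n * rate n\<bar>)"
    using Ca(2) Cb(2) Cm(2) Cx(2) Cd(2) CL(2) CC(2) Cg(2) C2' ev1 ev2 ev3 eta_pos
  proof eventually_elim
    case (elim n)
    note ev = elim
    have nf: "folds p \<le> n" and n: "1 \<le> n" using elim(10) folds by simp_all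
    define \<delta> where "\<delta> = C * c n"
    have \<delta>: "0 \<le> \<delta>" unfolding \<delta>_def using C c_g by simp
    have up: "C' * \<bar>c n\<bar> \<le> \<delta>" if "C' \<le> C" for C'
      unfolding \<delta>_def using that c_g(1)[of n] by (simp add: mult_right_mono)
    note likely_conj[OF elim(1) likely_conj[OF elim(2) likely_conj[OF elim(3) likely_conj[OF elim(4)
      likely_conj[OF elim(5) likely_conj[OF elim(6) likely_conj[OF elim(7) likely_conj[OF elim(8)
      likely_empirical_risk[OF nf e]]]]]]]]]
    from this[unfolded likely_def] obtain A where A: "A \<in> events" "1 - e \<le> prob A" and good:
      "\<And>\<omega> J. \<omega> \<in> A \<Longrightarrow> J \<in> cand p n \<Longrightarrow> \<bar>fst (coef p n 0 J \<omega>) - icept_lim q n J\<bar> \<le> Ca * \<bar>c n\<bar>"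
      "\<And>\<omega> J t. \<omega> \<in> A \<Longrightarrow> J \<in> cand p n \<Longrightarrow> t \<in> dom_of m \<Longrightarrow> \<bar>slope_est p n 0 J \<omega> t - slope_lim q n J t\<bar> \<le> Cb * \<bar>c n\<bar>"
      "\<And>\<omega> t. \<omega> \<in> A \<Longrightarrow> t \<in> dom_of m \<Longrightarrow> \<bar>mean_est (fit p n 0 \<omega>) t - mean_fun m t\<bar> \<le> Cm * \<bar>c n\<bar>"
      "\<And>\<omega> i J t. \<omega> \<in> A \<Longrightarrow> i \<in> {1..n} \<Longrightarrow> J \<in> cand p n \<Longrightarrow> t \<in> dom_of m \<Longrightarrow>
        \<bar>curve_est m p n i J \<omega> t - curve_lim q n i J \<omega> t\<bar> \<le> Cx * \<bar>c n\<bar>"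
      "\<And>\<omega> J t. \<omega> \<in> A \<Longrightarrow> J \<in> cand p n \<Longrightarrow> t \<in> dom_of m \<Longrightarrow> \<bar>D n J t \<omega>\<bar> \<le> Cd * \<bar>c n\<bar>"
      "\<And>\<omega> J. \<omega> \<in> A \<Longrightarrow> J \<in> cand p n \<Longrightarrow> \<bar>1 / real n * (\<Sum>i=1..n. curve_size n i J \<omega>)\<bar> \<le> CL"
      "\<And>\<omega> J. \<omega> \<in> A \<Longrightarrow> J \<in> cand p n \<Longrightarrow> \<bar>cond_exp n (curve_size n 0 J) \<omega>\<bar> \<le> CC"
      "\<And>\<omega> w k r. \<omega> \<in> A \<Longrightarrow> w \<in> weights n \<Longrightarrow> k \<in> {1..folds p} \<Longrightarrow> r \<in> {1..grp_size p n} \<Longrightarrow>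
        \<bar>avg_quant_est m p n 0 ((k - 1) * grp_size p n + r) w \<omega> - avg_quant_est m p n k ((k - 1) * grp_size p n + r) w \<omega>\<bar> \<le> Cg * \<bar>g n\<bar>"
      "\<And>\<omega> w. \<omega> \<in> A \<Longrightarrow> w \<in> weights n \<Longrightarrow> 1 / real n * \<bar>\<Sum>i=1..folds p * grp_size p n. excess_loss n w (obs_pair i \<omega>) - risk_lim n w\<bar>
        \<le> K3 * model_rate n"
      unfolding set_integral_dom K3_def by force
    note est = order_trans[OF good(1) up[OF C(2)]] order_trans[OF good(2) up[OF C(3)]] order_trans[OF good(3) up[OF C(4)]]
      order_trans[OF good(4) up[OF C(5)]] order_trans[OF good(5) up[OF C(6)]]
    have s: "integrable dom_measure (slope_lim q n J)" "(\<integral>t. \<bar>slope_lim q n J t\<bar> \<partial>dom_measure) \<le> C2" if "J \<in> cand p n" for J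
      using bspec[OF elim(9) that] C2(2) unfolding set_integrable_dom set_integral_dom by simp_all
    have \<kappa>: "error_factor \<delta> C2 CC \<le> K1 * c n" "error_factor \<delta> C2 CL \<le> K2 * c n"
      unfolding \<delta>_def K1_def K2_def using c_g(1)[of n] elim(11) C(1) C2(1) CC(1) CL(1) by (simp_all add: error_factor_le)
    have close: "AE \<omega> in prb m. \<omega> \<in> A \<longrightarrow> (\<forall>w\<in>weights n. \<bar>EFPE m FPE n w \<omega> - risk_lim n w\<bar> \<le> error_factor \<delta> C2 CC)"
      using good(7) by (intro AE_EFPE_close[OF n \<delta> CC(1) C2(1) A(1) s] est) (simp_all add: set_integral_dom)
    let ?l = "Cg * g n + K2 * c n + K3 * model_rate n"
    have "AE \<omega> in prb m. \<omega> \<in> A \<longrightarrow> \<bar>EFPE_ratio m p FPE what n \<omega> - 1\<bar> \<le> K * \<bar>risk_scale n * rate n\<bar>"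
      using close AE_sample_error[OF n \<delta>, of C2] AE_excess_loss[OF n] AE_CV_minimizer
    proof eventually_elim
      case (elim \<omega>)
      note close = elim(1) and sample = elim(2) and loss = elim(3) and min = elim(4)
      show ?case
      proof
        assume \<omega>: "\<omega> \<in> A"
        let ?N = "folds p * grp_size p n"
        let ?b = "1 / real n * (\<Sum>i=1..?N. loss (q_err m i \<omega>))"
        let ?\<theta> = "real ?N / real n"
        have "2 * ?N \<ge> n"
        proof -
          have "n = ?N + n mod folds p" unfolding grp_size_def by simp
          moreover have "n mod folds p < folds p" using folds by simp
          ultimately show ?thesis using ev(10) by linarith
        qed
        then have \<theta>: "1 / 2 \<le> ?\<theta>" using n by (simp add: field_simps flip: of_nat_mult)
        have err: "quant_error n i J \<omega>
            \<le> error_factor \<delta> C2 (curve_size n i J \<omega>)"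
          if "i \<in> {1..n}" "J \<in> cand p n" for i J
          using bspec[OF bspec[OF sample that(1)] that(2)] est(1-4)[OF \<omega>] that s[OF that(2)] by blast
        have V: "\<bar>CV m p n \<omega> w - ?b - ?\<theta> * risk_lim n w\<bar> \<le> ?l" if w: "w \<in> weights n" for w
        proof -
          have "\<bar>CV m p n \<omega> w - 1 / real n * (\<Sum>i=1..?N. loss (q_err m i \<omega>) + excess_loss n w (obs_pair i \<omega>))\<bar>
              \<le> Cg * g n + error_factor \<delta> C2 CL"
          proof (rule CV_close[OF n w _ err _ \<delta>])
            show "0 \<le> Cg * g n" using Cg(1) c_g by simp
            show "loss (resp m i \<omega> - avg_quant_lim p q n w (curve m i \<omega>)) =
              loss (q_err m i \<omega>) + excess_loss n w (obs_pair i \<omega>)" if "i \<le> n" for i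
              using loss that w by blast
            show "1 / real n * (\<Sum>i=1..n. curve_size n i J \<omega>) \<le> CL" if "J \<in> cand p n" for J
              using good(6)[OF \<omega> that] by linarith
          qed (use good(8)[OF \<omega> w] c_g(2)[of n] in simp_all)
          moreover have "\<bar>1 / real n * (\<Sum>i=1..?N. excess_loss n w (obs_pair i \<omega>) - risk_lim n w)\<bar>
              \<le> K3 * model_rate n"
            using good(9)[OF \<omega> w] by (simp add: abs_mult)
          moreover have "1 / real n * (\<Sum>i=1..?N. loss (q_err m i \<omega>) + excess_loss n w (obs_pair i \<omega>))
              - ?b - ?\<theta> * risk_lim n w = 1 / real n * (\<Sum>i=1..?N. excess_loss n w (obs_pair i \<omega>) - risk_lim n w)"
            by (simp add: sum.distrib sum_subtractf add_divide_distrib diff_divide_distrib)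
          ultimately show ?thesis using \<kappa>(2) by linarith
        qed
        have "\<bar>EFPE_ratio m p FPE what n \<omega> - 1\<bar> \<le> (2 * (K1 * c n) + 4 * ?l) * (2 / (eta m p q n / real n))"
          unfolding EFPE_ratio_def
        proof (rule minimizer_ratio[where V="CV m p n \<omega>" and S="risk_lim n" and b="?b" and \<theta>="?\<theta>"])
          show "what n \<omega> \<in> weights n" using min n by blast
          show "CV m p n \<omega> (what n \<omega>) \<le> CV m p n \<omega> w" if "w \<in> weights n" for w using min n that by blast
          show "\<bar>EFPE m FPE n w \<omega> - risk_lim n w\<bar> \<le> K1 * c n" if "w \<in> weights n" for w
            using close \<omega> that \<kappa>(1) by force
          show "\<bar>CV m p n \<omega> w - ?b - ?\<theta> * risk_lim n w\<bar> \<le> ?l" if "w \<in> weights n" for w by (rule V[OF that])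
          show "1 / 2 \<le> ?\<theta>" by (rule \<theta>)
          show "eta m p q n / real n \<le> risk_lim n w" if "w \<in> weights n" for w by (rule EFPE_lim_ge[OF n that])
          show "0 < eta m p q n / real n" using ev(13) n by simp
          show "K1 * c n \<le> eta m p q n / real n / 2" using ev(12,13) n by (simp add: field_simps)
        qed
        also have "\<dots> = (2 * (2 * K1 + 4 * K2) * c n + 8 * Cg * g n + 8 * K3 * model_rate n)
            * (risk_scale n)"
          by (simp add: divide_inverse algebra_simps)
        also have "\<dots> \<le> (K * rate n) * (risk_scale n)"
        proof (rule mult_right_mono)
          have "2 * (2 * K1 + 4 * K2) * c n \<le> K * c n" "8 * Cg * g n \<le> K * g n"
            "8 * K3 * model_rate n \<le> K * model_rate n"
            unfolding K_def using K Cg(1) c_g(1,2)[of n] by (intro mult_right_mono; simp)+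
          then show "2 * (2 * K1 + 4 * K2) * c n + 8 * Cg * g n + 8 * K3 * model_rate n \<le> K * rate n"
            unfolding rate_def distrib_left by linarith
        qed (use ev(13) in simp)
        also have "\<dots> = K * \<bar>risk_scale n * rate n\<bar>"
        proof -
          have "0 \<le> rate n" unfolding rate_def using c_g by simp
          then show ?thesis using ev(13) by (simp add: abs_mult)
        qed
        finally show "\<bar>EFPE_ratio m p FPE what n \<omega> - 1\<bar> \<le> K * \<bar>risk_scale n * rate n\<bar>" .
      qed
    qed
    with likelyI[OF A(1,2)] show ?case by (rule likely_AE)
  qed
  then show "\<exists>C. \<forall>\<^sub>F n in sequentially. \<exists>A\<in>events. 1 - e \<le> prob A \<and>
      (\<forall>\<omega>\<in>A. \<bar>EFPE_ratio m p FPE what n \<omega> - 1\<bar> \<le> C * \<bar>risk_scale n * rate n\<bar>)"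
    unfolding likely_def by (rule exI)
qed

end

theorem theorem1:
  fixes m :: "'w fq_model" and p :: "'w fq_proc" and q :: "'w fq_limits"
    and c g :: "nat \<Rightarrow> real"
    and D :: "nat \<Rightarrow> nat \<Rightarrow> real \<Rightarrow> 'w \<Rightarrow> real"
    and FPE :: "nat \<Rightarrow> (nat \<Rightarrow> real) \<Rightarrow> 'w \<Rightarrow> real"
    and what :: "nat \<Rightarrow> 'w \<Rightarrow> nat \<Rightarrow> real"
  assumes "curve_model m" and "quantile_model m" and "observation_model m"
    and "estimation m p" and "FPE_version m p FPE" and "CV_weights m p what"
    and "limit_objects m p q" and "bounded_limits m p q"
    and "condition1 m p q D c" and "condition2 m p q"
    and "condition3 m p g" and "condition4 m p q c g"
  shows "big_Op (prb m) (\<lambda>n \<omega>. EFPE_ratio m p FPE what n \<omega> - 1)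
           (\<lambda>n. inverse (eta m p q n) * real n *
              (c n + g n + sqrt (real (card (cand p n))) / sqrt (real n)))
       \<and> little_op1 (prb m) (\<lambda>n \<omega>. EFPE_ratio m p FPE what n \<omega> - 1)"
proof -
  interpret quantile_averaging m p q c g D FPE what
    by unfold_locales fact+
  show ?thesis
    using EFPE_ratio_big_Op big_Op_null_imp_little_op1[OF EFPE_ratio_big_Op rate_tendsto]
    unfolding rate_def by blast
qed

end
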